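(* Let $n\ge1$ and $k\ge 1$ be integers, and let $L$ and $L'$ be two $n$-component welded string links. The following are equivalent: (i) $\mu_L(I)=\mu_{L'}(I)$ for any sequence $I$ of indices in $\{1,\ldots,n\}$ with $r(I)\le k$; (ii) the $k$-reduced $i$th longitudes $\lambda^k_i(L)$ and $\lambda^k_i(L')$ are congruent modulo $J_i^k$, for all $i\in\{1,\ldots,n\}$; (iii) $L$ and $L'$ induce the same $k$-reduced free action $\varphi_L^{(k)}=\varphi_{L'}^{(k)}\in \mathrm{Aut}_c(R_kF_n)$.
   Context: **Welded string links.** Fix points $p_1<\dots<p_n$ in $(0,1)$. An $n$-component welded string link diagram is an immersion in $[0,1]\times[0,1]$ of $n$ disjoint copies of the unit interval, the $i$th running from $p_i\times\{0\}$ to $p_i\times\{1\}$, whose double points are transverse and are each either a classical crossing (with over/under information) or a virtual crossing. A welded string link is such a diagram up to welded equivalence, generated by planar isotopy, the three Reidemeister moves on classical crossings, the OC move (over-crossings commute; on Gauss diagrams, exchange of two adjacent arrow tails, where arrows point from the over-passing to the under-passing point) and the Detour move (an arc with only virtual crossings, possibly none, may be replaced by any other such arc with the same endpoints). **Group, longitudes, Milnor invariants.** Write $\overline a$ for $a^{-1}$. An arc of a diagram of $L$ runs from one under-passing point (or string endpoint) to the next along a component (it may contain virtual crossings). Let $a_{i,1},\ldots,a_{i,m_i+1}$ be the successive arcs of the $i$th component, and let $b_{i,j}=a^{\varepsilon}$, where $a$ is the overpassing arc at the classical crossing between $a_{i,j}$ and $a_{i,j+1}$, and $\varepsilon=\pm1$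 is the sign of the crossing. The group of $L$ is $G(L)=\langle a_{i,j}\mid a_{i,j+1}=\overline b_{i,j}a_{i,j}b_{i,j},\ 1\le i\le n,\ 1\le j\le m_i\rangle$. The preferred $i$th longitude is $\lambda_i(L)=\overline a_{i,1}^{\,f_i}b_{i,1}\cdots b_{i,m_i}$, where $f_i$ is the sum of signs of the classical self-crossings of the $i$th component. Let $\Gamma_qG$ denote the lower central series ($\Gamma_1G=G$, $\Gamma_{q+1}G=[G,\Gamma_qG]$). The images $\alpha_i$ of $a_{i,1}$ generate $G(L)/\Gamma_qG(L)$ for each $q\ge2$, so the image of $\lambda_i(L)$ is represented by a word in $\alpha_1,\ldots,\alpha_n$. Let $F_n$ be the free group on $\alpha_1,\ldots,\alpha_n$ and $E:F_n\to\mathbb Z\langle\langle X_1,\ldots,X_n\rangle\rangle$, $\alpha_i\mapsto 1+X_i$, the Magnus expansion (noncommuting variables). For $I=j_1\cdots j_l\,i$ with $1\le l<q$, the welded Milnor invariant $\mu_L(I)\in\mathbb Z$ is the coefficient of $X_{j_1}\cdots X_{j_l}$ in $E(\lambda_i(L))$; it is independent of $q>l$. $r(I)$ is the maximum number of times that any index appears in $I$. **$k$-reduced groups and action.** Let $N_i$ be the normal subgroup of $F_n$ generated by $\alpha_i$, and set $$J^k=\Gamma_{k+1}N_1\cdots\Gamma_{k+1}N_n,\qquad J_i^k=\Gamma_{k+1}N_1\cdots\Gamma_{k}N_i\cdots\Gamma_{k+1}N_n$$ (with $\Gamma_kN_i$ in the $i$th position and $\Gamma_{k+1}N_j$ for $j\ne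 i$), so $J^k\subset J_i^k$. Set $R_kF_n=F_n/J^k$. Similarly $R_kG(L)$ is the quotient of $G(L)$ by the product of the $\Gamma_{k+1}$'s of the normal subgroups generated by each $a_{i,1}$. The map $\alpha_i\mapsto a_{i,1}$ induces an isomorphism $R_kF_n\simeq R_kG(L)$, and the $k$-reduced $i$th longitude $\lambda_i^k(L)\in R_kF_n$ is the element corresponding to the preferred $i$th longitude. $\mathrm{Aut}_c(R_kF_n)$ is the set of automorphisms of $R_kF_n$ sending each generator $\alpha_i$ to a conjugate of itself. $\varphi_L^{(k)}\in\mathrm{Aut}_c(R_kF_n)$ is given by $\alpha_i\mapsto\overline{\lambda_i^k(L)}\,\alpha_i\,\lambda_i^k(L)$. *)

theory Defs
  imports "HOL-Algebra.Bij" "HOL-Algebra.Ring" "HOL-Algebra.Generated_Groups" "HOL-Analysis.Analysis"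
begin

section \<open>Group presentations and free groups\<close>

text \<open>The letter \<open>(x, True)\<close> stands for the generator \<open>x\<close> and \<open>(x, False)\<close> for its inverse.\<close>

type_synonym 'a letter = "'a \<times> bool"
type_synonym 'a word = "'a letter list"

definition inv_letter :: "'a letter \<Rightarrow> 'a letter" where
  "inv_letter l = (fst l, \<not> snd l)"

abbreviation words :: "'a set \<Rightarrow> 'a word set" where
  "words S \<equiv> lists (S \<times> UNIV)"

text \<open>A pair \<open>(r, r')\<close> of words in \<open>R\<close> stands for the relation \<open>r = r'\<close>.\<close>

inductive_set word_rel :: "'a set \<Rightarrow> ('a word \<times> 'a word) set \<Rightarrow> ('a word \<times> 'a word) set"
  for S :: "'a set" and R :: "('a word \<times> 'a word) set" where
  refl: "u \<in> words S \<Longrightarrow> (u, u) \<in> word_rel S R"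
| sym: "(u, v) \<in> word_rel S R \<Longrightarrow> (v, u) \<in> word_rel S R"
| trans: "(u, v) \<in> word_rel S R \<Longrightarrow> (v, w) \<in> word_rel S R \<Longrightarrow> (u, w) \<in> word_rel S R"
| cancel: "u \<in> words S \<Longrightarrow> v \<in> words S \<Longrightarrow> fst l \<in> S \<Longrightarrow>
    (u @ [l, inv_letter l] @ v, u @ v) \<in> word_rel S R"
| relation: "u \<in> words S \<Longrightarrow> v \<in> words S \<Longrightarrow> (r, r') \<in> R \<Longrightarrow>
    (u @ r @ v, u @ r' @ v) \<in> word_rel S R"

definition presented_group :: "'a set \<Rightarrow> ('a word \<times> 'a word) set \<Rightarrow> 'a word set monoid" where
  "presented_group S R =
    \<lparr>carrier = words S // word_rel S R,
     Group.monoid.mult = (\<lambda>A B. \<Union>u\<in>A. \<Union>v\<in>B. word_rel S R `` {u @ v}),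
     one = word_rel S R `` {[]}\<rparr>"

definition free_group :: "'a set \<Rightarrow> 'a word set monoid" where
  "free_group S = presented_group S {}"

definition free_gen :: "'a set \<Rightarrow> 'a \<Rightarrow> 'a word set" where
  "free_gen S x = word_rel S {} `` {[(x, True)]}"

text \<open>The homomorphism from the free group on \<open>S\<close> to the group \<open>H\<close> that extends \<open>f\<close>.\<close>

definition free_lift :: "'a set \<Rightarrow> ('b, 'm) monoid_scheme \<Rightarrow> ('a \<Rightarrow> 'b) \<Rightarrow> 'a word set \<Rightarrow> 'b" where
  "free_lift S H f =
    (THE h. h \<in> hom (free_group S) H \<inter> extensional (carrier (free_group S)) \<and>
            (\<forall>x\<in>S. h (free_gen S x) = f x))"

section \<open>Lower central series and reduced quotients\<close>

definition commutator_subgroup :: "('a, 'm) monoid_scheme \<Rightarrow> 'a set \<Rightarrow> 'a set \<Rightarrow> 'a set" where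
  "commutator_subgroup G H K =
    generate G {x \<otimes>\<^bsub>G\<^esub> y \<otimes>\<^bsub>G\<^esub> inv\<^bsub>G\<^esub> x \<otimes>\<^bsub>G\<^esub> inv\<^bsub>G\<^esub> y | x y. x \<in> H \<and> y \<in> K}"

text \<open>\<open>lower_central G H q\<close> is \<open>\<Gamma>\<^sub>q H\<close> for a subgroup \<open>H\<close> of \<open>G\<close> and \<open>q \<ge> 1\<close>; the value at \<open>q = 0\<close>
  is a dummy.\<close>

primrec lower_central :: "('a, 'm) monoid_scheme \<Rightarrow> 'a set \<Rightarrow> nat \<Rightarrow> 'a set" where
  "lower_central G H 0 = H"
| "lower_central G H (Suc q) =
    (if q = 0 then H else commutator_subgroup G H (lower_central G H q))"

definition normal_closure :: "('a, 'm) monoid_scheme \<Rightarrow> 'a set \<Rightarrow> 'a set" where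
  "normal_closure G A = \<Inter>{N. N \<lhd> G \<and> A \<subseteq> N}"

text \<open>\<open>\<Gamma>\<^bsub>e 1\<^esub>N\<^sub>1 \<cdots> \<Gamma>\<^bsub>e n\<^esub>N\<^sub>n\<close>, where \<open>N\<^sub>j\<close> is the normal subgroup generated by \<open>x j\<close>.\<close>

definition gamma_product ::
  "('a, 'm) monoid_scheme \<Rightarrow> nat \<Rightarrow> (nat \<Rightarrow> 'a) \<Rightarrow> (nat \<Rightarrow> nat) \<Rightarrow> 'a set" where
  "gamma_product G n x e =
    foldr (\<lambda>j A. lower_central G (normal_closure G {x j}) (e j) <#>\<^bsub>G\<^esub> A) [1..<n+1] {\<one>\<^bsub>G\<^esub>}"

abbreviation FG :: "nat \<Rightarrow> nat word set monoid" where
  "FG n \<equiv> free_group {1..n}"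

abbreviation alpha :: "nat \<Rightarrow> nat \<Rightarrow> nat word set" where
  "alpha n \<equiv> free_gen {1..n}"

definition JK :: "nat \<Rightarrow> nat \<Rightarrow> nat word set set" where
  "JK n k = gamma_product (FG n) n (alpha n) (\<lambda>_. k + 1)"

definition J_at :: "nat \<Rightarrow> nat \<Rightarrow> nat \<Rightarrow> nat word set set" where
  "J_at n k i = gamma_product (FG n) n (alpha n) ((\<lambda>_. k + 1)(i := k))"

definition RF :: "nat \<Rightarrow> nat \<Rightarrow> nat word set set monoid" where
  "RF n k = FG n Mod JK n k"

definition RF_gen :: "nat \<Rightarrow> nat \<Rightarrow> nat \<Rightarrow> nat word set set" where
  "RF_gen n k i = JK n k #>\<^bsub>FG n\<^esub> alpha n i"

text \<open>The image of \<open>J_at n k i\<close> in \<open>RF n k\<close>.\<close>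

definition RJ_at :: "nat \<Rightarrow> nat \<Rightarrow> nat \<Rightarrow> nat word set set set" where
  "RJ_at n k i = (\<lambda>g. JK n k #>\<^bsub>FG n\<^esub> g) ` J_at n k i"

definition Aut_c :: "nat \<Rightarrow> nat \<Rightarrow> (nat word set set \<Rightarrow> nat word set set) set" where
  "Aut_c n k = {\<phi> \<in> auto (RF n k). \<forall>i\<in>{1..n}. \<exists>g\<in>carrier (RF n k).
     \<phi> (RF_gen n k i) = inv\<^bsub>RF n k\<^esub> g \<otimes>\<^bsub>RF n k\<^esub> RF_gen n k i \<otimes>\<^bsub>RF n k\<^esub> g}"

section \<open>Magnus expansion\<close>

text \<open>The ring \<open>\<int>\<langle>\<langle>X\<^sub>1,\<dots>,X\<^sub>n\<rangle>\<rangle>\<close>: a series is given by its coefficients, the monomial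
  \<open>X\<^bsub>j\<^sub>1\<^esub>\<cdots>X\<^bsub>j\<^sub>l\<^esub>\<close> being encoded by the list \<open>[j\<^sub>1,\<dots>,j\<^sub>l]\<close>.\<close>

definition nc_series :: "nat \<Rightarrow> (nat list \<Rightarrow> int) ring" where
  "nc_series n =
    \<lparr>carrier = {f. \<forall>w. f w \<noteq> 0 \<longrightarrow> set w \<subseteq> {1..n}},
     Group.monoid.mult = (\<lambda>f g w. \<Sum>i\<le>length w. f (take i w) * g (drop i w)),
     one = (\<lambda>w. if w = [] then 1 else 0),
     zero = (\<lambda>w. 0),
     add = (\<lambda>f g w. f w + g w)\<rparr>"

definition nc_var :: "nat \<Rightarrow> nat list \<Rightarrow> int" where
  "nc_var i = (\<lambda>w. if w = [i] then 1 else 0)"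

definition magnus :: "nat \<Rightarrow> nat word set \<Rightarrow> nat list \<Rightarrow> int" where
  "magnus n = free_lift {1..n} (units_of (nc_series n))
    (\<lambda>i. \<one>\<^bsub>nc_series n\<^esub> \<oplus>\<^bsub>nc_series n\<^esub> nc_var i)"

section \<open>Welded string link diagrams\<close>

text \<open>A site \<open>(i, t)\<close> is the point with parameter \<open>t\<close> of the \<open>i\<close>th strand.\<close>

type_synonym site = "nat \<times> real"

text \<open>\<open>(x, y) \<in> classical D\<close> means that there is a classical crossing at which the site \<open>x\<close> passes
  over the site \<open>y\<close>; the remaining double points are virtual crossings.\<close>

record link_diagram =
  strand :: "nat \<Rightarrow> real \<Rightarrow> real \<times> real"
  classical :: "(site \<times> site) set"

definition sites :: "nat \<Rightarrow> site set" where
  "sites n = {1..n} \<times> {0..1}"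

definition pt :: "link_diagram \<Rightarrow> site \<Rightarrow> real \<times> real" where
  "pt D x = strand D (fst x) (snd x)"

definition tangent :: "link_diagram \<Rightarrow> site \<Rightarrow> real \<times> real" where
  "tangent D x = vector_derivative (strand D (fst x)) (at (snd x) within {0..1})"

definition cross2 :: "real \<times> real \<Rightarrow> real \<times> real \<Rightarrow> real" where
  "cross2 u v = fst u * snd v - snd u * fst v"

definition double_points :: "nat \<Rightarrow> link_diagram \<Rightarrow> (site \<times> site) set" where
  "double_points n D = {(x, y). x \<in> sites n \<and> y \<in> sites n \<and> x \<noteq> y \<and> pt D x = pt D y}"

definition square :: "(real \<times> real) set" where
  "square = {0..1} \<times> {0..1}"

definition immersed_path :: "(real \<Rightarrow> real \<times> real) \<Rightarrow> bool" where
  "immersed_path \<gamma> \<longleftrightarrow> (\<exists>\<gamma>'. continuous_on {0..1} \<gamma>' \<and>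
     (\<forall>t\<in>{0..1}. (\<gamma> has_vector_derivative \<gamma>' t) (at t within {0..1}) \<and> \<gamma>' t \<noteq> 0))"

definition string_link_diagram :: "(nat \<Rightarrow> real) \<Rightarrow> nat \<Rightarrow> link_diagram \<Rightarrow> bool" where
  "string_link_diagram p n D \<longleftrightarrow>
     (\<forall>i\<in>{1..n}. immersed_path (strand D i) \<and> strand D i ` {0..1} \<subseteq> square \<and>
                 strand D i 0 = (p i, 0) \<and> strand D i 1 = (p i, 1)) \<and>
     finite (double_points n D) \<and>
     (\<forall>(x, y)\<in>double_points n D. cross2 (tangent D x) (tangent D y) \<noteq> 0 \<and>
                 (\<forall>z\<in>sites n. pt D z = pt D x \<longrightarrow> z = x \<or> z = y)) \<and>
     classical D \<subseteq> double_points n D \<and>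
     (\<forall>(x, y)\<in>classical D. (y, x) \<notin> classical D)"

section \<open>Welded equivalence\<close>

text \<open>Planar isotopy: an ambient isotopy \<open>H\<close> of the square rel boundary, up to orientation-preserving
  reparametrisations \<open>r i\<close> of the strands.\<close>

definition planar_isotopic :: "nat \<Rightarrow> link_diagram \<Rightarrow> link_diagram \<Rightarrow> bool" where
  "planar_isotopic n D D' \<longleftrightarrow> (\<exists>(H :: real \<Rightarrow> real \<times> real \<Rightarrow> real \<times> real) (r :: nat \<Rightarrow> real \<Rightarrow> real).
     continuous_on ({0..1} \<times> square) (\<lambda>(u, x). H u x) \<and>
     (\<forall>u\<in>{0..1}. (\<exists>g. homeomorphism square square (H u) g) \<and>
                 (\<forall>x\<in>frontier square. H u x = x)) \<and>
     (\<forall>x\<in>square. H 0 x = x) \<and>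
     (\<forall>i\<in>{1..n}. strict_mono_on {0..1} (r i) \<and> continuous_on {0..1} (r i) \<and>
                 r i ` {0..1} = {0..1} \<and>
                 (\<forall>t\<in>{0..1}. strand D' i t = H 1 (strand D i (r i t)))) \<and>
     (\<forall>x\<in>sites n. \<forall>y\<in>sites n. (x, y) \<in> classical D' \<longleftrightarrow>
        ((fst x, r (fst x) (snd x)), (fst y, r (fst y) (snd y))) \<in> classical D))"

text \<open>A piece \<open>(i, s, t)\<close> is the part of the \<open>i\<close>th strand with parameters in \<open>[s, t]\<close>.\<close>

type_synonym piece = "nat \<times> real \<times> real"

fun piece_sites :: "piece \<Rightarrow> site set" where
  "piece_sites (i, s, t) = {i} \<times> {s..t}"

fun piece_interior :: "piece \<Rightarrow> site set" where
  "piece_interior (i, s, t) = {i} \<times> {s<..<t}"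

definition pieces_sites :: "piece list \<Rightarrow> site set" where
  "pieces_sites Ps = (\<Union>P\<in>set Ps. piece_sites P)"

definition proper_piece :: "nat \<Rightarrow> piece \<Rightarrow> bool" where
  "proper_piece n P \<longleftrightarrow> (case P of (i, s, t) \<Rightarrow> i \<in> {1..n} \<and> 0 \<le> s \<and> s < t \<and> t \<le> 1)"

text \<open>\<open>D\<close> and \<open>D'\<close> coincide outside a disc \<open>B\<close> in the open square, and each of them meets \<open>B\<close> exactly
  in the disjoint pieces \<open>Ps\<close>, which are properly embedded or immersed in \<open>B\<close>.\<close>

definition differ_in_disc :: "nat \<Rightarrow> piece list \<Rightarrow> link_diagram \<Rightarrow> link_diagram \<Rightarrow> bool" where
  "differ_in_disc n Ps D D' \<longleftrightarrow>
     (\<forall>P\<in>set Ps. proper_piece n P) \<and>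
     (\<forall>a<length Ps. \<forall>b<a. piece_sites (Ps ! a) \<inter> piece_sites (Ps ! b) = {}) \<and>
     (\<exists>B. B \<subseteq> interior square \<and> B homeomorphic cball (0 :: real \<times> real) 1 \<and>
        (\<forall>E\<in>{D, D'}. {x \<in> sites n. pt E x \<in> B} = pieces_sites Ps \<and>
           {x \<in> sites n. pt E x \<in> interior B} = (\<Union>P\<in>set Ps. piece_interior P))) \<and>
     (\<forall>x\<in>sites n - (\<Union>P\<in>set Ps. piece_interior P). pt D x = pt D' x) \<and>
     (\<forall>x\<in>sites n - pieces_sites Ps. \<forall>y\<in>sites n - pieces_sites Ps.
        (x, y) \<in> classical D \<longleftrightarrow> (x, y) \<in> classical D')"

definition double_points_on :: "nat \<Rightarrow> piece list \<Rightarrow> link_diagram \<Rightarrow> (site \<times> site) set" where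
  "double_points_on n Ps D = {(x, y) \<in> double_points n D. x \<in> pieces_sites Ps}"

definition reidemeister1 :: "nat \<Rightarrow> link_diagram \<Rightarrow> link_diagram \<Rightarrow> bool" where
  "reidemeister1 n D D' \<longleftrightarrow> (\<exists>P x y.
     differ_in_disc n [P] D D' \<and>
     double_points_on n [P] D = {} \<and>
     double_points_on n [P] D' = {(x, y), (y, x)} \<and>
     (x, y) \<in> classical D')"

definition reidemeister2 :: "nat \<Rightarrow> link_diagram \<Rightarrow> link_diagram \<Rightarrow> bool" where
  "reidemeister2 n D D' \<longleftrightarrow> (\<exists>P Q x y x' y'.
     differ_in_disc n [P, Q] D D' \<and>
     double_points_on n [P, Q] D = {} \<and>
     double_points_on n [P, Q] D' = {(x, y), (y, x), (x', y'), (y', x')} \<and> x \<noteq> x' \<and>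
     x \<in> piece_sites P \<and> x' \<in> piece_sites P \<and> y \<in> piece_sites Q \<and> y' \<in> piece_sites Q \<and>
     {(x, y), (x', y')} \<subseteq> classical D')"

text \<open>Three pieces that pairwise cross once, \<open>P\<close> passing over \<open>Q\<close> and \<open>R\<close>; the crossing of \<open>Q\<close> and
  \<open>R\<close> is classical with \<open>Q\<close> over \<open>R\<close>, or virtual, according to \<open>c\<close>.\<close>

definition triangle :: "nat \<Rightarrow> bool \<Rightarrow> piece \<Rightarrow> piece \<Rightarrow> piece \<Rightarrow> link_diagram \<Rightarrow> bool" where
  "triangle n c P Q R D \<longleftrightarrow> (\<exists>x y x' z y' z'.
     double_points_on n [P, Q, R] D =
       {(x, y), (y, x), (x', z), (z, x'), (y', z'), (z', y')} \<and>
     x \<in> piece_sites P \<and> x' \<in> piece_sites P \<and> y \<in> piece_sites Q \<and> y' \<in> piece_sites Q \<and>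
     z \<in> piece_sites R \<and> z' \<in> piece_sites R \<and>
     {(x, y), (x', z)} \<subseteq> classical D \<and>
     (if c then (y', z') \<in> classical D
      else (y', z') \<notin> classical D \<and> (z', y') \<notin> classical D))"

definition reidemeister3 :: "nat \<Rightarrow> link_diagram \<Rightarrow> link_diagram \<Rightarrow> bool" where
  "reidemeister3 n D D' \<longleftrightarrow> (\<exists>P Q R.
     differ_in_disc n [P, Q, R] D D' \<and> triangle n True P Q R D \<and> triangle n True P Q R D')"

definition over_crossings_commute :: "nat \<Rightarrow> link_diagram \<Rightarrow> link_diagram \<Rightarrow> bool" where
  "over_crossings_commute n D D' \<longleftrightarrow> (\<exists>P Q R.
     differ_in_disc n [P, Q, R] D D' \<and> triangle n False P Q R D \<and> triangle n False P Q R D')"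

definition detour :: "nat \<Rightarrow> link_diagram \<Rightarrow> link_diagram \<Rightarrow> bool" where
  "detour n D D' \<longleftrightarrow> (\<exists>P. proper_piece n P \<and>
     (\<forall>x\<in>sites n - piece_interior P. pt D x = pt D' x) \<and>
     classical D = classical D' \<and>
     (\<forall>(x, y)\<in>classical D. x \<notin> piece_sites P \<and> y \<notin> piece_sites P))"

definition welded_move :: "(nat \<Rightarrow> real) \<Rightarrow> nat \<Rightarrow> link_diagram \<Rightarrow> link_diagram \<Rightarrow> bool" where
  "welded_move p n D D' \<longleftrightarrow> string_link_diagram p n D \<and> string_link_diagram p n D' \<and>
     (planar_isotopic n D D' \<or> reidemeister1 n D D' \<or> reidemeister2 n D D' \<or>
      reidemeister3 n D D' \<or> over_crossings_commute n D D' \<or> detour n D D')"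

definition welded_string_links :: "(nat \<Rightarrow> real) \<Rightarrow> nat \<Rightarrow> link_diagram set set" where
  "welded_string_links p n =
    {D. string_link_diagram p n D} //
    {(D, D'). string_link_diagram p n D \<and> string_link_diagram p n D' \<and>
              equivclp (welded_move p n) D D'}"

section \<open>The group and the longitudes\<close>

text \<open>With the strands running upwards, a crossing is positive iff (over tangent, under tangent) is a
  positive basis of the plane.\<close>

definition crossing_sign :: "link_diagram \<Rightarrow> site \<times> site \<Rightarrow> int" where
  "crossing_sign D c = (if cross2 (tangent D (fst c)) (tangent D (snd c)) > 0 then 1 else -1)"

definition under_times :: "link_diagram \<Rightarrow> nat \<Rightarrow> real set" where
  "under_times D i = {t. \<exists>x. (x, (i, t)) \<in> classical D}"

abbreviation under_number :: "link_diagram \<Rightarrow> nat \<Rightarrow> nat" where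
  "under_number D i \<equiv> card (under_times D i)"

text \<open>The pair \<open>(i, j)\<close> stands for the \<open>j\<close>th arc \<open>a\<^bsub>i,j\<^esub>\<close> of the \<open>i\<close>th strand.\<close>

definition arcs :: "nat \<Rightarrow> link_diagram \<Rightarrow> (nat \<times> nat) set" where
  "arcs n D = (SIGMA i:{1..n}. {1..under_number D i + 1})"

text \<open>The arc containing a given site, which is not an under-passing point.\<close>

definition arc_of :: "link_diagram \<Rightarrow> site \<Rightarrow> nat \<times> nat" where
  "arc_of D x = (fst x, card {t \<in> under_times D (fst x). t < snd x} + 1)"

text \<open>The crossing (over site, under site) between \<open>a\<^bsub>i,j\<^esub>\<close> and \<open>a\<^bsub>i,j+1\<^esub>\<close>.\<close>

definition crossing_at :: "link_diagram \<Rightarrow> nat \<Rightarrow> nat \<Rightarrow> site \<times> site" where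
  "crossing_at D i j =
    (let y = (i, sorted_list_of_set (under_times D i) ! (j - 1))
     in (THE x. (x, y) \<in> classical D, y))"

definition over_letter :: "link_diagram \<Rightarrow> nat \<Rightarrow> nat \<Rightarrow> (nat \<times> nat) letter" where
  "over_letter D i j =
    (arc_of D (fst (crossing_at D i j)), crossing_sign D (crossing_at D i j) = 1)"

definition link_relations :: "nat \<Rightarrow> link_diagram \<Rightarrow> ((nat \<times> nat) word \<times> (nat \<times> nat) word) set" where
  "link_relations n D =
    {([((i, j + 1), True)],
      [inv_letter (over_letter D i j), ((i, j), True), over_letter D i j]) | i j.
      i \<in> {1..n} \<and> j \<in> {1..under_number D i}}"

definition link_group :: "nat \<Rightarrow> link_diagram \<Rightarrow> (nat \<times> nat) word set monoid" where
  "link_group n D = presented_group (arcs n D) (link_relations n D)"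

definition word_class :: "nat \<Rightarrow> link_diagram \<Rightarrow> (nat \<times> nat) word \<Rightarrow> (nat \<times> nat) word set" where
  "word_class n D w = word_rel (arcs n D) (link_relations n D) `` {w}"

definition meridian :: "nat \<Rightarrow> link_diagram \<Rightarrow> nat \<Rightarrow> (nat \<times> nat) word set" where
  "meridian n D i = word_class n D [((i, 1), True)]"

definition framing :: "link_diagram \<Rightarrow> nat \<Rightarrow> int" where
  "framing D i = (\<Sum>c\<in>{(x, y) \<in> classical D. fst x = i \<and> fst y = i}. crossing_sign D c)"

definition longitude :: "nat \<Rightarrow> link_diagram \<Rightarrow> nat \<Rightarrow> (nat \<times> nat) word set" where
  "longitude n D i =
    (inv\<^bsub>link_group n D\<^esub> meridian n D i) [^]\<^bsub>link_group n D\<^esub> framing D i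
    \<otimes>\<^bsub>link_group n D\<^esub> word_class n D (map (over_letter D i) [1..<under_number D i + 1])"

section \<open>Milnor invariants\<close>

definition meridian_map :: "nat \<Rightarrow> link_diagram \<Rightarrow> nat word set \<Rightarrow> (nat \<times> nat) word set" where
  "meridian_map n D = free_lift {1..n} (link_group n D) (meridian n D)"

text \<open>For \<open>I = j\<^sub>1\<cdots>j\<^sub>l i\<close> with \<open>l \<ge> 1\<close>: any \<open>q > l\<close> and any \<open>w \<in> F\<^sub>n\<close> that represents the longitude in
  \<open>G(L)/\<Gamma>\<^sub>q G(L)\<close> yield the same value \<open>m\<close>.\<close>

definition milnor :: "nat \<Rightarrow> link_diagram \<Rightarrow> nat list \<Rightarrow> int" where
  "milnor n D I =
    (let G = link_group n D; \<Gamma> = lower_central G (carrier G) in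
     THE m. \<exists>q w. length (butlast I) < q \<and> w \<in> carrier (FG n) \<and>
       \<Gamma> q #>\<^bsub>G\<^esub> meridian_map n D w = \<Gamma> q #>\<^bsub>G\<^esub> longitude n D (last I) \<and>
       m = magnus n w (butlast I))"

definition max_repetition :: "nat list \<Rightarrow> nat" where
  "max_repetition I = Max (count_list I ` set I)"

section \<open>Reduced longitudes and the reduced free action\<close>

definition RG_kernel :: "nat \<Rightarrow> nat \<Rightarrow> link_diagram \<Rightarrow> (nat \<times> nat) word set set" where
  "RG_kernel n k D = gamma_product (link_group n D) n (meridian n D) (\<lambda>_. k + 1)"

definition RG :: "nat \<Rightarrow> nat \<Rightarrow> link_diagram \<Rightarrow> (nat \<times> nat) word set set monoid" where
  "RG n k D = link_group n D Mod RG_kernel n k D"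

text \<open>The isomorphism \<open>R\<^sub>kF\<^sub>n \<simeq> R\<^sub>kG(L)\<close> induced by \<open>\<alpha>\<^sub>i \<mapsto> a\<^bsub>i,1\<^esub>\<close>.\<close>

definition reduced_meridian_map ::
  "nat \<Rightarrow> nat \<Rightarrow> link_diagram \<Rightarrow> nat word set set \<Rightarrow> (nat \<times> nat) word set set" where
  "reduced_meridian_map n k D =
    (THE h. h \<in> iso (RF n k) (RG n k D) \<inter> extensional (carrier (RF n k)) \<and>
       (\<forall>i\<in>{1..n}. h (RF_gen n k i) = RG_kernel n k D #>\<^bsub>link_group n D\<^esub> meridian n D i))"

definition reduced_longitude :: "nat \<Rightarrow> nat \<Rightarrow> link_diagram \<Rightarrow> nat \<Rightarrow> nat word set set" where
  "reduced_longitude n k D i =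
    inv_into (carrier (RF n k)) (reduced_meridian_map n k D)
      (RG_kernel n k D #>\<^bsub>link_group n D\<^esub> longitude n D i)"

definition reduced_action ::
  "nat \<Rightarrow> nat \<Rightarrow> link_diagram \<Rightarrow> nat word set set \<Rightarrow> nat word set set" where
  "reduced_action n k D = (THE \<phi>. \<phi> \<in> Aut_c n k \<and> (\<forall>i\<in>{1..n}. \<phi> (RF_gen n k i) =
     inv\<^bsub>RF n k\<^esub> reduced_longitude n k D i \<otimes>\<^bsub>RF n k\<^esub> RF_gen n k i \<otimes>\<^bsub>RF n k\<^esub> reduced_longitude n k D i))"

end

theory Submission
  imports Defs "HOL-Library.List_Lexorder"
begin

text \<open>The Magnus expansion identifies the product of the \<open>\<Gamma>\<^bsub>e j\<^esub>N\<^sub>j\<close> with the set of all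
  \<open>g \<in> F\<^sub>n\<close> for which \<open>E(g) - 1\<close> vanishes at every word in which each index \<open>j\<close> occurs less than \<open>e j\<close>
  times. One inclusion is a degree count. For the other one, \<open>\<Gamma>\<^sub>q/\<Gamma>\<^bsub>q+1\<^esub>\<close> is generated by the commutators
  of the Lyndon words of length \<open>q\<close>, and the leading Magnus term of such a commutator is its Lyndon
  word plus larger words of the same content; so the exponent of each Lyndon word of admissible
  content can be read off the coefficients and is zero, while the remaining commutators lie in the
  product. As \<open>\<Gamma>\<^sub>q\<close> is contained in the product for large \<open>q\<close>, finitely many steps suffice.

  Milnor's recursive approximations of the arcs by words in the meridians invert
  \<open>F\<^sub>n/\<Gamma>\<^sub>q \<rightarrow> G(L)/\<Gamma>\<^sub>q\<close>, so one lift to \<open>F\<^sub>n\<close> of the longitude for a large \<open>q\<close> computes both the Milnor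
  invariants and the reduced longitude; with the identification above this gives the equivalence of
  (i) and (ii). For (iii), the two actions agree iff the quotient of the longitudes commutes with
  \<open>\<alpha>\<^sub>i\<close> modulo \<open>J\<^sup>k\<close>. Comparing coefficients, this happens iff its Magnus expansion agrees up to \<open>J\<^sub>i\<^sup>k\<close>
  with that of a power of \<open>\<alpha>\<^sub>i\<close>, and that power is trivial because the longitudes are preferred.\<close>

section \<open>Commutators and the lower central series\<close>

text \<open>All three conditions are turned into the same membership in \<open>F\<^sub>n\<close>:
  \<open>inv (l i) \<otimes> l' i\<close> lies in \<open>J_at n k i\<close>, where
  \<open>l i\<close> and \<open>l' i\<close> lift the longitudes. The level \<open>n * k\<close> of
  the lifts serves two purposes: a commutator of weight above \<open>n * k\<close> in
  \<open>n\<close> generators repeats one of them more than \<open>k\<close> times, and a word in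
  which no index occurs more than \<open>k\<close> times has at most \<open>n * k\<close> letters.
  The exponents \<open>e\<close> are kept arbitrary, since \<open>J\<^sup>k\<close> and
  \<open>J\<^sub>i\<^sup>k\<close> have different ones. The obstacle is that admissibility concerns
  the content of a word, not its length, whereas the lower central series is filtered by length. The
  descent goes by length, so it needs generators of \<open>\<Gamma>\<^sub>q\<close> modulo the next
  term that are compatible with content as well; the Lyndon commutators are. The Milnor invariants,
  the reduced longitudes and the action are defined by definite descriptions. That these are met, in
  particular that the reduced meridian map is an isomorphism and the action an automorphism, is
  proved here and not presupposed.\<close>

definition gcomm :: "('a, 'm) monoid_scheme \<Rightarrow> 'a \<Rightarrow> 'a \<Rightarrow> 'a" where
  "gcomm G x y = x \<otimes>\<^bsub>G\<^esub> y \<otimes>\<^bsub>G\<^esub> inv\<^bsub>G\<^esub> x \<otimes>\<^bsub>G\<^esub> inv\<^bsub>G\<^esub> y"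

lemma commutator_subgroup_gcomm:
  "commutator_subgroup G H K = generate G {gcomm G x y | x y. x \<in> H \<and> y \<in> K}"
  by (simp add: commutator_subgroup_def gcomm_def)

declare lower_central.simps(2) [simp del]

lemma lower_central_1 [simp]: "lower_central G H (Suc 0) = H"
  by (simp add: lower_central.simps(2))

lemma lower_central_Suc:
  "1 \<le> q \<Longrightarrow> lower_central G H (Suc q) = generate G {gcomm G x y | x y. x \<in> H \<and> y \<in> lower_central G H q}"
  by (simp add: lower_central.simps(2) commutator_subgroup_gcomm)

context Group.group
begin

abbreviation comm :: "'a \<Rightarrow> 'a \<Rightarrow> 'a" where
  "comm \<equiv> gcomm G"

abbreviation lcs :: "nat \<Rightarrow> 'a set" where
  "lcs \<equiv> lower_central G (carrier G)"

lemma mult_inv_cancel [simp]: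
  assumes "x \<in> carrier G" "y \<in> carrier G"
  shows "x \<otimes> (inv x \<otimes> y) = y" and "inv x \<otimes> (x \<otimes> y) = y"
  using assms by (simp_all flip: m_assoc)

lemma comm_closed [simp]: "x \<in> carrier G \<Longrightarrow> y \<in> carrier G \<Longrightarrow> comm x y \<in> carrier G"
  by (simp add: gcomm_def)

lemma inv_gcomm: "x \<in> carrier G \<Longrightarrow> y \<in> carrier G \<Longrightarrow> inv (comm x y) = comm y x"
  by (simp add: gcomm_def inv_mult_group m_assoc)

lemma comm_swap_mem:
  assumes "subgroup S G" "x \<in> carrier G" "y \<in> carrier G"
  shows "comm x y \<in> S \<longleftrightarrow> comm y x \<in> S"
  by (metis assms inv_gcomm subgroup.m_inv_closed)

lemma conj_comm:
  assumes "x \<in> carrier G" "y \<in> carrier G" "g \<in> carrier G"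
  shows "g \<otimes> comm x y \<otimes> inv g = comm (g \<otimes> x \<otimes> inv g) (g \<otimes> y \<otimes> inv g)"
  using assms by (simp add: gcomm_def inv_mult_group m_assoc)

text \<open>Multiplicativity in the left argument, up to the correction
  \<open>comm x (comm x' y)\<close>. This correction lies deeper in the lower central series; the
  later uses differ only in why it can be ignored.\<close>

lemma comm_mult_left:
  assumes "x \<in> carrier G" "x' \<in> carrier G" "y \<in> carrier G"
  shows "comm (x \<otimes> x') y = comm x (comm x' y) \<otimes> comm x' y \<otimes> comm x y"
  using assms by (simp add: gcomm_def inv_mult_group m_assoc)

lemma hall_witt:
  assumes "x \<in> carrier G" "y \<in> carrier G" "z \<in> carrier G"
  shows "comm (comm x y) (y \<otimes> z \<otimes> inv y) \<otimes> comm (comm y z) (z \<otimes> x \<otimes> inv z)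
    \<otimes> comm (comm z x) (x \<otimes> y \<otimes> inv x) = \<one>"
  using assms by (simp add: gcomm_def inv_mult_group m_assoc)

lemma normal_subsetD: "N \<lhd> G \<Longrightarrow> x \<in> N \<Longrightarrow> x \<in> carrier G"
  by (meson normal_imp_subgroup subgroup.mem_carrier)

lemma normal_conj_inv:
  "N \<lhd> G \<Longrightarrow> x \<in> carrier G \<Longrightarrow> h \<in> N \<Longrightarrow> inv x \<otimes> h \<otimes> x \<in> N"
  by (simp add: normal.inv_op_closed1)

lemma normal_comm:
  assumes "N \<lhd> G" "x \<in> N" "y \<in> carrier G"
  shows "comm x y \<in> N" "comm y x \<in> N"
proof -
  interpret N: normal N G by fact
  have x: "x \<in> carrier G" using assms by simp
  have "x \<otimes> (y \<otimes> inv x \<otimes> inv y) \<in> N"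
    using assms by (intro N.m_closed N.inv_op_closed2) auto
  then show "comm x y \<in> N" using x assms by (simp add: gcomm_def m_assoc)
  then show "comm y x \<in> N" using comm_swap_mem[OF N.subgroup_axioms] x assms by simp
qed

text \<open>By \<open>comm_mult_left\<close> the elements whose commutator with \<open>y\<close>
  lies in \<open>S\<close> are closed under products as soon as the correction lies in
  \<open>S\<close>, which is the last assumption. Claims about a generated group then need checking
  on generators only.\<close>

lemma subgroup_comm_mem:
  assumes S: "subgroup S G" and T: "subgroup T G" and y: "y \<in> carrier G"
    and T': "\<And>x x'. x \<in> T \<Longrightarrow> x' \<in> T \<Longrightarrow> comm x' y \<in> S \<Longrightarrow> comm x (comm x' y) \<in> S"
  shows "subgroup {x \<in> T. comm x y \<in> S} G"
proof -
  interpret S: subgroup S G by fact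
  interpret T: subgroup T G by fact
  show ?thesis
  proof (unfold_locales)
    show "{x \<in> T. comm x y \<in> S} \<subseteq> carrier G" by auto
    show "x \<otimes> x' \<in> {x \<in> T. comm x y \<in> S}"
      if "x \<in> {x \<in> T. comm x y \<in> S}" "x' \<in> {x \<in> T. comm x y \<in> S}" for x x'
      using that y T' by (auto simp: comm_mult_left intro!: S.m_closed)
    show "\<one> \<in> {x \<in> T. comm x y \<in> S}" using y by (simp add: gcomm_def)
    show "inv x \<in> {x \<in> T. comm x y \<in> S}" if "x \<in> {x \<in> T. comm x y \<in> S}" for x
    proof -
      have x: "x \<in> T" "comm x y \<in> S" and xc: "x \<in> carrier G" using that by auto
      have "comm (inv x) y = inv (comm x y) \<otimes> inv (comm (inv x) (comm x y))"
        using xc y by (simp add: gcomm_def inv_mult_group m_assoc)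
      moreover have "comm (inv x) (comm x y) \<in> S" using x T' by simp
      ultimately show ?thesis using x by simp
    qed
  qed
qed

lemma subgroup_comm_normal:
  assumes "N \<lhd> G" "y \<in> carrier G"
  shows "subgroup {x \<in> carrier G. comm x y \<in> N} G"
  using assms by (intro subgroup_comm_mem subgroup_self) (auto intro: normal_imp_subgroup normal_comm(2))

lemma commutator_subgroup_normal:
  assumes "H \<lhd> G" "K \<lhd> G"
  shows "commutator_subgroup G H K \<lhd> G"
  unfolding commutator_subgroup_gcomm
proof (rule normal_generateI)
  show "{gcomm G x y |x y. x \<in> H \<and> y \<in> K} \<subseteq> carrier G"
    using assms by (auto intro!: comm_closed dest: normal_subsetD)
next
  fix h g assume "h \<in> {gcomm G x y |x y. x \<in> H \<and> y \<in> K}" and g: "g \<in> carrier G"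
  then obtain x y where xy: "h = comm x y" "x \<in> H" "y \<in> K" by auto
  then have "g \<otimes> h \<otimes> inv g = comm (g \<otimes> x \<otimes> inv g) (g \<otimes> y \<otimes> inv g)"
    using assms g by (simp add: conj_comm normal_subsetD)
  then show "g \<otimes> h \<otimes> inv g \<in> {gcomm G x y |x y. x \<in> H \<and> y \<in> K}"
    using xy assms g by (auto dest: normal_invE)
qed

lemma lower_central_normal: "H \<lhd> G \<Longrightarrow> lower_central G H q \<lhd> G"
  by (induction q) (auto simp: lower_central.simps(2) intro: commutator_subgroup_normal)

lemma lower_central_subgroup: "H \<lhd> G \<Longrightarrow> subgroup (lower_central G H q) G"
  by (simp add: lower_central_normal normal_imp_subgroup)

lemma lower_central_mem_carrier:
  "H \<lhd> G \<Longrightarrow> x \<in> lower_central G H q \<Longrightarrow> x \<in> carrier G"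
  using lower_central_normal normal_subsetD by blast

lemma lower_central_Suc_subset:
  assumes "H \<lhd> G"
  shows "lower_central G H (Suc q) \<subseteq> lower_central G H q"
proof (cases "q = 0")
  case False
  note n = lower_central_normal[OF assms, of q]
  have "generate G {comm x y |x y. x \<in> H \<and> y \<in> lower_central G H q} \<subseteq> lower_central G H q"
    using n assms by (intro generate_subgroup_incl normal_imp_subgroup)
      (auto intro: normal_comm normal_subsetD)
  then show ?thesis using False by (simp add: lower_central_Suc)
qed auto

lemma lower_central_antimono:
  assumes "H \<lhd> G" "q \<le> r"
  shows "lower_central G H r \<subseteq> lower_central G H q"
  using assms(2)
  by (induction r rule: dec_induct) (use lower_central_Suc_subset[OF assms(1)] in blast)+

lemma comm_mem_lower_central:
  assumes "H \<lhd> G" "x \<in> H" "y \<in> lower_central G H q" "1 \<le> q"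
  shows "comm x y \<in> lower_central G H (Suc q)" "comm y x \<in> lower_central G H (Suc q)"
proof -
  show *: "comm x y \<in> lower_central G H (Suc q)"
    using assms by (auto simp: lower_central_Suc intro: generate.incl)
  show "comm y x \<in> lower_central G H (Suc q)"
    using comm_swap_mem[OF lower_central_subgroup[OF assms(1)]] * assms lower_central_mem_carrier normal_subsetD
    by metis
qed

lemma lcs_normal: "lcs q \<lhd> G" and lcs_subgroup: "subgroup (lcs q) G"
  by (simp_all add: lower_central_normal lower_central_subgroup normal_self)

lemma lcs_antimono: "q \<le> r \<Longrightarrow> lcs r \<subseteq> lcs q"
  by (simp add: lower_central_antimono normal_self)

lemma lcs_carrier: "x \<in> lcs q \<Longrightarrow> x \<in> carrier G"
  using lower_central_mem_carrier normal_self by blast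

lemma lcs_1 [simp]: "lcs (Suc 0) = carrier G" "lcs 1 = carrier G" by simp_all

text \<open>The three subgroups argument. For a generator \<open>comm a b\<close> of the term at
  \<open>Suc p\<close>, \<open>hall_witt\<close> expresses \<open>comm (comm a b) y\<close> by two
  brackets in which \<open>b\<close> has the lower index \<open>p\<close>. The index
  \<open>r\<close> varies in the induction because one of the two raises it.\<close>

lemma comm_mem_lower_central_add:
  assumes H: "H \<lhd> G" and xy: "x \<in> lower_central G H p" "y \<in> lower_central G H r" "1 \<le> p" "1 \<le> r"
  shows "comm x y \<in> lower_central G H (p + r)"
  using xy(3,1,2,4)
proof (induction p arbitrary: x y r rule: dec_induct)
  case base
  then show ?case using comm_mem_lower_central(1)[OF H] by simp
next
  case (step p)
  let ?\<Gamma> = "lower_central G H"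
  let ?N = "?\<Gamma> (Suc p + r)"
  note sub = subgroup_comm_normal[OF lower_central_normal[OF H]]
  note carr = lower_central_mem_carrier[OF H]
  have gen: "comm (comm a b) y \<in> ?N" if a: "a \<in> H" and b: "b \<in> ?\<Gamma> p" for a b
  proof -
    have ac: "a \<in> carrier G" using a H normal_subsetD by blast
    have y: "y \<in> carrier G" and bc: "b \<in> carrier G" using step.prems b carr by blast+
    \<comment> \<open>\<open>hall_witt\<close> contains the conjugate
      \<open>b \<otimes> z \<otimes> inv b\<close>, so \<open>z\<close> is chosen to make this equal
      to \<open>y\<close>.\<close>
    define z where "z = inv b \<otimes> y \<otimes> b"
    have zc: "z \<in> carrier G" using y bc z_def by simp
    have z: "z \<in> ?\<Gamma> r" using lower_central_normal[OF H] step.prems bc z_def normal_conj_inv by blast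
    have yz: "y = b \<otimes> z \<otimes> inv b" using y bc by (simp add: z_def m_assoc)
    have "comm b z \<in> ?\<Gamma> (p + r)" using step.IH b z step.prems by simp
    moreover have "z \<otimes> a \<otimes> inv z \<in> H" using a zc H by (blast dest: normal_invE)
    ultimately have 1: "comm (comm b z) (z \<otimes> a \<otimes> inv z) \<in> ?N"
      using comm_mem_lower_central(2)[OF H, of _ _ "p + r"] step.hyps by auto
    have "comm z a \<in> ?\<Gamma> (Suc r)"
      using comm_mem_lower_central(2)[OF H a z] step.prems by simp
    moreover have "a \<otimes> b \<otimes> inv a \<in> ?\<Gamma> p"
      using lower_central_normal[OF H] ac b by (blast dest: normal_invE)
    ultimately have "comm (a \<otimes> b \<otimes> inv a) (comm z a) \<in> ?\<Gamma> (p + Suc r)"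
      by - (rule step.IH, auto)
    then have 2: "comm (comm z a) (a \<otimes> b \<otimes> inv a) \<in> ?N"
      using comm_swap_mem[OF lower_central_subgroup[OF H]] ac bc zc by simp
    let ?A = "comm (comm a b) (b \<otimes> z \<otimes> inv b)" and ?B = "comm (comm b z) (z \<otimes> a \<otimes> inv z)"
      and ?C = "comm (comm z a) (a \<otimes> b \<otimes> inv a)"
    have "?A \<otimes> (?B \<otimes> ?C) = \<one>" using hall_witt[OF ac bc zc] ac bc zc by (simp add: m_assoc)
    then have "?A = inv (?B \<otimes> ?C)" using ac bc zc by (intro inv_equality[symmetric]) auto
    then show ?thesis using 1 2 lower_central_subgroup[OF H] unfolding yz
      by (metis subgroup.m_closed subgroup.m_inv_closed)
  qed
  have "?\<Gamma> (Suc p) \<subseteq> {x \<in> carrier G. comm x y \<in> ?N}"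
    unfolding lower_central_Suc[OF step.hyps(1)]
  proof (rule generate_subgroup_incl)
    show "{comm a b |a b. a \<in> H \<and> b \<in> ?\<Gamma> p} \<subseteq> {x \<in> carrier G. comm x y \<in> ?N}"
      using gen carr normal_subsetD[OF H] by auto
    show "subgroup {x \<in> carrier G. comm x y \<in> ?N} G"
      using step.prems carr by (intro sub) blast
  qed
  then show ?case using step.prems by blast
qed

lemma comm_mem_lcs:
  assumes "x \<in> lcs p" "y \<in> lcs r" "1 \<le> p" "1 \<le> r"
  shows "comm x y \<in> lcs (p + r)"
  by (rule comm_mem_lower_central_add[OF normal_self assms])

text \<open>Commutators of \<open>lcs p\<close> with \<open>lcs r\<close> are bilinear modulo
  \<open>lcs (p + r + 1)\<close>, so it is enough that the subgroup \<open>S\<close> contains that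
  term.\<close>

lemma subgroup_comm_lcs:
  assumes S: "subgroup S G" and p: "1 \<le> p" "1 \<le> r" and sub: "lcs (p + r + 1) \<subseteq> S" and y: "y \<in> lcs r"
  shows "subgroup {x \<in> lcs p. comm x y \<in> S} G" "subgroup {x \<in> lcs p. comm y x \<in> S} G"
proof -
  show *: "subgroup {x \<in> lcs p. comm x y \<in> S} G"
  proof (rule subgroup_comm_mem[OF S lcs_subgroup])
    fix x x' assume x: "x \<in> lcs p" "x' \<in> lcs p"
    then have "comm x (comm x' y) \<in> lcs (p + (p + r))" using y p by (intro comm_mem_lcs) auto
    then show "comm x (comm x' y) \<in> S" using sub lcs_antimono[of "p + r + 1" "p + (p + r)"] p by auto
  qed (use y lcs_carrier in blast)
  have "{x \<in> lcs p. comm x y \<in> S} = {x \<in> lcs p. comm y x \<in> S}"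
    using comm_swap_mem[OF S] y lcs_carrier by blast
  then show "subgroup {x \<in> lcs p. comm y x \<in> S} G" using * by simp
qed

text \<open>\<open>hall_witt\<close> read modulo \<open>lcs (p + r + s + 1)\<close>: replacing
  \<open>y \<otimes> z \<otimes> inv y\<close> by \<open>z\<close> changes the bracket only by
  elements of that term.\<close>

lemma jacobi_mem:
  assumes S: "subgroup S G" and sub: "lcs (p + r + s + 1) \<subseteq> S" and p: "1 \<le> p" "1 \<le> r" "1 \<le> s"
    and x: "x \<in> lcs p" and y: "y \<in> lcs r" and z: "z \<in> lcs s"
    and 1: "comm (comm y z) x \<in> S" and 2: "comm (comm z x) y \<in> S"
  shows "comm (comm x y) z \<in> S"
proof -
  have c: "x \<in> carrier G" "y \<in> carrier G" "z \<in> carrier G" using x y z lcs_carrier by blast+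
  \<comment> \<open>Stated for arbitrary entries, since it is applied to all three cyclic rotations
    of the identity.\<close>
  have tw: "comm (comm x y) (y \<otimes> z \<otimes> inv y) \<in> S \<longleftrightarrow> comm (comm x y) z \<in> S"
    if x: "x \<in> lcs p" and y: "y \<in> lcs r" and z: "z \<in> lcs s" and p: "1 \<le> p" "1 \<le> r" "1 \<le> s"
      and sub: "lcs (p + r + s + 1) \<subseteq> S" for p r s x y z
  proof -
    have c: "x \<in> carrier G" "y \<in> carrier G" "z \<in> carrier G" using x y z lcs_carrier by blast+
    let ?a = "comm x y"
    have a: "?a \<in> lcs (p + r)" using x y p by (intro comm_mem_lcs) auto
    have U: "subgroup {u \<in> lcs s. comm ?a u \<in> S} G"
    proof (rule subgroup_comm_lcs(2)[OF S _ _ _ a])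
      show "lcs (s + (p + r) + 1) \<subseteq> S" using sub by (simp add: add.commute add.left_commute)
    qed (use p in auto)
    have yz: "comm y z \<in> lcs (r + s)" using y z p by (intro comm_mem_lcs) auto
    have "comm ?a (comm y z) \<in> lcs ((p + r) + (r + s))"
      by (rule comm_mem_lcs[OF a yz]) (use p in linarith)+
    moreover have "lcs ((p + r) + (r + s)) \<subseteq> lcs (p + r + s + 1)" using p by (intro lcs_antimono) linarith
    ultimately have "comm ?a (comm y z) \<in> S" using sub by blast
    then have u: "comm y z \<in> {u \<in> lcs s. comm ?a u \<in> S}" using yz lcs_antimono[of s "r + s"] by auto
    have e: "y \<otimes> z \<otimes> inv y = comm y z \<otimes> z" using c by (simp add: gcomm_def m_assoc)
    have e': "inv (comm y z) \<otimes> (y \<otimes> z \<otimes> inv y) = z" unfolding e using c by simp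
    have w: "y \<otimes> z \<otimes> inv y \<in> lcs s" using lcs_normal c z by (blast dest: normal_invE)
    show ?thesis
    proof
      assume "comm ?a (y \<otimes> z \<otimes> inv y) \<in> S"
      with w subgroup.m_closed[OF U subgroup.m_inv_closed[OF U u], of "y \<otimes> z \<otimes> inv y"] show "comm ?a z \<in> S"
        unfolding e' by blast
    next
      assume "comm ?a z \<in> S"
      with z subgroup.m_closed[OF U u, of z] show "comm ?a (y \<otimes> z \<otimes> inv y) \<in> S"
        unfolding e by blast
    qed
  qed
  let ?A = "comm (comm x y) (y \<otimes> z \<otimes> inv y)" and ?B = "comm (comm y z) (z \<otimes> x \<otimes> inv z)"
    and ?C = "comm (comm z x) (x \<otimes> y \<otimes> inv x)"
  have B: "?B \<in> S" using tw[OF y z x p(2,3,1)] sub 1 by (simp add: add.commute add.left_commute)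
  have C: "?C \<in> S" using tw[OF z x y p(3,1,2)] sub 2 by (simp add: add.commute add.left_commute)
  have "?A \<otimes> (?B \<otimes> ?C) = \<one>" using hall_witt c by (simp add: m_assoc)
  then have "?A = inv (?B \<otimes> ?C)" using c by (intro inv_equality[symmetric]) auto
  then have "?A \<in> S" using B C S by (simp add: subgroup.m_closed subgroup.m_inv_closed)
  then show ?thesis using tw[OF x y z p sub] by simp
qed

end

section \<open>Quotients, normal closures and products of lower central terms\<close>

lemma lower_central_mono:
  assumes "Group.group G" "H \<subseteq> H'"
  shows "lower_central G H q \<subseteq> lower_central G H' q"
proof (induction q)
  case (Suc q)
  then have "{gcomm G x y |x y. x \<in> H \<and> y \<in> lower_central G H q}
      \<subseteq> {gcomm G x y |x y. x \<in> H' \<and> y \<in> lower_central G H' q}"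
    using assms(2) by blast
  from group.mono_generate[OF assms(1) this] show ?case
    using assms(2) by (simp add: lower_central.simps(2) commutator_subgroup_gcomm)
qed (use assms in simp)

context Group.group
begin

lemma coset_eq_iff:
  assumes "N \<lhd> G" "x \<in> carrier G" "y \<in> carrier G"
  shows "N #> x = N #> y \<longleftrightarrow> x \<otimes> inv y \<in> N"
proof -
  interpret N: normal N G by fact
  show ?thesis
    using assms N.rcos_module[OF is_group assms(3,2)] N.subgroup_axioms repr_independence rcos_self
    by metis
qed

lemma coset_eq_self_iff:
  assumes "N \<lhd> G" "x \<in> carrier G"
  shows "N #> x = N \<longleftrightarrow> x \<in> N"
  using coset_eq_iff[OF assms one_closed] assms by (simp add: normal_imp_subgroup subgroup.subset)

lemma group_hom_coset:
  assumes "N \<lhd> G"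
  shows "group_hom G (G Mod N) (\<lambda>x. N #> x)"
  using assms by (simp add: group_hom.intro group_hom_axioms.intro normal.factorgroup_is_group
      normal.r_coset_hom_Mod is_group)

lemma coset_mult:
  assumes "N \<lhd> G" "x \<in> carrier G" "y \<in> carrier G"
  shows "(N #> x) \<otimes>\<^bsub>G Mod N\<^esub> (N #> y) = N #> (x \<otimes> y)"
  using assms by (simp add: normal.rcos_sum)

lemma coset_inv:
  assumes "N \<lhd> G" "x \<in> carrier G"
  shows "inv\<^bsub>G Mod N\<^esub> (N #> x) = N #> inv x"
  using group_hom.hom_inv[OF group_hom_coset] assms by metis

lemma coset_eq_mono:
  assumes "N \<lhd> G" "M \<lhd> G" "N \<subseteq> M" "x \<in> carrier G" "y \<in> carrier G" "N #> x = N #> y"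
  shows "M #> x = M #> y"
  using assms coset_eq_iff by blast

text \<open>Two conjugators that agree modulo \<open>lcs q\<close> differ by an element of
  \<open>lcs q\<close>, and its commutator with \<open>a\<close> lies in \<open>lcs (Suc q)\<close>.
  This gain of one degree makes Milnor's recursion stabilize.\<close>

lemma lcs_conj_coset:
  assumes "1 \<le> q" "x \<in> carrier G" "y \<in> carrier G" "a \<in> carrier G" "lcs q #> x = lcs q #> y"
  shows "lcs (Suc q) #> (inv x \<otimes> a \<otimes> x) = lcs (Suc q) #> (inv y \<otimes> a \<otimes> y)"
proof -
  have xy: "x \<otimes> inv y \<in> lcs q" using assms coset_eq_iff lcs_normal by blast
  define c where "c = comm a (x \<otimes> inv y)"
  have c: "c \<in> lcs (Suc q)" "c \<in> carrier G"
    unfolding c_def using assms xy comm_mem_lower_central[OF normal_self] by auto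
  have "inv x \<otimes> a \<otimes> x \<otimes> inv (inv y \<otimes> a \<otimes> y) = inv x \<otimes> c \<otimes> x"
    using assms by (simp add: c_def gcomm_def inv_mult_group m_assoc)
  also have "\<dots> \<in> lcs (Suc q)"
    using lcs_normal assms c normal_conj_inv by blast
  finally show ?thesis
    using assms by (subst coset_eq_iff) (auto intro: lcs_normal)
qed

section \<open>Normal closures and products of normal subgroups\<close>

lemma normal_closure_normal:
  assumes "x \<in> carrier G"
  shows "normal_closure G {x} \<lhd> G"
proof (rule normal_invI)
  have ne: "carrier G \<in> {N. N \<lhd> G \<and> {x} \<subseteq> N}" using assms normal_self by auto
  show "subgroup (normal_closure G {x}) G"
    unfolding normal_closure_def using ne by (intro subgroups_Inter) (auto intro: normal_imp_subgroup)
  show "y \<otimes> h \<otimes> inv y \<in> normal_closure G {x}"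
    if "y \<in> carrier G" "h \<in> normal_closure G {x}" for y h
    using that unfolding normal_closure_def by (auto intro: normal_invE(2))
qed

lemma normal_closure_mem: "x \<in> normal_closure G {x}"
  by (simp add: normal_closure_def)

lemma normal_closure_least: "N \<lhd> G \<Longrightarrow> x \<in> N \<Longrightarrow> normal_closure G {x} \<subseteq> N"
  by (auto simp: normal_closure_def)

lemma normal_set_mult:
  assumes "N \<lhd> G" "K \<lhd> G"
  shows "N <#> K \<lhd> G"
proof (rule normal_invI)
  interpret N: normal N G by fact
  interpret K: normal K G by fact
  have memI: "n \<otimes> k \<in> N <#> K" if "n \<in> N" "k \<in> K" for n k
    using that by (auto simp: set_mult_def)
  show "subgroup (N <#> K) G"
  proof (rule subgroupI)
    show "N <#> K \<subseteq> carrier G" by (auto simp: set_mult_def)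
    show "N <#> K \<noteq> {}" using memI[OF N.one_closed K.one_closed] by auto
  next
    fix a assume "a \<in> N <#> K"
    then obtain n k where nk: "a = n \<otimes> k" "n \<in> N" "k \<in> K" by (auto simp: set_mult_def)
    have "inv a = (inv k \<otimes> inv n \<otimes> k) \<otimes> inv k"
      using nk N.mem_carrier K.mem_carrier by (simp add: inv_mult_group m_assoc)
    then show "inv a \<in> N <#> K"
      using nk memI[of "inv k \<otimes> inv n \<otimes> k" "inv k"] N.inv_op_closed1[of k "inv n"] K.mem_carrier by simp
  next
    fix a b assume "a \<in> N <#> K" "b \<in> N <#> K"
    then obtain n k n' k' where nk: "a = n \<otimes> k" "n \<in> N" "k \<in> K" "b = n' \<otimes> k'" "n' \<in> N" "k' \<in> K"
      by (auto simp: set_mult_def)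
    have "a \<otimes> b = (n \<otimes> (k \<otimes> n' \<otimes> inv k)) \<otimes> (k \<otimes> k')"
      using nk N.mem_carrier K.mem_carrier by (simp add: m_assoc)
    then show "a \<otimes> b \<in> N <#> K"
      using nk memI[of "n \<otimes> (k \<otimes> n' \<otimes> inv k)" "k \<otimes> k'"] N.inv_op_closed2[of k n'] K.mem_carrier by simp
  qed
  fix x h assume x: "x \<in> carrier G" and "h \<in> N <#> K"
  then obtain n k where nk: "h = n \<otimes> k" "n \<in> N" "k \<in> K" by (auto simp: set_mult_def)
  have "x \<otimes> h \<otimes> inv x = (x \<otimes> n \<otimes> inv x) \<otimes> (x \<otimes> k \<otimes> inv x)"
    using nk x N.mem_carrier K.mem_carrier by (simp add: m_assoc)
  then show "x \<otimes> h \<otimes> inv x \<in> N <#> K"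
    using nk x memI N.inv_op_closed2 K.inv_op_closed2 by simp
qed

lemma foldr_set_mult_normal:
  "(\<And>j. j \<in> set js \<Longrightarrow> A j \<lhd> G) \<Longrightarrow> foldr (\<lambda>j B. A j <#> B) js {\<one>} \<lhd> G"
  by (induction js) (auto intro: normal_set_mult one_is_normal)

lemma foldr_set_mult_incl:
  assumes "\<And>j. j \<in> set js \<Longrightarrow> A j \<lhd> G" "j \<in> set js"
  shows "A j \<subseteq> foldr (\<lambda>j B. A j <#> B) js {\<one>}"
  using assms
proof (induction js)
  case (Cons a js)
  let ?B = "foldr (\<lambda>j B. A j <#> B) js {\<one>}"
  have B: "?B \<lhd> G" using Cons.prems by (intro foldr_set_mult_normal) auto
  have a: "A a \<lhd> G" using Cons.prems by simp
  have "A a \<subseteq> A a <#> ?B"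
    using normal_subsetD[OF a] subgroup.one_closed[OF normal_imp_subgroup[OF B]]
    by (force simp: set_mult_def)
  moreover have "?B \<subseteq> A a <#> ?B"
    using normal_subsetD[OF B] subgroup.one_closed[OF normal_imp_subgroup[OF a]]
    by (force simp: set_mult_def)
  ultimately show ?case using Cons by auto
qed auto

lemma foldr_set_mult_least:
  assumes "subgroup S G" "\<And>j. j \<in> set js \<Longrightarrow> A j \<subseteq> S"
  shows "foldr (\<lambda>j B. A j <#> B) js {\<one>} \<subseteq> S"
  using assms(2)
proof (induction js)
  case Nil
  then show ?case using subgroup.one_closed[OF assms(1)] by simp
next
  case (Cons a js)
  then have "A a \<subseteq> S" "foldr (\<lambda>j B. A j <#> B) js {\<one>} \<subseteq> S" by auto
  then show ?case using subgroup.m_closed[OF assms(1)] by (auto simp: set_mult_def)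
qed

end

text \<open>Instantiated by the free group, its quotients and the link group. That the
  \<open>x j\<close> generate, or their conjugates in the case of the link group, is assumed lemma
  by lemma.\<close>

locale group_with_gens = Group.group G for G (structure) +
  fixes n :: nat and x :: "nat \<Rightarrow> 'a"
  assumes gens_carrier [simp]: "j \<in> {1..n} \<Longrightarrow> x j \<in> carrier G"
begin

abbreviation N :: "nat \<Rightarrow> 'a set" where
  "N j \<equiv> normal_closure G {x j}"

abbreviation gprod :: "(nat \<Rightarrow> nat) \<Rightarrow> 'a set" where
  "gprod \<equiv> gamma_product G n x"

lemma N_normal: "j \<in> {1..n} \<Longrightarrow> N j \<lhd> G"
  by (simp add: normal_closure_normal)

lemma gfactor_normal: "j \<in> set [1..<n+1] \<Longrightarrow> lower_central G (N j) (e j) \<lhd> G"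
  by (rule lower_central_normal, rule N_normal) auto

lemma gprod_normal: "gprod e \<lhd> G"
  unfolding gamma_product_def by (rule foldr_set_mult_normal) (rule gfactor_normal)

lemma gprod_incl: "j \<in> {1..n} \<Longrightarrow> lower_central G (N j) (e j) \<subseteq> gprod e"
  unfolding gamma_product_def by (rule foldr_set_mult_incl) (rule gfactor_normal, auto)

lemma gprod_least:
  assumes "subgroup S G" "\<And>j. j \<in> {1..n} \<Longrightarrow> lower_central G (N j) (e j) \<subseteq> S"
  shows "gprod e \<subseteq> S"
  unfolding gamma_product_def by (rule foldr_set_mult_least) (use assms in force)+

lemma gprod_antimono:
  assumes "\<And>j. j \<in> {1..n} \<Longrightarrow> e' j \<le> e j"
  shows "gprod e \<subseteq> gprod e'"
proof (rule gprod_least)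
  show "subgroup (gprod e') G" using gprod_normal normal_imp_subgroup by blast
  show "lower_central G (N j) (e j) \<subseteq> gprod e'" if "j \<in> {1..n}" for j
    using gprod_incl[OF that, of e'] lower_central_antimono[OF N_normal[OF that] assms[OF that]] by blast
qed

text \<open>It suffices to look at the factors. The factor at \<open>i\<close> moves one step down
  the lower central series of \<open>N i\<close>; every other factor is unaffected by the update of
  \<open>e\<close>, so it already lies in the target, which is normal.\<close>

lemma comm_gprod:
  assumes i: "i \<in> {1..n}" and a: "a \<in> N i" and y: "y \<in> gprod (e(i := m))" and m: "1 \<le> m"
  shows "comm y a \<in> gprod (e(i := Suc m))"
proof -
  let ?J = "gprod (e(i := Suc m))"
  have ac: "a \<in> carrier G" using a N_normal[OF i] normal_subsetD by blast
  have "gprod (e(i := m)) \<subseteq> {y \<in> carrier G. comm y a \<in> ?J}"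
  proof (rule gprod_least)
    show "subgroup {y \<in> carrier G. comm y a \<in> ?J} G"
      by (rule subgroup_comm_normal[OF gprod_normal ac])
    fix j assume j: "j \<in> {1..n}"
    show "lower_central G (N j) ((e(i := m)) j) \<subseteq> {y \<in> carrier G. comm y a \<in> ?J}"
    proof
      fix y assume y: "y \<in> lower_central G (N j) ((e(i := m)) j)"
      have yc: "y \<in> carrier G" using y lower_central_mem_carrier N_normal j by blast
      have "comm y a \<in> ?J"
      proof (cases "j = i")
        case True
        have "comm y a \<in> lower_central G (N i) (Suc m)"
          using y True m a N_normal[OF i] by (intro comm_mem_lower_central(2)) auto
        then show ?thesis using gprod_incl[OF i, of "e(i := Suc m)"] by auto
      next
        case False
        have "y \<in> ?J" using gprod_incl[OF j, of "e(i := Suc m)"] y False by auto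
        then show ?thesis using gprod_normal normal_comm(1) ac by blast
      qed
      then show "y \<in> {y \<in> carrier G. comm y a \<in> ?J}" using yc by simp
    qed
  qed
  then show ?thesis using y by blast
qed

text \<open>Pigeonhole: of \<open>q\<close> entries taken from the \<open>N j\<close>, some
  \<open>N j\<close> must contribute \<open>e j\<close> of them if \<open>q\<close> exceeds the sum
  of all \<open>e j - 1\<close>. In the induction an entry from \<open>N i\<close> is paid for by
  lowering \<open>e i\<close> by one.\<close>

lemma lcs_subset_gprod:
  assumes gen: "carrier G \<subseteq> generate G (\<Union>j\<in>{1..n}. N j)"
    and "\<And>j. j \<in> {1..n} \<Longrightarrow> 1 \<le> e j" and "(\<Sum>j\<in>{1..n}. e j - 1) < q"
  shows "lcs q \<subseteq> gprod e"
  using assms(2,3)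
proof (induction q arbitrary: e)
  case (Suc q)
  show ?case
  proof (cases "q = 0")
    case True
    then have e: "e j = 1" if "j \<in> {1..n}" for j using Suc.prems that by force
    have "(\<Union>j\<in>{1..n}. N j) \<subseteq> gprod e" using gprod_incl[of _ e] e by fastforce
    then have "generate G (\<Union>j\<in>{1..n}. N j) \<subseteq> gprod e"
      by (rule generate_subgroup_incl) (use gprod_normal normal_imp_subgroup in blast)
    then show ?thesis using gen True by auto
  next
    case False
    have gen_comm: "comm a y \<in> gprod e" if i: "i \<in> {1..n}" and a: "a \<in> N i" and y: "y \<in> lcs q" for i a y
    \<comment> \<open>An exponent \<open>1\<close> cannot be lowered, since exponents stay positive;
      but then \<open>a\<close> itself lies in the product.\<close>
    proof (cases "e i = 1")
      case True
      then have "a \<in> gprod e" using gprod_incl[OF i, of e] a by auto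
      then show ?thesis using gprod_normal normal_comm(1) y lcs_carrier by blast
    next
      case False
      define m where "m = e i - 1"
      have m: "1 \<le> m" "Suc m = e i" using False Suc.prems(1)[OF i] by (auto simp: m_def)
      have "(\<Sum>j\<in>{1..n}. (e(i := m)) j - 1) < (\<Sum>j\<in>{1..n}. e j - 1)"
        using i m by (intro sum_strict_mono_ex1) (auto intro!: bexI[of _ i])
      then have "lcs q \<subseteq> gprod (e(i := m))"
        using Suc.prems m by (intro Suc.IH) auto
      then have "comm y a \<in> gprod (e(i := Suc m))" using y comm_gprod[OF i a _ m(1)] by blast
      then have "comm y a \<in> gprod e" using m by (simp add: fun_upd_idem)
      then show ?thesis
        using comm_swap_mem[OF normal_imp_subgroup[OF gprod_normal]] y a i N_normal normal_subsetD lcs_carrier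
        by metis
    qed
    have "comm a y \<in> gprod e" if a: "a \<in> carrier G" and y: "y \<in> lcs q" for a y
    proof -
      have yc: "y \<in> carrier G" using y lcs_carrier by blast
      have "generate G (\<Union>j\<in>{1..n}. N j) \<subseteq> {a \<in> carrier G. comm a y \<in> gprod e}"
      proof (rule generate_subgroup_incl)
        show "subgroup {a \<in> carrier G. comm a y \<in> gprod e} G"
          by (rule subgroup_comm_normal[OF gprod_normal yc])
        show "(\<Union>j\<in>{1..n}. N j) \<subseteq> {a \<in> carrier G. comm a y \<in> gprod e}"
          using gen_comm y N_normal normal_subsetD by blast
      qed
      then show ?thesis using a gen by blast
    qed
    then have "generate G {comm a y |a y. a \<in> carrier G \<and> y \<in> lcs q} \<subseteq> gprod e"
      by (intro generate_subgroup_incl) (auto intro: normal_imp_subgroup[OF gprod_normal])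
    then show ?thesis using False by (simp add: lower_central_Suc)
  qed
qed simp

end

section \<open>Behaviour under homomorphisms\<close>

context group_hom
begin

lemma preimage_subgroup:
  assumes "subgroup S H"
  shows "subgroup {x \<in> carrier G. h x \<in> S} G"
proof -
  interpret S: subgroup S H by fact
  show ?thesis by unfold_locales auto
qed

lemma preimage_normal:
  assumes "N \<lhd> H"
  shows "{x \<in> carrier G. h x \<in> N} \<lhd> G"
proof (rule G.normal_invI)
  show "subgroup {x \<in> carrier G. h x \<in> N} G"
    using assms preimage_subgroup normal_imp_subgroup by blast
qed (use H.normal_invE(2)[OF assms] in auto)

lemma lower_central_in_carrier:
  assumes "K \<subseteq> carrier G"
  shows "lower_central G K q \<subseteq> carrier G"
proof (induction q)
  case (Suc q)
  have "{gcomm G x y |x y. x \<in> K \<and> y \<in> lower_central G K q} \<subseteq> carrier G"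
    using Suc assms G.comm_closed by blast
  then show ?case using assms G.generate_incl
    by (cases "q = 0") (simp_all add: lower_central_Suc)
qed (use assms in simp)

lemma hom_gcomm:
  "x \<in> carrier G \<Longrightarrow> y \<in> carrier G \<Longrightarrow> h (gcomm G x y) = gcomm H (h x) (h y)"
  by (simp add: gcomm_def)

lemma lower_central_image:
  assumes "K \<subseteq> carrier G"
  shows "h ` lower_central G K q = lower_central H (h ` K) q"
proof (induction q)
  case (Suc q)
  show ?case
  proof (cases "q = 0")
    case False
    let ?S = "{gcomm G x y |x y. x \<in> K \<and> y \<in> lower_central G K q}"
    have in_carrier: "lower_central G K q \<subseteq> carrier G" by (rule lower_central_in_carrier[OF assms])
    have "?S \<subseteq> carrier G" using in_carrier assms G.comm_closed by blast
    then have "h ` generate G ?S = generate H (h ` ?S)" by (simp add: generate_img)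
    also have "h ` ?S = {gcomm H x y |x y. x \<in> h ` K \<and> y \<in> lower_central H (h ` K) q}"
    proof -
      have "h ` ?S = {gcomm H (h x) (h y) |x y. x \<in> K \<and> y \<in> lower_central G K q}"
      proof (intro equalityI subsetI)
        fix z assume "z \<in> h ` ?S"
        then obtain x y where xy: "z = h (gcomm G x y)" "x \<in> K" "y \<in> lower_central G K q" by blast
        then have "x \<in> carrier G" "y \<in> carrier G" using assms in_carrier by auto
        with xy have "z = gcomm H (h x) (h y)" using hom_gcomm by simp
        then show "z \<in> {gcomm H (h x) (h y) |x y. x \<in> K \<and> y \<in> lower_central G K q}" using xy by blast
      next
        fix z assume "z \<in> {gcomm H (h x) (h y) |x y. x \<in> K \<and> y \<in> lower_central G K q}"
        then obtain x y where xy: "z = gcomm H (h x) (h y)" "x \<in> K" "y \<in> lower_central G K q" by blast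
        then have "x \<in> carrier G" "y \<in> carrier G" using assms in_carrier by auto
        with xy have "z = h (gcomm G x y)" using hom_gcomm by simp
        then show "z \<in> h ` ?S" using xy by blast
      qed
      then show ?thesis unfolding Suc[symmetric] by blast
    qed
    finally show ?thesis using False by (simp add: lower_central_Suc)
  qed simp
qed simp

lemma normal_closure_image:
  assumes "x \<in> carrier G"
  shows "h ` normal_closure G {x} \<subseteq> normal_closure H {h x}"
  using G.normal_closure_least[OF preimage_normal[OF H.normal_closure_normal[of "h x"]], of x]
    assms H.normal_closure_mem by auto

text \<open>Only membership of \<open>h (x j)\<close> in a normal closure is asked, so that the
  lemma covers both the meridian map and maps that send each generator to a conjugate of its
  counterpart.\<close>

lemma gamma_product_image:
  assumes x: "\<And>j. j \<in> {1..n} \<Longrightarrow> x j \<in> carrier G" and y: "\<And>j. j \<in> {1..n} \<Longrightarrow> y j \<in> carrier H"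
    and xy: "\<And>j. j \<in> {1..n} \<Longrightarrow> h (x j) \<in> normal_closure H {y j}"
  shows "h ` gamma_product G n x e \<subseteq> gamma_product H n y e"
proof -
  interpret X: group_with_gens G n x using x by unfold_locales
  interpret Y: group_with_gens H n y using y by unfold_locales
  have "gamma_product G n x e \<subseteq> {z \<in> carrier G. h z \<in> gamma_product H n y e}"
  proof (rule X.gprod_least)
    show "subgroup {z \<in> carrier G. h z \<in> gamma_product H n y e} G"
      by (intro preimage_subgroup normal_imp_subgroup Y.gprod_normal)
    fix j assume j: "j \<in> {1..n}"
    have N: "X.N j \<subseteq> carrier G" using X.N_normal[OF j] G.normal_subsetD by blast
    have "h ` X.N j \<subseteq> Y.N j"
      using normal_closure_image[OF x[OF j]] H.normal_closure_least[OF Y.N_normal[OF j] xy[OF j]] by blast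
    then have "h ` lower_central G (X.N j) (e j) \<subseteq> lower_central H (Y.N j) (e j)"
      unfolding lower_central_image[OF N] by (rule lower_central_mono[OF H.is_group])
    also have "\<dots> \<subseteq> gamma_product H n y e" by (rule Y.gprod_incl[OF j])
    finally show "lower_central G (X.N j) (e j) \<subseteq> {z \<in> carrier G. h z \<in> gamma_product H n y e}"
      using lower_central_in_carrier[OF N] by blast
  qed
  then show ?thesis by blast
qed

end

text \<open>The projection is onto, so it maps \<open>N j\<close> to a normal subgroup, which
  therefore contains the normal closure formed in the quotient.\<close>

lemma (in group_with_gens) gamma_product_quotient:
  assumes M: "M \<lhd> G" and e: "gprod e \<subseteq> M"
  shows "gamma_product (G Mod M) n (\<lambda>j. M #> x j) e \<subseteq> {M}"
proof -
  interpret c: group_hom G "G Mod M" "\<lambda>x. M #> x" using group_hom_coset M by blast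
  interpret Q: group_with_gens "G Mod M" n "\<lambda>j. M #> x j"
    by unfold_locales (use c.hom_closed in simp)
  show ?thesis
  proof (rule Q.gprod_least)
    show "subgroup {M} (G Mod M)" using c.H.triv_subgroup by simp
    fix j assume j: "j \<in> {1..n}"
    have Nc: "N j \<subseteq> carrier G" using N_normal[OF j] normal_subsetD by blast
    have "(\<lambda>x. M #> x) ` N j \<lhd> G Mod M"
      using N_normal[OF j] c.group_hom_axioms carrier_FactGroup
      by (metis (no_types, lifting) normal.surj_hom_normal_subgroup)
    then have "Q.N j \<subseteq> (\<lambda>x. M #> x) ` N j"
      using normal_closure_mem[of "x j"] by (intro c.H.normal_closure_least) auto
    then have "lower_central (G Mod M) (Q.N j) (e j) \<subseteq> lower_central (G Mod M) ((\<lambda>x. M #> x) ` N j) (e j)"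
      by (rule lower_central_mono[OF c.H.is_group])
    also have "\<dots> = (\<lambda>x. M #> x) ` lower_central G (N j) (e j)"
      by (rule c.lower_central_image[OF Nc, symmetric])
    also have "\<dots> \<subseteq> {M}"
      using gprod_incl[OF j, of e] e coset_eq_self_iff[OF M] M normal_subsetD by blast
    finally show "lower_central (G Mod M) (Q.N j) (e j) \<subseteq> {M}" .
  qed
qed

section \<open>Presented groups\<close>

text \<open>These rules would take words over \<open>S \<times> UNIV\<close> apart into letters.\<close>

declare in_lists_conv_set [simp del] in_listsD [rule del] in_listsI [rule del]

text \<open>Evaluation is defined on words, not on their classes: Milnor's approximations satisfy
  the link relations in general only modulo a term of the lower central series, so in the free group
  they give a value to a word but not to its class.\<close>

definition weval :: "('b, 'm) monoid_scheme \<Rightarrow> ('a \<Rightarrow> 'b) \<Rightarrow> 'a word \<Rightarrow> 'b" where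
  "weval H f w =
    foldr (\<lambda>l a. (if snd l then f (fst l) else inv\<^bsub>H\<^esub> f (fst l)) \<otimes>\<^bsub>H\<^esub> a) w \<one>\<^bsub>H\<^esub>"

lemma weval_Nil [simp]: "weval H f [] = \<one>\<^bsub>H\<^esub>"
  by (simp add: weval_def)

lemma weval_Cons [simp]:
  "weval H f (l # w) = (if snd l then f (fst l) else inv\<^bsub>H\<^esub> f (fst l)) \<otimes>\<^bsub>H\<^esub> weval H f w"
  by (simp add: weval_def)

lemma weval_cong:
  "w \<in> words S \<Longrightarrow> (\<And>x. x \<in> S \<Longrightarrow> f x = g x) \<Longrightarrow> weval H f w = weval H g w"
  by (induction w rule: lists.induct) auto

lemma (in Group.group) weval_closed [simp]:
  assumes "f \<in> S \<rightarrow> carrier G" "w \<in> words S"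
  shows "weval G f w \<in> carrier G"
  using assms(2)
proof (induction w)
  case (Cons l w)
  then have "f (fst l) \<in> carrier G" using assms by auto
  then show ?case using Cons by auto
qed simp

lemma (in Group.group) weval_append:
  assumes "f \<in> S \<rightarrow> carrier G" "u \<in> words S" "v \<in> words S"
  shows "weval G f (u @ v) = weval G f u \<otimes> weval G f v"
  using assms(2)
proof (induction u)
  case (Cons l u)
  have "(if snd l then f (fst l) else inv f (fst l)) \<in> carrier G" using Cons assms by auto
  then show ?case using Cons assms by (simp add: m_assoc[symmetric])
qed (use assms in simp)

lemma (in group_hom) weval_hom:
  assumes "f \<in> S \<rightarrow> carrier G" "w \<in> words S"
  shows "h (weval G f w) = weval H (h \<circ> f) w"
  using assms(2)
proof (induction w)
  case (Cons l w)
  have "f (fst l) \<in> carrier G" using Cons assms by auto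
  moreover have "weval G f w \<in> carrier G" using Cons assms by auto
  ultimately show ?case using Cons by auto
qed simp

text \<open>The rule \<open>relation\<close> of \<open>word_rel\<close> inserts the sides of a
  relation unchecked; the assumption keeps \<open>word_rel S R\<close> within
  \<open>words S\<close>.\<close>

locale presentation =
  fixes S :: "'a set" and R :: "('a word \<times> 'a word) set"
  assumes R: "R \<subseteq> words S \<times> words S"
begin

definition cls :: "'a word \<Rightarrow> 'a word set" where
  "cls w = word_rel S R `` {w}"

definition gen :: "'a \<Rightarrow> 'a word set" where
  "gen x = cls [(x, True)]"

abbreviation P :: "'a word set monoid" where
  "P \<equiv> presented_group S R"

lemma word_rel_words: "(u, v) \<in> word_rel S R \<Longrightarrow> u \<in> words S \<and> v \<in> words S"
  by (induction rule: word_rel.induct) (use R in \<open>auto simp: inv_letter_def mem_Times_iff\<close>)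

lemma word_rel_congr:
  assumes "(u, v) \<in> word_rel S R" "a \<in> words S" "b \<in> words S"
  shows "(a @ u @ b, a @ v @ b) \<in> word_rel S R"
  using assms
proof (induction rule: word_rel.induct)
  case (refl u)
  then show ?case by (intro word_rel.refl) auto
next
  case (cancel u v l)
  then show ?case using word_rel.cancel[of "a @ u" S "v @ b" l R] by simp
next
  case (relation u v r r')
  then show ?case using word_rel.relation[of "a @ u" S "v @ b" r r' R] by simp
qed (blast intro: word_rel.sym word_rel.trans)+

lemma equiv_word_rel: "equiv (words S) (word_rel S R)"
proof (rule equivI)
  show "word_rel S R \<subseteq> words S \<times> words S" using word_rel_words by auto
  show "refl_on (words S) (word_rel S R)"
    using word_rel_words by (auto simp: refl_on_def intro: word_rel.refl)
  show "sym (word_rel S R)" by (auto simp: sym_def intro: word_rel.sym)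
  show "trans (word_rel S R)" by (auto simp: trans_def intro: word_rel.trans)
qed

lemma cls_eq_iff: "u \<in> words S \<Longrightarrow> v \<in> words S \<Longrightarrow> cls u = cls v \<longleftrightarrow> (u, v) \<in> word_rel S R"
  unfolding cls_def using eq_equiv_class_iff[OF equiv_word_rel] by blast

lemma mem_cls_iff: "v \<in> cls u \<longleftrightarrow> (u, v) \<in> word_rel S R"
  by (simp add: cls_def)

lemma carrier_P: "carrier P = cls ` words S"
  by (auto simp: presented_group_def cls_def quotient_def)

lemma one_P: "\<one>\<^bsub>P\<^esub> = cls []"
  by (simp add: presented_group_def cls_def)

lemma mult_P:
  assumes "u \<in> words S" "v \<in> words S"
  shows "cls u \<otimes>\<^bsub>P\<^esub> cls v = cls (u @ v)"
proof -
  have "cls (a @ b) = cls (u @ v)" if "a \<in> cls u" "b \<in> cls v" for a b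
  proof -
    have ab: "(u, a) \<in> word_rel S R" "(v, b) \<in> word_rel S R" using that by (simp_all add: mem_cls_iff)
    have w: "a \<in> words S" "b \<in> words S" using ab word_rel_words by auto
    have "(u @ v, a @ v) \<in> word_rel S R" using word_rel_congr[OF ab(1), of "[]" v] assms by simp
    moreover have "(a @ v, a @ b) \<in> word_rel S R" using word_rel_congr[OF ab(2), of a "[]"] w by simp
    ultimately have "(u @ v, a @ b) \<in> word_rel S R" by (rule word_rel.trans)
    then show ?thesis using assms w by (subst cls_eq_iff) (auto intro: word_rel.sym)
  qed
  moreover have "u \<in> cls u" "v \<in> cls v" using assms by (auto simp: mem_cls_iff intro: word_rel.refl)
  ultimately have "(\<Union>a\<in>cls u. \<Union>b\<in>cls v. cls (a @ b)) = cls (u @ v)" by blast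
  then show ?thesis by (simp add: presented_group_def cls_def)
qed

definition inv_word :: "'a word \<Rightarrow> 'a word" where
  "inv_word w = rev (map inv_letter w)"

lemma inv_word_words: "w \<in> words S \<Longrightarrow> inv_word w \<in> words S"
  by (induction w) (auto simp: inv_word_def inv_letter_def)

lemma inv_word_cancel: "w \<in> words S \<Longrightarrow> (inv_word w @ w, []) \<in> word_rel S R"
proof (induction w)
  case Nil
  then show ?case by (simp add: inv_word_def word_rel.refl)
next
  case (Cons l w)
  then have w: "w \<in> words S" "fst l \<in> S" by auto
  \<comment> \<open>\<open>cancel\<close> removes a letter followed by its inverse. Here the inverse
    comes first, so the rule is applied to \<open>inv_letter l\<close>.\<close>
  have "inv_letter (inv_letter l) = l" by (cases l) (simp add: inv_letter_def)
  moreover have "fst (inv_letter l) \<in> S" using w by (simp add: inv_letter_def)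
  ultimately have "(inv_word w @ [inv_letter l, l] @ w, inv_word w @ w) \<in> word_rel S R"
    using word_rel.cancel[OF inv_word_words[OF w(1)] w(1), of "inv_letter l"] by simp
  then have "(inv_word (l # w) @ l # w, inv_word w @ w) \<in> word_rel S R" by (simp add: inv_word_def)
  then show ?case using Cons.IH[OF w(1)] word_rel.trans by blast
qed

lemma group_P: "Group.group P"
proof (rule groupI)
  show "\<And>x y. x \<in> carrier P \<Longrightarrow> y \<in> carrier P \<Longrightarrow> x \<otimes>\<^bsub>P\<^esub> y \<in> carrier P"
    by (auto simp: carrier_P mult_P)
  show "\<one>\<^bsub>P\<^esub> \<in> carrier P" by (auto simp: carrier_P one_P)
  show "\<And>x y z. x \<in> carrier P \<Longrightarrow> y \<in> carrier P \<Longrightarrow> z \<in> carrier P \<Longrightarrow>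
      x \<otimes>\<^bsub>P\<^esub> y \<otimes>\<^bsub>P\<^esub> z = x \<otimes>\<^bsub>P\<^esub> (y \<otimes>\<^bsub>P\<^esub> z)"
    by (auto simp: carrier_P mult_P)
  show "\<And>x. x \<in> carrier P \<Longrightarrow> \<one>\<^bsub>P\<^esub> \<otimes>\<^bsub>P\<^esub> x = x" by (auto simp: carrier_P one_P mult_P)
  show "\<exists>y\<in>carrier P. y \<otimes>\<^bsub>P\<^esub> x = \<one>\<^bsub>P\<^esub>" if x: "x \<in> carrier P" for x
  proof -
    obtain w where w: "x = cls w" "w \<in> words S" using x by (auto simp: carrier_P)
    have "cls (inv_word w @ w) = cls []"
      using w inv_word_words inv_word_cancel by (subst cls_eq_iff) auto
    then show ?thesis using w inv_word_words
      by (intro bexI[of _ "cls (inv_word w)"]) (auto simp: carrier_P mult_P one_P)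
  qed
qed

sublocale P: Group.group P by (rule group_P)

lemma cls_closed [simp]: "w \<in> words S \<Longrightarrow> cls w \<in> carrier P"
  by (simp add: carrier_P)

lemma gen_closed [simp]: "x \<in> S \<Longrightarrow> gen x \<in> carrier P"
  by (simp add: gen_def)

lemma inv_gen:
  assumes "x \<in> S"
  shows "inv\<^bsub>P\<^esub> gen x = cls [(x, False)]"
proof (rule P.inv_equality)
  have "([] @ [(x, False), inv_letter (x, False)] @ [], [] @ []) \<in> word_rel S R"
    using assms by (intro word_rel.cancel) auto
  then show "cls [(x, False)] \<otimes>\<^bsub>P\<^esub> gen x = \<one>\<^bsub>P\<^esub>"
    using assms by (auto simp: gen_def mult_P one_P cls_eq_iff inv_letter_def)
qed (use assms in auto)

lemma cls_weval: "w \<in> words S \<Longrightarrow> cls w = weval P gen w"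
proof (induction w)
  case Nil
  then show ?case by (simp add: one_P)
next
  case (Cons l w)
  then have l: "[l] \<in> words S" "w \<in> words S" "fst l \<in> S" by auto
  have "cls (l # w) = cls [l] \<otimes>\<^bsub>P\<^esub> cls w" using mult_P[OF l(1,2)] by simp
  also have "cls [l] = (if snd l then gen (fst l) else inv\<^bsub>P\<^esub> gen (fst l))"
    using l(3) inv_gen by (cases l) (auto simp: gen_def)
  finally show ?case using Cons l by simp
qed

lemma gen_in: "gen \<in> S \<rightarrow> carrier P" by simp

lemma hom_cls:
  assumes "Group.group H" "h \<in> hom P H" "w \<in> words S"
  shows "h (cls w) = weval H (h \<circ> gen) w"
proof -
  interpret h: group_hom P H h
    by (intro group_hom.intro group_hom_axioms.intro assms group_P)
  show ?thesis unfolding cls_weval[OF assms(3)] by (rule h.weval_hom[OF gen_in assms(3)])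
qed

lemma hom_unique:
  assumes "Group.group H" "h \<in> hom P H" "h' \<in> hom P H"
    and "\<And>x. x \<in> S \<Longrightarrow> h (gen x) = h' (gen x)" "z \<in> carrier P"
  shows "h z = h' z"
proof -
  obtain w where w: "z = cls w" "w \<in> words S" using assms(5) by (auto simp: carrier_P)
  show ?thesis unfolding w(1) hom_cls[OF assms(1,2) w(2)] hom_cls[OF assms(1,3) w(2)]
    using assms(4) by (intro weval_cong[OF w(2)]) simp
qed

lemma exists_hom:
  assumes H: "Group.group H" and f: "f \<in> S \<rightarrow> carrier H"
    and rel: "\<And>r r'. (r, r') \<in> R \<Longrightarrow> weval H f r = weval H f r'"
  obtains h where "h \<in> hom P H" "\<And>w. w \<in> words S \<Longrightarrow> h (cls w) = weval H f w"
proof -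
  interpret H: Group.group H by fact
  have inv: "weval H f u = weval H f v" if "(u, v) \<in> word_rel S R" for u v
    using that
  proof (induction rule: word_rel.induct)
    case (cancel u v l)
    have l: "[l, inv_letter l] \<in> words S" using cancel by (auto simp: inv_letter_def mem_Times_iff)
    have "f (fst l) \<in> carrier H" using f cancel by auto
    then have "weval H f [l, inv_letter l] = \<one>\<^bsub>H\<^esub>" by (simp add: inv_letter_def)
    then have "weval H f ([l, inv_letter l] @ v) = weval H f v"
      using cancel l f unfolding H.weval_append[OF f l cancel(2)] by (simp del: weval_Cons)
    then show ?case using cancel l H.weval_append[OF f] by (simp del: weval_Cons append_Cons)
  next
    case (relation u v r r')
    have r: "r \<in> words S" "r' \<in> words S" using R relation by auto
    then show ?case using relation rel f H.weval_append[OF f] by simp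
  qed auto
  define h where "h A = weval H f (SOME w. w \<in> A)" for A
  have h: "h (cls w) = weval H f w" if "w \<in> words S" for w
  proof -
    have "w \<in> cls w" using that by (simp add: mem_cls_iff word_rel.refl)
    then have "(SOME v. v \<in> cls w) \<in> cls w" by (rule someI)
    then show ?thesis unfolding h_def using inv mem_cls_iff by metis
  qed
  have "h \<in> hom P H"
    by (rule homI) (auto simp: carrier_P mult_P h H.weval_append[OF f] f
        intro: H.weval_closed[OF f])
  then show thesis using h that by blast
qed

lemma P_generated:
  assumes T: "subgroup T P" and gens: "\<And>x. x \<in> S \<Longrightarrow> gen x \<in> T"
  shows "carrier P \<subseteq> T"
proof
  have "weval P gen w \<in> T" if "w \<in> words S" for w
    using that
  proof (induction w)
    case (Cons l w)
    then have "gen (fst l) \<in> T" using gens by auto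
    then show ?case using Cons T by (auto simp: subgroup.m_closed subgroup.m_inv_closed)
  qed (use T subgroup.one_closed in simp)
  then show "z \<in> T" if "z \<in> carrier P" for z
    using that by (auto simp: carrier_P cls_weval)
qed

end

section \<open>Free groups\<close>

interpretation free: presentation S "{}" for S
  by unfold_locales simp

lemma free_group_P: "free_group S = presented_group S {}"
  by (simp add: free_group_def)

lemma group_free_group: "Group.group (free_group S)"
  using free.group_P by (simp add: free_group_P)

lemma free_gen_eq: "free_gen S = free.gen S"
  by (simp add: fun_eq_iff free_gen_def free.gen_def free.cls_def)

text \<open>The definite description in \<open>free_lift\<close> only admits maps that are
  \<open>undefined\<close> off the carrier. Existence is therefore obtained by restricting a
  homomorphism, and uniqueness from the values on generators together with extensionality.\<close>

lemma
  assumes H: "Group.group H" and f: "f \<in> S \<rightarrow> carrier H"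
  shows free_lift_hom: "free_lift S H f \<in> hom (free_group S) H"
    and free_lift_gen: "x \<in> S \<Longrightarrow> free_lift S H f (free_gen S x) = f x"
proof -
  obtain h where h: "h \<in> hom (free_group S) H" "\<And>w. w \<in> words S \<Longrightarrow> h (free.cls S w) = weval H f w"
    using free.exists_hom[OF H f] by (auto simp: free_group_P)
  interpret H: Group.group H by fact
  let ?P = "\<lambda>h. h \<in> hom (free_group S) H \<inter> extensional (carrier (free_group S)) \<and>
    (\<forall>x\<in>S. h (free_gen S x) = f x)"
  let ?h = "restrict h (carrier (free_group S))"
  have "?h \<in> hom (free_group S) H"
    using h(1) monoid.m_closed[OF Group.group.is_monoid[OF group_free_group]]
    by (auto simp: hom_def Pi_iff)
  moreover have "?h (free_gen S x) = f x" if "x \<in> S" for x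
  proof -
    have "f x \<in> carrier H" using f that by auto
    then show ?thesis
      using that h(2)[of "[(x, True)]"]
      by (simp add: free_gen_eq free_group_P free.gen_closed) (simp add: free.gen_def)
  qed
  ultimately have "?P ?h" by auto
  moreover have "g = ?h" if "?P g" for g
    using that \<open>?P ?h\<close> free.hom_unique[OF H, of g S ?h]
    by (intro extensionalityI[of _ "carrier (free_group S)"]) (auto simp: free_group_P free_gen_eq)
  ultimately have "?P (THE h. ?P h)" by (intro theI[of ?P ?h])
  then show "free_lift S H f \<in> hom (free_group S) H"
    "x \<in> S \<Longrightarrow> free_lift S H f (free_gen S x) = f x"
    unfolding free_lift_def by auto
qed

lemma free_group_hom_unique:
  assumes "Group.group H" "h \<in> hom (free_group S) H" "h' \<in> hom (free_group S) H"
    and "\<And>x. x \<in> S \<Longrightarrow> h (free_gen S x) = h' (free_gen S x)" "z \<in> carrier (free_group S)"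
  shows "h z = h' z"
  using free.hom_unique[of H h S h' z] assms by (simp add: free_group_P free_gen_eq)

lemma free_gen_closed: "x \<in> S \<Longrightarrow> free_gen S x \<in> carrier (free_group S)"
  by (simp add: free_group_P free_gen_eq)

lemma free_group_generated:
  assumes "subgroup T (free_group S)" "\<And>x. x \<in> S \<Longrightarrow> free_gen S x \<in> T"
  shows "carrier (free_group S) \<subseteq> T"
  using free.P_generated[of T S] assms by (simp add: free_group_P free_gen_eq)

section \<open>Noncommutative power series and the Magnus expansion\<close>

text \<open>A copy of the coefficient functions that can be made an instance of
  \<open>ring_1\<close>, so that Magnus calculations become type class algebra. All natural numbers
  are allowed as letters, in contrast to the carrier of \<open>nc_series n\<close>.\<close>

typedef ncseries = "UNIV :: (nat list \<Rightarrow> int) set"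
  morphisms coeff NC by simp

setup_lifting type_definition_ncseries

lemma ncseries_eqI: "(\<And>w. coeff f w = coeff g w) \<Longrightarrow> f = g"
  by (metis coeff_inject ext)

lemma coeff_NC [simp]: "coeff (NC f) = f"
  by (simp add: NC_inverse)

definition conv :: "(nat list \<Rightarrow> int) \<Rightarrow> (nat list \<Rightarrow> int) \<Rightarrow> nat list \<Rightarrow> int" where
  "conv f g w = (\<Sum>i\<le>length w. f (take i w) * g (drop i w))"

lemma conv_Nil [simp]: "conv f g [] = f [] * g []"
  by (simp add: conv_def)

text \<open>The left factor is replaced by its left derivative \<open>u \<mapsto> f (x # u)\<close>.
  With the series kept arbitrary, this turns associativity into an induction on the word.\<close>

lemma conv_Cons [simp]: "conv f g (x # w) = f [] * g (x # w) + conv (\<lambda>u. f (x # u)) g w"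
  by (simp add: conv_def sum.atMost_Suc_shift del: sum.atMost_Suc)

lemma conv_add_left: "conv (\<lambda>u. f u + f' u) g w = conv f g w + conv f' g w"
  by (simp add: conv_def sum.distrib algebra_simps)

lemma conv_add_right: "conv f (\<lambda>u. g u + g' u) w = conv f g w + conv f g' w"
  by (simp add: conv_def sum.distrib algebra_simps)

lemma conv_scale_left: "conv (\<lambda>u. c * f u) g w = c * conv f g w"
  by (simp add: conv_def sum_distrib_left algebra_simps)

lemma conv_assoc: "conv (conv f g) h w = conv f (conv g h) w"
  by (induction w arbitrary: f g h) (simp_all add: conv_add_left conv_scale_left algebra_simps)

lemma conv_zero_left: "conv (\<lambda>u. 0) g w = 0"
  by (simp add: conv_def)

lemma conv_one_left: "conv (\<lambda>w. if w = [] then 1 else 0) g w = g w"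
  by (cases w) (simp_all add: conv_zero_left)

lemma conv_one_right: "conv f (\<lambda>w. if w = [] then 1 else 0) w = f w"
  by (induction w arbitrary: f) simp_all

instantiation ncseries :: ring_1
begin

lift_definition zero_ncseries :: ncseries is "\<lambda>w. 0" .
lift_definition one_ncseries :: ncseries is "\<lambda>w. if w = [] then 1 else 0" .
lift_definition plus_ncseries :: "ncseries \<Rightarrow> ncseries \<Rightarrow> ncseries" is "\<lambda>f g w. f w + g w" .
lift_definition minus_ncseries :: "ncseries \<Rightarrow> ncseries \<Rightarrow> ncseries" is "\<lambda>f g w. f w - g w" .
lift_definition uminus_ncseries :: "ncseries \<Rightarrow> ncseries" is "\<lambda>f w. - f w" .
lift_definition times_ncseries :: "ncseries \<Rightarrow> ncseries \<Rightarrow> ncseries" is conv .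

instance
proof
  fix a b c :: ncseries
  show "a * b * c = a * (b * c)" by transfer (simp add: conv_assoc fun_eq_iff)
  show "1 * a = a" by transfer (simp add: conv_one_left fun_eq_iff)
  show "a * 1 = a" by transfer (simp add: conv_one_right fun_eq_iff)
  show "(a + b) * c = a * c + b * c" by transfer (simp add: conv_add_left fun_eq_iff)
  show "a * (b + c) = a * b + a * c" by transfer (simp add: conv_add_right fun_eq_iff)
  show "(0 :: ncseries) \<noteq> 1" by transfer (auto simp: fun_eq_iff)
qed (transfer; simp add: fun_eq_iff algebra_simps)+

end

lemma coeff_simps [simp]:
  "coeff 0 w = 0" "coeff 1 w = (if w = [] then 1 else 0)" "coeff (f + g) w = coeff f w + coeff g w"
  "coeff (f - g) w = coeff f w - coeff g w" "coeff (- f) w = - coeff f w"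
  by (transfer; simp)+

lemma coeff_mult: "coeff (f * g) w = (\<Sum>i\<le>length w. coeff f (take i w) * coeff g (drop i w))"
  by transfer (simp add: conv_def)

definition ncX :: "nat \<Rightarrow> ncseries" where
  "ncX i = NC (nc_var i)"

lemma coeff_ncX [simp]: "coeff (ncX i) w = (if w = [i] then 1 else 0)"
  by (simp add: ncX_def nc_var_def)

text \<open>The series \<open>1 - X\<^sub>i + X\<^sub>i\<^sup>2 - ...\<close>, the inverse of
  \<open>1 + X\<^sub>i\<close>; it witnesses that the Magnus images of the generators are
  units.\<close>

definition geom_inv :: "nat \<Rightarrow> nat list \<Rightarrow> int" where
  "geom_inv i w = (if set w \<subseteq> {i} then (-1) ^ length w else 0)"

lemma geom_inv_simps [simp]: "geom_inv i [] = 1" "geom_inv i (x # w) = (if x = i then - geom_inv i w else 0)"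
  by (auto simp: geom_inv_def)

lemma one_plus_X_geom: "conv (\<lambda>w. (if w = [] then 1 else 0) + nc_var i w) (geom_inv i) w = (if w = [] then 1 else 0)"
proof (cases w)
  case (Cons x v)
  have "(\<lambda>u. (if x # u = [] then 1 else 0) + nc_var i (x # u)) =
      (\<lambda>u. (if x = i then 1 else 0) * (if u = [] then 1 else 0))"
    by (auto simp: nc_var_def)
  then have "conv (\<lambda>u. (if x # u = [] then 1 else 0) + nc_var i (x # u)) (geom_inv i) v = (if x = i then 1 else 0) * geom_inv i v"
    by (simp only: conv_scale_left conv_one_left)
  then show ?thesis using Cons by (simp add: nc_var_def)
qed (simp add: nc_var_def)

lemma geom_one_plus_X: "conv (geom_inv i) (\<lambda>w. (if w = [] then 1 else 0) + nc_var i w) w = (if w = [] then 1 else 0)"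
proof (induction w)
  case (Cons x v)
  have "(\<lambda>u. geom_inv i (x # u)) = (\<lambda>u. (if x = i then -1 else 0) * geom_inv i u)"
    by auto
  then have "conv (\<lambda>u. geom_inv i (x # u)) (\<lambda>w. (if w = [] then 1 else 0) + nc_var i w) v =
     (if x = i then -1 else 0) * conv (geom_inv i) (\<lambda>w. (if w = [] then 1 else 0) + nc_var i w) v"
    by (simp only: conv_scale_left)
  then show ?case using Cons by (simp add: nc_var_def)
qed (simp add: nc_var_def)

section \<open>The Magnus expansion as a homomorphism into the units\<close>

lemma nc_series_simps [simp]:
  "f \<otimes>\<^bsub>nc_series n\<^esub> g = conv f g" "\<one>\<^bsub>nc_series n\<^esub> = (\<lambda>w. if w = [] then 1 else 0)"
  "f \<oplus>\<^bsub>nc_series n\<^esub> g = (\<lambda>w. f w + g w)"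
  by (simp_all add: nc_series_def conv_def fun_eq_iff)

lemma nc_series_carrier: "f \<in> carrier (nc_series n) \<longleftrightarrow> (\<forall>w. f w \<noteq> 0 \<longrightarrow> set w \<subseteq> {1..n})"
  by (simp add: nc_series_def)

lemma monoid_nc_series: "Group.monoid (nc_series n)"
proof
  fix f g assume f: "f \<in> carrier (nc_series n)" and g: "g \<in> carrier (nc_series n)"
  have "set w \<subseteq> {1..n}" if nz: "conv f g w \<noteq> 0" for w
  proof -
    obtain i where "f (take i w) * g (drop i w) \<noteq> 0"
      using nz sum.neutral[of "{..length w}" "\<lambda>i. f (take i w) * g (drop i w)"] unfolding conv_def by auto
    then have "f (take i w) \<noteq> 0" "g (drop i w) \<noteq> 0" by auto
    then have "set (take i w) \<union> set (drop i w) \<subseteq> {1..n}"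
      using f g unfolding nc_series_carrier by blast
    then show ?thesis by (simp flip: set_append)
  qed
  then show "f \<otimes>\<^bsub>nc_series n\<^esub> g \<in> carrier (nc_series n)" by (simp add: nc_series_carrier)
qed (auto simp: conv_assoc conv_one_left conv_one_right nc_series_carrier fun_eq_iff)

lemma units_nc_series_gen:
  assumes "i \<in> {1..n}"
  shows "\<one>\<^bsub>nc_series n\<^esub> \<oplus>\<^bsub>nc_series n\<^esub> nc_var i \<in> carrier (units_of (nc_series n))"
proof -
  have "geom_inv i \<in> carrier (nc_series n)"
    using assms by (auto simp: nc_series_carrier geom_inv_def split: if_splits)
  moreover have "(\<lambda>w. (if w = [] then 1 else 0) + nc_var i w) \<in> carrier (nc_series n)"
    using assms by (auto simp: nc_series_carrier nc_var_def split: if_splits)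
  ultimately show ?thesis
    unfolding units_of_carrier Units_def nc_series_simps mem_Collect_eq
    by (intro conjI bexI[of _ "geom_inv i"] ext one_plus_X_geom geom_one_plus_X)
qed

lemma group_units_nc_series: "Group.group (units_of (nc_series n))"
  by (rule monoid.units_group[OF monoid_nc_series])

definition mag :: "nat \<Rightarrow> nat word set \<Rightarrow> ncseries" where
  "mag n g = NC (magnus n g)"

lemma coeff_mag: "coeff (mag n g) = magnus n g"
  by (simp add: mag_def)

lemma magnus_hom: "magnus n \<in> hom (FG n) (units_of (nc_series n))"
  unfolding magnus_def using units_nc_series_gen
  by (intro free_lift_hom group_units_nc_series) auto

lemma mag_mult:
  assumes "g \<in> carrier (FG n)" "h \<in> carrier (FG n)"
  shows "mag n (g \<otimes>\<^bsub>FG n\<^esub> h) = mag n g * mag n h"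
proof (rule ncseries_eqI)
  fix w
  have "magnus n (g \<otimes>\<^bsub>FG n\<^esub> h) = conv (magnus n g) (magnus n h)"
    using hom_mult[OF magnus_hom assms] by (simp add: units_of_mult)
  then show "coeff (mag n (g \<otimes>\<^bsub>FG n\<^esub> h)) w = coeff (mag n g * mag n h) w"
    by (simp add: coeff_mag coeff_mult conv_def)
qed

lemma mag_one: "mag n \<one>\<^bsub>FG n\<^esub> = 1"
proof (rule ncseries_eqI)
  fix w
  have "magnus n \<one>\<^bsub>FG n\<^esub> = (\<lambda>w. if w = [] then 1 else 0)"
    using group_hom.hom_one[OF group_hom.intro[OF group_free_group group_units_nc_series
          group_hom_axioms.intro[OF magnus_hom]]]
    by (simp add: units_of_one)
  then show "coeff (mag n \<one>\<^bsub>FG n\<^esub>) w = coeff 1 w" by (simp add: coeff_mag)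
qed

lemma mag_alpha:
  assumes "i \<in> {1..n}"
  shows "mag n (alpha n i) = 1 + ncX i"
proof (rule ncseries_eqI)
  fix w
  have "magnus n (alpha n i) = (\<lambda>w. (if w = [] then 1 else 0) + nc_var i w)"
    unfolding magnus_def using units_nc_series_gen
    by (subst free_lift_gen[OF group_units_nc_series _ assms]) (auto simp del: nc_series_simps, simp)
  then show "coeff (mag n (alpha n i)) w = coeff (1 + ncX i) w" by (simp add: coeff_mag nc_var_def)
qed

section \<open>Magnus coefficients of lower central terms\<close>

text \<open>Rewriting \<open>1\<close> to \<open>Suc 0\<close> would keep facts about \<open>FG n\<close>, which abbreviates a term with
  \<open>{1..n}\<close>, from being used as rewrite rules.\<close>

declare One_nat_def [simp del]

interpretation F: Group.group "FG n" for n
  by (rule group_free_group)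

interpretation FA: group_with_gens "FG n" n "alpha n" for n
  by unfold_locales (rule free_gen_closed)

definition vanish :: "nat list set \<Rightarrow> ncseries \<Rightarrow> bool" where
  "vanish A f \<longleftrightarrow> (\<forall>u\<in>A. coeff f u = 0)"

text \<open>A coefficient of a product at \<open>u\<close> is a sum over the splittings of
  \<open>u\<close> into a prefix and a suffix. Closure under both makes the series that vanish on
  \<open>A\<close> a two-sided ideal.\<close>

definition factor_closed :: "nat list set \<Rightarrow> bool" where
  "factor_closed A \<longleftrightarrow> (\<forall>u\<in>A. \<forall>i. take i u \<in> A \<and> drop i u \<in> A)"

lemma vanish_mult:
  assumes "factor_closed A" "vanish A f"
  shows "vanish A (f * g)" "vanish A (g * f)"
  using assms by (auto simp: vanish_def factor_closed_def coeff_mult intro!: sum.neutral)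

lemma vanish_add: "vanish A f \<Longrightarrow> vanish A g \<Longrightarrow> vanish A (f + g)"
  and vanish_diff: "vanish A f \<Longrightarrow> vanish A g \<Longrightarrow> vanish A (f - g)"
  and vanish_uminus: "vanish A f \<Longrightarrow> vanish A (- f)"
  by (auto simp: vanish_def)

text \<open>For factor-closed \<open>A\<close>, the elements whose expansion is \<open>1\<close>
  modulo the ideal of series vanishing on \<open>A\<close>. It is used with a bound on the length, a
  bound on the occurrences of one index, the admissible words, and the words in a single
  letter.\<close>

definition magnus_kernel :: "nat \<Rightarrow> nat list set \<Rightarrow> nat word set set" where
  "magnus_kernel n A = {g \<in> carrier (FG n). vanish A (mag n g - 1)}"

lemma mag_inv:
  assumes "g \<in> carrier (FG n)"
  shows "mag n g * mag n (inv\<^bsub>FG n\<^esub> g) = 1" "mag n (inv\<^bsub>FG n\<^esub> g) * mag n g = 1"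
  using mag_mult[of g n "inv\<^bsub>FG n\<^esub> g"] mag_mult[of "inv\<^bsub>FG n\<^esub> g" n g] assms mag_one by auto

lemma magnus_kernel_normal:
  assumes A: "factor_closed A"
  shows "magnus_kernel n A \<lhd> FG n"
proof (rule F.normal_invI)
  show "subgroup (magnus_kernel n A) (FG n)"
  proof (rule F.subgroupI)
    show "magnus_kernel n A \<subseteq> carrier (FG n)" by (auto simp: magnus_kernel_def)
    have "\<one>\<^bsub>FG n\<^esub> \<in> magnus_kernel n A" by (simp add: magnus_kernel_def mag_one vanish_def)
    then show "magnus_kernel n A \<noteq> {}" by blast
  next
    fix g assume g: "g \<in> magnus_kernel n A"
    then have gc: "g \<in> carrier (FG n)" by (simp add: magnus_kernel_def)
    have eq: "mag n (inv\<^bsub>FG n\<^esub> g) - 1 = - (mag n (inv\<^bsub>FG n\<^esub> g) * (mag n g - 1))"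
      using mag_inv[OF gc] by (simp add: algebra_simps)
    have "vanish A (mag n (inv\<^bsub>FG n\<^esub> g) - 1)"
      unfolding eq using g by (intro vanish_uminus vanish_mult[OF A]) (simp add: magnus_kernel_def)
    then show "inv\<^bsub>FG n\<^esub> g \<in> magnus_kernel n A" using gc by (simp add: magnus_kernel_def)
  next
    fix g h assume gh: "g \<in> magnus_kernel n A" "h \<in> magnus_kernel n A"
    then have c: "g \<in> carrier (FG n)" "h \<in> carrier (FG n)" by (simp_all add: magnus_kernel_def)
    have eq: "mag n (g \<otimes>\<^bsub>FG n\<^esub> h) - 1 = (mag n g - 1) * mag n h + (mag n h - 1)"
      using c by (simp add: mag_mult algebra_simps)
    have "vanish A (mag n (g \<otimes>\<^bsub>FG n\<^esub> h) - 1)"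
      unfolding eq using gh by (intro vanish_add vanish_mult(1)[OF A]) (simp_all add: magnus_kernel_def)
    then show "g \<otimes>\<^bsub>FG n\<^esub> h \<in> magnus_kernel n A" using c by (simp add: magnus_kernel_def)
  qed
next
  fix x h assume x: "x \<in> carrier (FG n)" and h: "h \<in> magnus_kernel n A"
  then have hc: "h \<in> carrier (FG n)" by (simp add: magnus_kernel_def)
  have eq: "mag n (x \<otimes>\<^bsub>FG n\<^esub> h \<otimes>\<^bsub>FG n\<^esub> inv\<^bsub>FG n\<^esub> x) - 1 = mag n x * (mag n h - 1) * mag n (inv\<^bsub>FG n\<^esub> x)"
    using x hc mag_inv[OF x] by (simp add: mag_mult algebra_simps)
  have "vanish A (mag n (x \<otimes>\<^bsub>FG n\<^esub> h \<otimes>\<^bsub>FG n\<^esub> inv\<^bsub>FG n\<^esub> x) - 1)"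
    unfolding eq using h by (intro vanish_mult[OF A]) (simp add: magnus_kernel_def)
  then show "x \<otimes>\<^bsub>FG n\<^esub> h \<otimes>\<^bsub>FG n\<^esub> inv\<^bsub>FG n\<^esub> x \<in> magnus_kernel n A"
    using x hc by (simp add: magnus_kernel_def)
qed

text \<open>Up to sign, \<open>mag n g - mag n h\<close> is the unit \<open>mag n g\<close> times
  the expansion of the quotient minus one, and multiplication by a unit or its inverse preserves
  vanishing on \<open>A\<close>.\<close>

lemma magnus_kernel_coset_iff:
  assumes A: "factor_closed A" and c: "g \<in> carrier (FG n)" "h \<in> carrier (FG n)"
  shows "inv\<^bsub>FG n\<^esub> g \<otimes>\<^bsub>FG n\<^esub> h \<in> magnus_kernel n A \<longleftrightarrow> vanish A (mag n g - mag n h)"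
proof -
  have 1: "mag n g * (mag n (inv\<^bsub>FG n\<^esub> g \<otimes>\<^bsub>FG n\<^esub> h) - 1) = - (mag n g - mag n h)"
    using c mag_inv[OF c(1)] by (simp add: mag_mult algebra_simps flip: mult.assoc)
  have 2: "mag n (inv\<^bsub>FG n\<^esub> g \<otimes>\<^bsub>FG n\<^esub> h) - 1 = - (mag n (inv\<^bsub>FG n\<^esub> g) * (mag n g - mag n h))"
    using c mag_inv[OF c(1)] by (simp add: mag_mult algebra_simps)
  show ?thesis
  proof
    assume "inv\<^bsub>FG n\<^esub> g \<otimes>\<^bsub>FG n\<^esub> h \<in> magnus_kernel n A"
    then have "vanish A (- (mag n g - mag n h))"
      unfolding 1[symmetric] by (intro vanish_mult(2)[OF A]) (simp add: magnus_kernel_def)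
    from vanish_uminus[OF this] show "vanish A (mag n g - mag n h)" by simp
  next
    assume "vanish A (mag n g - mag n h)"
    then have "vanish A (mag n (inv\<^bsub>FG n\<^esub> g \<otimes>\<^bsub>FG n\<^esub> h) - 1)"
      unfolding 2 by (intro vanish_uminus vanish_mult(2)[OF A])
    then show "inv\<^bsub>FG n\<^esub> g \<otimes>\<^bsub>FG n\<^esub> h \<in> magnus_kernel n A"
      using c by (simp add: magnus_kernel_def)
  qed
qed

text \<open>The constant terms cancel in \<open>x y - y x\<close>. Up to a right factor, the
  expansion of a group commutator minus one is thus a Lie bracket, which is why leading terms of
  commutators can be computed in the free Lie ring.\<close>

lemma mag_comm:
  assumes "x \<in> carrier (FG n)" "y \<in> carrier (FG n)"
  shows "mag n (F.comm n x y) - 1 =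
    ((mag n x - 1) * (mag n y - 1) - (mag n y - 1) * (mag n x - 1)) * mag n (inv\<^bsub>FG n\<^esub> x \<otimes>\<^bsub>FG n\<^esub> inv\<^bsub>FG n\<^esub> y)"
proof -
  have "(mag n y * mag n x) * (mag n (inv\<^bsub>FG n\<^esub> x) * mag n (inv\<^bsub>FG n\<^esub> y)) =
      mag n y * (mag n x * mag n (inv\<^bsub>FG n\<^esub> x)) * mag n (inv\<^bsub>FG n\<^esub> y)"
    by (simp add: mult.assoc)
  then have "mag n y * mag n x * (mag n (inv\<^bsub>FG n\<^esub> x) * mag n (inv\<^bsub>FG n\<^esub> y)) = 1"
    using mag_inv assms by simp
  moreover have "(mag n x - 1) * (mag n y - 1) - (mag n y - 1) * (mag n x - 1) = mag n x * mag n y - mag n y * mag n x"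
    by (simp add: algebra_simps)
  ultimately show ?thesis
    using assms by (simp add: gcomm_def mag_mult left_diff_distrib mult.assoc)
qed

text \<open>Covers the two gradings in use: the length, which matches the lower central series of
  the free group, and the number of occurrences of \<open>j\<close>, which matches that of
  \<open>N j\<close>.\<close>

definition additive_weight :: "(nat list \<Rightarrow> nat) \<Rightarrow> bool" where
  "additive_weight \<nu> \<longleftrightarrow> (\<forall>u v. \<nu> (u @ v) = \<nu> u + \<nu> v)"

lemma additive_length: "additive_weight length"
  by (simp add: additive_weight_def)

lemma additive_count: "additive_weight (\<lambda>u. count_list u j)"
  by (simp add: additive_weight_def)

lemma additive_take_drop: "additive_weight \<nu> \<Longrightarrow> \<nu> (take i u) + \<nu> (drop i u) = \<nu> u"
  unfolding additive_weight_def by (metis append_take_drop_id)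

lemma factor_closed_additive: "additive_weight \<nu> \<Longrightarrow> factor_closed {u. \<nu> u < m}"
  using additive_take_drop unfolding factor_closed_def
  by (metis (no_types, lifting) add_leD1 add_leD2 le_refl mem_Collect_eq order.strict_trans1)

lemma vanish_mult_additive:
  assumes \<nu>: "additive_weight \<nu>" and f: "vanish {u. \<nu> u < a} f" and g: "vanish {u. \<nu> u < b} g"
  shows "vanish {u. \<nu> u < a + b} (f * g)"
proof -
  have "coeff f (take i u) * coeff g (drop i u) = 0" if "\<nu> u < a + b" for u i
  proof -
    have "\<nu> (take i u) < a \<or> \<nu> (drop i u) < b"
      using additive_take_drop[OF \<nu>, of i u] that by linarith
    then show ?thesis using f g by (auto simp: vanish_def)
  qed
  then show ?thesis unfolding vanish_def coeff_mult by (blast intro: sum.neutral)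
qed

abbreviation deg_kernel :: "nat \<Rightarrow> (nat list \<Rightarrow> nat) \<Rightarrow> nat \<Rightarrow> nat word set set" where
  "deg_kernel n \<nu> m \<equiv> magnus_kernel n {u. \<nu> u < m}"

lemma deg_kernel_normal: "additive_weight \<nu> \<Longrightarrow> deg_kernel n \<nu> m \<lhd> FG n"
  by (rule magnus_kernel_normal[OF factor_closed_additive])

lemma comm_deg_kernel:
  assumes \<nu>: "additive_weight \<nu>" and x: "x \<in> deg_kernel n \<nu> a" and y: "y \<in> deg_kernel n \<nu> b"
  shows "F.comm n x y \<in> deg_kernel n \<nu> (a + b)"
proof -
  have c: "x \<in> carrier (FG n)" "y \<in> carrier (FG n)"
    and v: "vanish {u. \<nu> u < a} (mag n x - 1)" "vanish {u. \<nu> u < b} (mag n y - 1)"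
    using x y by (simp_all add: magnus_kernel_def)
  have "vanish {u. \<nu> u < a + b} ((mag n x - 1) * (mag n y - 1) - (mag n y - 1) * (mag n x - 1))"
    using vanish_mult_additive[OF \<nu> v] vanish_mult_additive[OF \<nu> v(2,1)]
    by (intro vanish_diff) (simp_all add: add.commute)
  then show ?thesis using c vanish_mult(1)[OF factor_closed_additive[OF \<nu>]]
    by (simp add: magnus_kernel_def mag_comm)
qed

lemma lower_central_deg_kernel:
  assumes \<nu>: "additive_weight \<nu>" and H: "H \<subseteq> deg_kernel n \<nu> 1" and q: "1 \<le> q"
  shows "lower_central (FG n) H q \<subseteq> deg_kernel n \<nu> q"
  using q
proof (induction q rule: dec_induct)
  case (step q)
  have "{F.comm n x y |x y. x \<in> H \<and> y \<in> lower_central (FG n) H q} \<subseteq> deg_kernel n \<nu> (Suc q)"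
    using comm_deg_kernel[OF \<nu>, of _ n 1 _ q] H step.IH unfolding plus_1_eq_Suc by blast
  then show ?case
    unfolding lower_central_Suc[OF step.hyps(1)]
    by (rule F.generate_subgroup_incl[OF _ normal_imp_subgroup[OF deg_kernel_normal[OF \<nu>]]])
qed (use H in \<open>simp add: One_nat_def\<close>)

lemma alpha_kernel:
  assumes "i \<in> {1..n}" "[i] \<notin> A"
  shows "alpha n i \<in> magnus_kernel n A"
  using assms free_gen_closed[of i "{1..n}"] by (auto simp: magnus_kernel_def mag_alpha vanish_def)

lemma carrier_deg_kernel: "carrier (FG n) \<subseteq> deg_kernel n length 1"
  by (rule free_group_generated)
    (blast intro: normal_imp_subgroup deg_kernel_normal additive_length, auto intro: alpha_kernel)

lemma mag_coeff_Nil [simp]: "g \<in> carrier (FG n) \<Longrightarrow> coeff (mag n g) [] = 1"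
  using carrier_deg_kernel by (auto simp: magnus_kernel_def vanish_def)

lemma lcs_deg_kernel: "1 \<le> q \<Longrightarrow> F.lcs n q \<subseteq> deg_kernel n length q"
  by (rule lower_central_deg_kernel[OF additive_length carrier_deg_kernel])

lemma N_deg_kernel: "j \<in> {1..n} \<Longrightarrow> FA.N n j \<subseteq> deg_kernel n (\<lambda>u. count_list u j) 1"
  by (rule F.normal_closure_least, rule deg_kernel_normal[OF additive_count], rule alpha_kernel) auto

definition adm :: "nat \<Rightarrow> (nat \<Rightarrow> nat) \<Rightarrow> nat list set" where
  "adm n e = {u. set u \<subseteq> {1..n} \<and> (\<forall>j\<in>{1..n}. count_list u j < e j)}"

lemma factor_closed_adm: "factor_closed (adm n e)"
proof -
  have "count_list (take i u) j \<le> count_list u j" "count_list (drop i u) j \<le> count_list u j" for i j and u :: "nat list"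
    using additive_take_drop[OF additive_count, of i u j] by linarith+
  then have "take i u \<in> adm n e \<and> drop i u \<in> adm n e" if u: "u \<in> adm n e" for u i
    using u set_take_subset[of i u] set_drop_subset[of i u] unfolding adm_def mem_Collect_eq
    by (meson le_less_trans subset_trans)
  then show ?thesis by (simp add: factor_closed_def)
qed

lemma gprod_magnus_kernel:
  assumes "\<And>j. j \<in> {1..n} \<Longrightarrow> 1 \<le> e j"
  shows "FA.gprod n e \<subseteq> magnus_kernel n (adm n e)"
proof (rule FA.gprod_least)
  show "subgroup (magnus_kernel n (adm n e)) (FG n)"
    by (intro normal_imp_subgroup magnus_kernel_normal factor_closed_adm)
  fix j assume j: "j \<in> {1..n}"
  have "lower_central (FG n) (FA.N n j) (e j) \<subseteq> deg_kernel n (\<lambda>u. count_list u j) (e j)"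
    by (rule lower_central_deg_kernel[OF additive_count N_deg_kernel[OF j] assms[OF j]])
  also have "\<dots> \<subseteq> magnus_kernel n (adm n e)"
    using j by (auto simp: magnus_kernel_def vanish_def adm_def)
  finally show "lower_central (FG n) (FA.N n j) (e j) \<subseteq> magnus_kernel n (adm n e)" .
qed

section \<open>Lyndon words\<close>

lemma append_less_cancel_left: "u @ v < u @ w \<longleftrightarrow> v < (w :: 'a :: linorder list)"
  by (induction u) auto

lemma less_append_self: "v \<noteq> [] \<Longrightarrow> u < u @ (v :: 'a :: linorder list)"
  by (induction u) (auto simp: neq_Nil_conv)

lemma le_append_self: "u \<le> u @ (v :: 'a :: linorder list)"
  using less_append_self[of v u] by (cases "v = []") auto

text \<open>Either the comparison is decided at a differing letter, and then anything may be
  appended to both words, or the smaller word is a proper prefix. The comparisons of suffixes below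
  split along these two cases.\<close>

lemma less_cases_prefix:
  fixes a b :: "'a :: linorder list"
  assumes "a < b"
  obtains (prefix) z where "z \<noteq> []" "b = a @ z" | (differ) "\<And>x y. a @ x < b @ y"
proof -
  have "(\<exists>z. z \<noteq> [] \<and> b = a @ z) \<or> (\<forall>x y. a @ x < b @ y)"
    using assms
  proof (induction a arbitrary: b)
    case (Cons c a)
    then show ?case by (cases b) auto
  qed auto
  then show thesis using that by blast
qed

lemma less_append_same_length:
  fixes a b :: "'a :: linorder list"
  assumes "a < b" "length b \<le> length a"
  shows "a @ x < b @ y"
  using assms(1) by (cases rule: less_cases_prefix) (use assms in auto)

definition lyndon :: "'a :: linorder list \<Rightarrow> bool" where
  "lyndon w \<longleftrightarrow> w \<noteq> [] \<and> (\<forall>u v. w = u @ v \<longrightarrow> u \<noteq> [] \<longrightarrow> v \<noteq> [] \<longrightarrow> w < v)"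

text \<open>The standard factorization of the Lyndon word \<open>u @ v\<close>. The last clause
  makes \<open>v\<close> the least proper suffix of \<open>u @ v\<close>: a proper suffix of
  \<open>v\<close> is larger than \<open>v\<close>, and \<open>s @ v\<close> is larger than
  \<open>s\<close>.\<close>

definition standard :: "'a :: linorder list \<Rightarrow> 'a list \<Rightarrow> bool" where
  "standard u v \<longleftrightarrow> lyndon u \<and> lyndon v \<and> u < v \<and>
    (\<forall>a s. u = a @ s \<longrightarrow> a \<noteq> [] \<longrightarrow> s \<noteq> [] \<longrightarrow> v \<le> s)"

lemma lyndon_less_suffix: "lyndon (u @ v) \<Longrightarrow> u \<noteq> [] \<Longrightarrow> v \<noteq> [] \<Longrightarrow> u @ v < v"
  by (auto simp: lyndon_def)

lemma lyndon_not_Nil: "lyndon w \<Longrightarrow> w \<noteq> []"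
  by (simp add: lyndon_def)

lemma singleton_eq_append: "[i] = u @ v \<Longrightarrow> u \<noteq> [] \<Longrightarrow> v \<noteq> [] \<Longrightarrow> P"
  by (cases u) auto

lemma lyndon_singleton: "lyndon [i]"
  unfolding lyndon_def by (auto elim: singleton_eq_append)

text \<open>Only the prefix case is at issue: if \<open>v = u @ z\<close>, then \<open>v < z\<close>
  because \<open>v\<close> is Lyndon, and prepending \<open>u\<close> gives the claim.\<close>

lemma append_less_lyndon:
  assumes "lyndon v" "u < v" "u \<noteq> []"
  shows "u @ v < v"
  using assms(2)
proof (cases rule: less_cases_prefix)
  case (prefix z)
  then have "v < z" using lyndon_less_suffix[of u z] assms by simp
  then show ?thesis using prefix append_less_cancel_left[of u v z] by simp
next
  case differ
  then show ?thesis using differ[of v "[]"] by simp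
qed

lemma lyndon_append:
  assumes u: "lyndon u" and v: "lyndon v" and uv: "u < v"
  shows "lyndon (u @ v)"
  unfolding lyndon_def
proof (intro conjI allI impI)
  have ne: "u \<noteq> []" "v \<noteq> []" using u v lyndon_not_Nil by auto
  then show "u @ v \<noteq> []" by simp
  have uvv: "u @ v < v" using append_less_lyndon v uv ne by blast
  fix a s assume as: "u @ v = a @ s" "a \<noteq> []" "s \<noteq> []"
  then obtain t where "(u = a @ t \<and> t @ v = s) \<or> (u @ t = a \<and> v = t @ s)"
    by (auto simp: append_eq_append_conv2)
  then consider t where "a = u @ t" "v = t @ s" | t where "t \<noteq> []" "u = a @ t" "s = t @ v"
    by (cases "t = []") fastforce+
  then show "u @ v < s"
  proof cases
    case 1
    then have "v \<le> s" using lyndon_less_suffix[of t s] v as by (cases "t = []") auto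
    then show ?thesis using uvv by simp
  next
    case 2
    then have "u < t" using lyndon_less_suffix[of a t] u as by simp
    then show ?thesis unfolding 2(3) by (rule less_append_same_length) (simp add: 2(2))
  qed
qed

text \<open>The right part \<open>v\<close> is the least proper suffix of \<open>w\<close>, hence
  Lyndon. The claims about proper suffixes \<open>s\<close> of the left part come from comparing
  \<open>v\<close> or \<open>w\<close> with suffixes of \<open>w\<close> such as
  \<open>s @ v\<close>.\<close>

lemma lyndon_standard:
  assumes w: "lyndon w" and len: "2 \<le> length w"
  obtains u v where "w = u @ v" "standard u v" "\<And>a s. w = a @ s \<Longrightarrow> a \<noteq> [] \<Longrightarrow> s \<noteq> [] \<Longrightarrow> v \<le> s"
proof -
  define S where "S = {s. s \<noteq> [] \<and> (\<exists>a. a \<noteq> [] \<and> w = a @ s)}"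
  have "S \<subseteq> (\<lambda>i. drop i w) ` {..length w}"
  proof
    fix s assume "s \<in> S"
    then obtain a where "w = a @ s" by (auto simp: S_def)
    then have "s = drop (length a) w" "length a \<le> length w" by simp_all
    then show "s \<in> (\<lambda>i. drop i w) ` {..length w}" by blast
  qed
  then have "finite S" by (rule finite_subset) simp
  moreover have "drop 1 w \<in> S"
    unfolding S_def using len by (auto intro!: exI[of _ "take 1 w"])
  ultimately have v: "Min S \<in> S" "\<And>s. s \<in> S \<Longrightarrow> Min S \<le> s" by (auto intro: Min_in)
  define v where "v = Min S"
  obtain u where u: "u \<noteq> []" "w = u @ v" "v \<noteq> []" using v(1) by (auto simp: S_def v_def)
  have min: "v \<le> s" if "w = a @ s" "a \<noteq> []" "s \<noteq> []" for a s
    using v(2)[of s] that unfolding v_def by (auto simp: S_def)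
  have lv: "lyndon v" unfolding lyndon_def
  proof (intro conjI allI impI)
    fix a s assume as: "v = a @ s" "a \<noteq> []" "s \<noteq> []"
    then have "v \<le> s" using min[of "u @ a" s] u by simp
    moreover have "v \<noteq> s" using as by simp
    ultimately show "v < s" by simp
  qed (use u in simp)
  have lu: "lyndon u" unfolding lyndon_def
  proof (intro conjI allI impI)
    fix a s assume as: "u = a @ s" "a \<noteq> []" "s \<noteq> []"
    show "u < s"
    proof (rule ccontr)
      assume "\<not> u < s"
      moreover have "u \<noteq> s" using as by simp
      ultimately have "s < u" by simp
      then show False
      proof (cases rule: less_cases_prefix)
        case (prefix z)
        have "w < s @ v" using lyndon_less_suffix[of a "s @ v"] w u as by simp
        then have "s @ z @ v < s @ v" using u prefix by simp
        then have "z @ v < v" using append_less_cancel_left by blast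
        moreover have "v \<le> z @ v"
        proof -
          have "length s + length z = length a + length s" using prefix as by (metis length_append)
          then have "z @ v = drop (length s) w" "0 < length s" using u prefix as by auto
          then show ?thesis using min[of s "z @ v"] u prefix as by simp
        qed
        ultimately show False by simp
      next
        case differ
        have "w < s @ v" using lyndon_less_suffix[of a "s @ v"] w u as by simp
        moreover have "s @ v < u @ v" by (rule differ)
        ultimately show False using u by simp
      qed
    qed
  qed (use u in simp)
  have "u < u @ v" using u less_append_self by blast
  also have "\<dots> < v" using lyndon_less_suffix w u by blast
  finally have "u < v" .
  moreover have "v \<le> s" if "u = a @ s" "a \<noteq> []" "s \<noteq> []" for a s
  proof (rule ccontr)
    assume "\<not> v \<le> s"
    then have "s < v" by simp
    moreover have "u < s" using lyndon_less_suffix[of a s] lu that by simp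
    ultimately have "v \<le> s @ v" and "s < v" using min[of a "s @ v"] u that by auto
    from \<open>s < v\<close> show False
    proof (cases rule: less_cases_prefix)
      case (prefix z)
      then have "v < z" using lyndon_less_suffix[of s z] lv that by simp
      then have "s @ v < s @ z" using append_less_cancel_left by blast
      then show False using prefix \<open>v \<le> s @ v\<close> by simp
    next
      case differ
      then show False using differ[of v "[]"] \<open>v \<le> s @ v\<close> by simp
    qed
  qed
  ultimately have "standard u v" using lu lv by (simp add: standard_def)
  then show thesis using that u min by blast
qed

text \<open>If \<open>u\<close> were shorter than \<open>u'\<close>, then \<open>v = t @ v'\<close>
  for a proper suffix \<open>t\<close> of \<open>u'\<close>, and \<open>v' \<le> t < v\<close>
  contradicts \<open>v < v'\<close>, which holds because \<open>v\<close> is Lyndon.\<close>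

lemma standard_unique:
  assumes "standard u v" "standard u' v'" "u @ v = u' @ v'"
  shows "u = u' \<and> v = v'"
proof -
  have False if st: "standard u v" "standard u' v'" and e: "u @ v = u' @ v'" and l: "length u < length u'"
    for u v u' v' :: "'a list"
  proof -
    obtain t where t: "u' = u @ t" "v = t @ v'" "t \<noteq> []"
      using e l by (auto simp: append_eq_append_conv2)
    have ne: "u \<noteq> []" "v' \<noteq> []" using st by (auto simp: standard_def lyndon_def)
    have "v' \<le> t" using st(2) t ne by (auto simp: standard_def)
    moreover have "t < v" unfolding t(2) by (rule less_append_self[OF ne(2)])
    moreover have "v < v'" using st(1) t ne lyndon_less_suffix[of t v'] by (auto simp: standard_def)
    ultimately show False by order
  qed
  note * = this
  have "length u = length u'"
  proof (cases "length u" "length u'" rule: linorder_cases)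
    case less
    from *[OF assms less] show ?thesis ..
  next
    case greater
    from *[OF assms(2,1) assms(3)[symmetric] greater] show ?thesis ..
  qed
  then show ?thesis using assms(3) by simp
qed

text \<open>Prepares the Jacobi step of straightening. Some proper suffix of \<open>u\<close> is
  below \<open>v\<close>, hence so is the least one, \<open>u2\<close>; and \<open>u1\<close> is
  below \<open>v\<close> as a prefix of \<open>u\<close>.\<close>

lemma standard_append:
  assumes u: "lyndon u" and v: "lyndon v" and uv: "u < v" and "\<not> standard u v"
  obtains u1 u2 where "u = u1 @ u2" "standard u1 u2" "u2 < v" "u1 < v"
proof -
  obtain a s where s: "u = a @ s" "a \<noteq> []" "s \<noteq> []" "s < v"
    using assms by (auto simp: standard_def not_le)
  have "2 \<le> length u" using s by (auto simp: neq_Nil_conv)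
  then obtain u1 u2 where u12: "u = u1 @ u2" "standard u1 u2"
      "\<And>a s. u = a @ s \<Longrightarrow> a \<noteq> [] \<Longrightarrow> s \<noteq> [] \<Longrightarrow> u2 \<le> s"
    using lyndon_standard[OF u] by blast
  have "u2 < v" using u12(3)[OF s(1-3)] s(4) by simp
  moreover have "u1 \<le> u" unfolding u12(1) by (rule le_append_self)
  ultimately show thesis using that u12 uv by force
qed

text \<open>A choice, in order that \<open>lyndon_comm\<close> can recurse on a single word; by
  \<open>standard_unique\<close> there is at most one candidate.\<close>

definition factorization :: "'a :: linorder list \<Rightarrow> 'a list \<times> 'a list" where
  "factorization w = (SOME p. w = fst p @ snd p \<and> standard (fst p) (snd p))"

lemma factorization_standard:
  assumes "standard u v"
  shows "factorization (u @ v) = (u, v)"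
proof -
  have "\<exists>p. u @ v = fst p @ snd p \<and> standard (fst p) (snd p)"
    using assms by (intro exI[of _ "(u, v)"]) simp
  from someI_ex[OF this] have "u @ v = fst (factorization (u @ v)) @ snd (factorization (u @ v))"
    "standard (fst (factorization (u @ v))) (snd (factorization (u @ v)))"
    unfolding factorization_def by blast+
  from standard_unique[OF assms this(2,1)] show ?thesis by (simp add: prod_eq_iff)
qed

text \<open>The commutators whose leading Magnus terms are the Lyndon basis of the free Lie ring.\<close>

function lyndon_comm :: "('a, 'm) monoid_scheme \<Rightarrow> (nat \<Rightarrow> 'a) \<Rightarrow> nat list \<Rightarrow> 'a" where
  "lyndon_comm G x w =
    (if \<exists>u v. w = u @ v \<and> standard u v
     then gcomm G (lyndon_comm G x (fst (factorization w))) (lyndon_comm G x (snd (factorization w)))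
     else x (hd w))"
  by auto
termination
proof (relation "Wellfounded.measure (\<lambda>(G, x, w). length w)"; clarsimp)
  fix u v :: "nat list" assume "standard u v"
  then show "length (fst (factorization (u @ v))) < length u + length v"
    and "length (snd (factorization (u @ v))) < length u + length v"
    by (auto simp: factorization_standard standard_def lyndon_def)
qed

declare lyndon_comm.simps [simp del]

lemma lyndon_comm_append:
  "standard u v \<Longrightarrow> lyndon_comm G x (u @ v) = gcomm G (lyndon_comm G x u) (lyndon_comm G x v)"
  by (subst lyndon_comm.simps) (auto simp: factorization_standard)

lemma lyndon_comm_singleton: "lyndon_comm G x [i] = x i"
  by (subst lyndon_comm.simps) (auto simp: standard_def lyndon_def elim: singleton_eq_append)

lemma lyndon_induct [consumes 1, case_names singleton append]:
  assumes "lyndon w" "\<And>i. P [i]"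
    and "\<And>u v. standard u v \<Longrightarrow> P u \<Longrightarrow> P v \<Longrightarrow> P (u @ v)"
  shows "P w"
  using assms(1)
proof (induction "length w" arbitrary: w rule: less_induct)
  case less
  show ?case
  proof (cases "2 \<le> length w")
    case True
    obtain u v where uv: "w = u @ v" "standard u v" by (rule lyndon_standard[OF less.prems True], rule that)
    then have l: "lyndon u" "lyndon v" by (auto simp: standard_def)
    then have "length u < length w" "length v < length w" using uv by (auto simp: lyndon_def)
    then show ?thesis using less.hyps l assms(3)[OF uv(2)] uv by blast
  next
    case False
    then have "\<exists>i. w = [i]" using lyndon_not_Nil[OF less.prems] by (cases w) (auto simp: One_nat_def Suc_le_eq)
    then show ?thesis using assms(2) by blast
  qed
qed

section \<open>Lyndon commutators span the lower central factors\<close>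

lemma lyndon_length: "lyndon w \<Longrightarrow> 1 \<le> length w"
  by (simp add: lyndon_def One_nat_def Suc_le_eq)

context group_with_gens
begin

abbreviation lc :: "nat list \<Rightarrow> 'a" where
  "lc \<equiv> lyndon_comm G x"

definition lyn :: "nat \<Rightarrow> nat list set" where
  "lyn q = {w. lyndon w \<and> set w \<subseteq> {1..n} \<and> length w = q}"

text \<open>For \<open>A \<subseteq> lyn q\<close>, the preimage in \<open>lcs q\<close> of the
  subgroup that the commutators of \<open>A\<close> generate in the abelian group
  \<open>lcs q\<close> modulo \<open>lcs (Suc q)\<close>. Preimages make it possible to stay in
  \<open>G\<close>.\<close>

definition lspan :: "nat list set \<Rightarrow> nat \<Rightarrow> 'a set" where
  "lspan A q = generate G (lc ` A \<union> lcs (Suc q))"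

lemma lc_mem_lcs:
  assumes "lyndon w" "set w \<subseteq> {1..n}"
  shows "lc w \<in> lcs (length w)"
  using assms
proof (induction w rule: lyndon_induct)
  case (singleton i)
  then show ?case using gens_carrier[of i] by (simp add: lyndon_comm_singleton)
next
  case (append u v)
  have "1 \<le> length u" "1 \<le> length v"
    using append.hyps lyndon_length by (auto simp: standard_def)
  then show ?case using append
    by (auto simp: lyndon_comm_append intro!: comm_mem_lcs)
qed

lemma lc_closed: "lyndon w \<Longrightarrow> set w \<subseteq> {1..n} \<Longrightarrow> lc w \<in> carrier G"
  using lc_mem_lcs lcs_carrier by blast

lemma lc_lyn: "A \<subseteq> lyn q \<Longrightarrow> lc ` A \<subseteq> lcs q"
  using lc_mem_lcs by (auto simp: lyn_def)

lemma lspan_base: "A \<subseteq> lyn q \<Longrightarrow> lc ` A \<union> lcs (Suc q) \<subseteq> carrier G"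
  using lc_lyn lcs_carrier by blast

lemma lspan_subgroup: "A \<subseteq> lyn q \<Longrightarrow> subgroup (lspan A q) G"
  unfolding lspan_def by (rule generate_is_subgroup[OF lspan_base])

lemma lspan_mem: "w \<in> A \<Longrightarrow> lc w \<in> lspan A q"
  unfolding lspan_def by (auto intro: generate.incl)

lemma lcs_subset_lspan: "lcs (Suc q) \<subseteq> lspan A q"
  unfolding lspan_def by (auto intro: generate.incl)

lemma lspan_mono: "A \<subseteq> B \<Longrightarrow> lspan A q \<subseteq> lspan B q"
  unfolding lspan_def by (intro mono_generate) blast

lemma lspan_least:
  assumes "subgroup S G" "\<And>w. w \<in> A \<Longrightarrow> lc w \<in> S" "lcs (Suc q) \<subseteq> S"
  shows "lspan A q \<subseteq> S"
  unfolding lspan_def using assms by (intro generate_subgroup_incl) auto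

lemma lspan_subset_lcs: "A \<subseteq> lyn q \<Longrightarrow> lspan A q \<subseteq> lcs q"
  using lc_lyn[of A q] lcs_antimono[of q "Suc q"] by (intro lspan_least lcs_subgroup) auto

lemma comm_lspan_left:
  assumes A: "A \<subseteq> lyn p" and p: "1 \<le> p" "1 \<le> r" and y: "y \<in> lcs r"
    and S: "subgroup S G" "lcs (p + r + 1) \<subseteq> S"
    and gen: "\<And>w. w \<in> A \<Longrightarrow> comm (lc w) y \<in> S" and z: "z \<in> lspan A p"
  shows "comm z y \<in> S"
proof -
  have "lspan A p \<subseteq> {x \<in> lcs p. comm x y \<in> S}"
  proof (rule lspan_least)
    show "subgroup {x \<in> lcs p. comm x y \<in> S} G"
      by (rule subgroup_comm_lcs(1)[OF S(1) p S(2) y])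
    show "lc w \<in> {x \<in> lcs p. comm x y \<in> S}" if "w \<in> A" for w
      using that A lc_lyn[OF A] gen by auto
    show "lcs (Suc p) \<subseteq> {x \<in> lcs p. comm x y \<in> S}"
    proof
      fix x assume x: "x \<in> lcs (Suc p)"
      have "comm x y \<in> lcs (p + r + 1)" using comm_mem_lcs[OF x y] p by (simp add: One_nat_def)
      then show "x \<in> {x \<in> lcs p. comm x y \<in> S}" using x S(2) lcs_antimono[of p "Suc p"] by auto
    qed
  qed
  then show ?thesis using z by blast
qed

text \<open>Recording that only words below \<open>v\<close> occur keeps the straightening induction
  going: after a second bracketing both entries are again below \<open>v\<close>.\<close>

definition below :: "nat \<Rightarrow> nat list \<Rightarrow> nat list set" where
  "below L v = {w \<in> lyn L. w < v}"

lemma below_lyn: "below L v \<subseteq> lyn L"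
  by (auto simp: below_def)

lemma below_mono: "v \<le> v' \<Longrightarrow> below L v \<subseteq> below L v'"
  by (auto simp: below_def)

lemma finite_lyn: "finite (lyn q)"
  by (rule finite_subset[OF _ finite_lists_length_eq[of "{1..n}" q]]) (auto simp: lyn_def)

text \<open>Straightening: induction on the total length, then on the larger of the two words. A bracket
  that is not already a Lyndon commutator is rewritten by the Jacobi identity along the standard
  factorization of its smaller entry.\<close>

lemma comm_lc_lspan:
  assumes "lyndon u" "lyndon v" "u < v" "set u \<subseteq> {1..n}" "set v \<subseteq> {1..n}"
  shows "comm (lc u) (lc v) \<in> lspan (below (length u + length v) v) (length u + length v)"
  using assms
\<comment> \<open>The lexicographic order has infinite descending chains, so it cannot serve as the
  second measure; the finitely many smaller words of bounded length are counted instead.\<close>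
proof (induction "(u, v)" arbitrary: u v
    rule: wf_induct_rule[OF wf_measures[of "[\<lambda>(u, v). length u + length v,
      \<lambda>(u, v). card {w. set w \<subseteq> {1..n} \<and> length w \<le> length u + length v \<and> w < v}]"]])
  case (1 u v)
  define L where "L = length u + length v"
  let ?S = "lspan (below L v) L"
  have S: "subgroup ?S G" "lcs (Suc L) \<subseteq> ?S"
    using lspan_subgroup[OF below_lyn] lcs_subset_lspan by auto
  have fin: "finite {w. set w \<subseteq> {1..n} \<and> length w \<le> L \<and> w < v}"
    by (rule finite_subset[OF _ finite_lists_length_le[of "{1..n}" L]]) auto
  have small: "comm (lc p) (lc q) \<in> lspan (below (length p + length q) q) (length p + length q)"
    if "lyndon p" "lyndon q" "p < q" "set p \<subseteq> {1..n}" "set q \<subseteq> {1..n}" "length p + length q < L" for p q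
    using that 1(1)[of p q] by (simp add: L_def)
  have lt: "comm (lc p) (lc q) \<in> ?S"
    if pq: "lyndon p" "lyndon q" "p < q" "set p \<subseteq> {1..n}" "set q \<subseteq> {1..n}" "length p + length q = L" "q < v" for p q
  proof -
    have "{w. set w \<subseteq> {1..n} \<and> length w \<le> L \<and> w < q} \<subset> {w. set w \<subseteq> {1..n} \<and> length w \<le> L \<and> w < v}"
      using pq by auto
    then have "card {w. set w \<subseteq> {1..n} \<and> length w \<le> L \<and> w < q} < card {w. set w \<subseteq> {1..n} \<and> length w \<le> L \<and> w < v}"
      by (rule psubset_card_mono[OF fin])
    then have "comm (lc p) (lc q) \<in> lspan (below L q) L"
      using 1(1)[of p q] pq by (simp add: L_def)
    moreover have "lspan (below L q) L \<subseteq> ?S" using pq by (intro lspan_mono below_mono) simp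
    ultimately show ?thesis by blast
  qed
  have both: "comm (lc p) (lc q) \<in> ?S"
    if pq: "lyndon p" "lyndon q" "set p \<subseteq> {1..n}" "set q \<subseteq> {1..n}" "length p + length q = L" "p < v" "q < v" for p q
  proof (cases p q rule: linorder_cases)
    case less
    then show ?thesis using lt that by blast
  next
    case equal
    have "lc p \<in> carrier G" using pq lc_closed by blast
    then have "comm (lc p) (lc q) = \<one>" using equal by (simp add: gcomm_def m_assoc)
    then show ?thesis using S(1) subgroup.one_closed by metis
  next
    case greater
    then have "comm (lc q) (lc p) \<in> ?S" using lt[of q p] that by (simp add: add.commute)
    then show ?thesis using comm_swap_mem[OF S(1)] pq lc_closed by blast
  qed
  show ?case
  proof (cases "standard u v")
    case True
    \<comment> \<open>\<open>u @ v < v\<close> because \<open>v\<close> is Lyndon, so the new Lyndon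
      word respects the bound.\<close>
    have "u @ v \<in> below L v"
      using 1(2-) lyndon_append[of u v] append_less_lyndon[of v u]
      by (auto simp: below_def lyn_def L_def lyndon_def)
    then show ?thesis using lspan_mem[of "u @ v" "below L v" L] True
      by (simp add: lyndon_comm_append L_def)
  next
    case False
    then obtain u1 u2 where u: "u = u1 @ u2" "standard u1 u2" "u2 < v" "u1 < v"
      using standard_append 1(2-4) by metis
    have l: "lyndon u1" "lyndon u2" using u(2) by (auto simp: standard_def)
    have s: "set u1 \<subseteq> {1..n}" "set u2 \<subseteq> {1..n}" using 1(5) u(1) by auto
    have len: "1 \<le> length u1" "1 \<le> length u2" "1 \<le> length v"
      using l 1(3) lyndon_length by auto
    have L: "L = length u1 + length u2 + length v" by (simp add: L_def u(1))
    have mem: "lc u1 \<in> lcs (length u1)" "lc u2 \<in> lcs (length u2)" "lc v \<in> lcs (length v)"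
      using lc_mem_lcs l s 1(3,6) by auto
    \<comment> \<open>The inner bracket has smaller total length, so it is straightened into words
      below \<open>v\<close>. Bracketing these with \<open>lc p'\<close> restores the full length,
      but now both words are below \<open>v\<close> and \<open>both\<close> applies.\<close>
    have step: "comm (comm (lc p) (lc v)) (lc p') \<in> ?S"
      if p: "lyndon p" "lyndon p'" "set p \<subseteq> {1..n}" "set p' \<subseteq> {1..n}" "p < v" "p' < v"
        "L = length p + length p' + length v" for p p'
    proof -
      let ?m = "length p + length v"
      have ne: "1 \<le> length p" "1 \<le> length p'" using p lyndon_length by auto
      have bel: "comm (lc p) (lc v) \<in> lspan (below ?m v) ?m"
        using small[of p v] p 1(3,6) ne lyndon_not_Nil[of p'] by simp
      show ?thesis
      proof (rule comm_lspan_left[OF below_lyn _ ne(2) _ S(1) _ _ bel])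
        show "lc p' \<in> lcs (length p')" using lc_mem_lcs p by blast
        show "lcs (?m + length p' + 1) \<subseteq> ?S" using S(2) p(7) by (simp add: algebra_simps One_nat_def)
        show "comm (lc w) (lc p') \<in> ?S" if "w \<in> below ?m v" for w
          using that p by (intro both) (auto simp: below_def lyn_def)
      qed (use ne in simp)
    qed
    have A: "comm (comm (lc u2) (lc v)) (lc u1) \<in> ?S"
      by (rule step) (use l s u L in auto)
    have "comm (comm (lc u1) (lc v)) (lc u2) \<in> ?S"
      by (rule step) (use l s u L in auto)
    \<comment> \<open>\<open>jacobi_mem\<close> wants the inner bracket in the opposite order. The
      \<open>z\<close> whose commutator with \<open>lc u2\<close> lies in the span form a subgroup,
      so the inner bracket may be inverted.\<close>
    have B: "comm (comm (lc v) (lc u1)) (lc u2) \<in> ?S"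
    proof -
      let ?T = "{z \<in> lcs (length u1 + length v). comm z (lc u2) \<in> ?S}"
      have T: "subgroup ?T G"
        by (rule subgroup_comm_lcs(1)[OF S(1) _ len(2) _ mem(2)]) (use len S(2) L in \<open>auto simp: algebra_simps One_nat_def\<close>)
      have "comm (lc u1) (lc v) \<in> ?T"
        using \<open>comm (comm (lc u1) (lc v)) (lc u2) \<in> ?S\<close> mem len by (auto intro: comm_mem_lcs)
      then have "comm (lc v) (lc u1) \<in> ?T" using comm_swap_mem[OF T] mem lcs_carrier by blast
      then show ?thesis by blast
    qed
    have "comm (comm (lc u1) (lc u2)) (lc v) \<in> ?S"
      by (rule jacobi_mem[OF S(1) _ len mem A B]) (use S(2) L in \<open>simp add: One_nat_def\<close>)
    then show ?thesis using u by (simp add: lyndon_comm_append L_def)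
  qed
qed

text \<open>\<open>lcs (Suc q)\<close> is generated by the commutators of \<open>G\<close> with
  \<open>lcs q\<close>. By bilinearity they reduce to brackets of \<open>lc w\<close> with a
  generator \<open>x i = lc [i]\<close>, which \<open>comm_lc_lspan\<close> straightens.\<close>

lemma lcs_subset_span_lyn:
  assumes gen: "carrier G \<subseteq> generate G (x ` {1..n})" and q: "1 \<le> q"
  shows "lcs q \<subseteq> lspan (lyn q) q"
  using q
proof (induction q rule: dec_induct)
  case base
  have "x ` {1..n} \<subseteq> lspan (lyn 1) 1"
  proof
    fix a assume "a \<in> x ` {1..n}"
    then obtain i where i: "a = x i" "i \<in> {1..n}" by blast
    then have "[i] \<in> lyn 1" by (simp add: lyn_def lyndon_singleton)
    then show "a \<in> lspan (lyn 1) 1" using lspan_mem[of "[i]" "lyn 1" 1] i by (simp add: lyndon_comm_singleton)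
  qed
  then have "generate G (x ` {1..n}) \<subseteq> lspan (lyn 1) 1"
    by (rule generate_subgroup_incl[OF _ lspan_subgroup[OF subset_refl]])
  then show ?case using gen by simp
next
  case (step q)
  let ?S = "lspan (lyn (Suc q)) (Suc q)"
  have S: "subgroup ?S G" "lcs (Suc (Suc q)) \<subseteq> ?S"
    using lspan_subgroup[OF subset_refl] lcs_subset_lspan by auto
  have gen_lc: "comm (lc w) (x i) \<in> ?S" if w: "w \<in> lyn q" and i: "i \<in> {1..n}" for w i
  proof -
    have w': "lyndon w" "set w \<subseteq> {1..n}" "length w = q" using w by (auto simp: lyn_def)
    have sub: "lspan (below (Suc q) v) (Suc q) \<subseteq> ?S" for v
      by (rule lspan_mono[OF below_lyn])
    have c: "lc w \<in> carrier G" "x i \<in> carrier G" using w' lc_closed i gens_carrier by auto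
    show ?thesis
    proof (cases w "[i]" rule: linorder_cases)
      case less
      then show ?thesis using comm_lc_lspan[of w "[i]"] w' i sub lyndon_singleton[of i]
        by (auto simp: lyndon_comm_singleton)
    next
      case equal
      then have "comm (lc w) (x i) = \<one>" using c by (simp add: lyndon_comm_singleton gcomm_def m_assoc)
      then show ?thesis using S(1) subgroup.one_closed by metis
    next
      case greater
      then have "comm (x i) (lc w) \<in> ?S"
        using comm_lc_lspan[of "[i]" w] w' i sub[of w] lyndon_singleton[of i]
        by (auto simp: lyndon_comm_singleton)
      then show ?thesis using comm_swap_mem[OF S(1)] c by blast
    qed
  qed
  have gen1: "comm y (x i) \<in> ?S" if i: "i \<in> {1..n}" and y: "y \<in> lcs q" for i y
    by (rule comm_lspan_left[OF subset_refl step.hyps(1) order_refl[of 1] _ S(1)])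
      (use S(2) gens_carrier[OF i] y step.IH gen_lc i in \<open>auto simp: One_nat_def\<close>)
  have "comm a y \<in> ?S" if a: "a \<in> carrier G" and y: "y \<in> lcs q" for a y
  proof -
    have yc: "y \<in> carrier G" using y lcs_carrier by blast
    have "generate G (x ` {1..n}) \<subseteq> {a \<in> lcs 1. comm a y \<in> ?S}"
    proof (rule generate_subgroup_incl)
      show "subgroup {a \<in> lcs 1. comm a y \<in> ?S} G"
        by (rule subgroup_comm_lcs(1)[OF S(1) _ step.hyps(1) _ y]) (use S(2) in \<open>auto simp: One_nat_def\<close>)
      show "x ` {1..n} \<subseteq> {a \<in> lcs 1. comm a y \<in> ?S}"
        using gen1[OF _ y] comm_swap_mem[OF S(1) yc] gens_carrier by auto
    qed
    then show ?thesis using gen a by auto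
  qed
  then show ?case
    unfolding lower_central_Suc[OF step.hyps(1)]
    by (intro generate_subgroup_incl[OF _ S(1)]) auto
qed

text \<open>Under a bracket the indices in the lower central series of \<open>N j\<close> add up, as
  the numbers of occurrences of \<open>j\<close> do. If one part contains no \<open>j\<close>,
  normality keeps the bracket in the term of the other part.\<close>

lemma lc_mem_gamma:
  assumes "lyndon w" "set w \<subseteq> {1..n}" and j: "j \<in> {1..n}" "1 \<le> count_list w j"
  shows "lc w \<in> lower_central G (N j) (count_list w j)"
  using assms(1,2,4)
proof (induction w rule: lyndon_induct)
  case (singleton i)
  then show ?case using normal_closure_mem by (auto simp: lyndon_comm_singleton One_nat_def split: if_splits)
next
  case (append u v)
  have uv: "lyndon u" "lyndon v" "set u \<subseteq> {1..n}" "set v \<subseteq> {1..n}"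
    using append by (auto simp: standard_def)
  have c: "lc u \<in> carrier G" "lc v \<in> carrier G" using uv lc_closed by auto
  note Nj = N_normal[OF j(1)]
  consider "count_list u j = 0" | "count_list v j = 0" | "1 \<le> count_list u j" "1 \<le> count_list v j"
    by linarith
  then show ?case
  proof cases
    case 1
    then show ?thesis using append c uv normal_comm(2)[OF lower_central_normal[OF Nj]]
      by (simp add: lyndon_comm_append)
  next
    case 2
    then show ?thesis using append c uv normal_comm(1)[OF lower_central_normal[OF Nj]]
      by (simp add: lyndon_comm_append)
  next
    case 3
    then show ?thesis using append uv
      by (simp add: lyndon_comm_append comm_mem_lower_central_add[OF Nj])
  qed
qed

end

section \<open>The Magnus expansion detects the product of lower central terms\<close>

lemma coeff_mult_lead:
  assumes "vanish {u. length u < a} f" "vanish {u. length u < b} g" "length z = a + b"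
  shows "coeff (f * g) z = coeff f (take a z) * coeff g (drop a z)"
proof -
  have "coeff f (take i z) * coeff g (drop i z) = 0" if "i \<le> length z" "i \<noteq> a" for i
  proof (cases "i < a")
    case True
    then show ?thesis using assms that by (simp add: vanish_def)
  next
    case False
    then have "length (drop i z) < b" using assms(3) that by auto
    then show ?thesis using assms(2) by (simp add: vanish_def)
  qed
  then have "coeff (f * g) z = (\<Sum>i\<in>{a}. coeff f (take i z) * coeff g (drop i z))"
    unfolding coeff_mult using assms(3) by (intro sum.mono_neutral_right) auto
  then show ?thesis by simp
qed

lemma coeff_mult_head_one:
  assumes "vanish {u. length u < a} f" "coeff g [] = 1" "length z = a"
  shows "coeff (f * g) z = coeff f z"
  using coeff_mult_lead[of a f 0 g z] assms by (simp add: vanish_def)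

abbreviation lie :: "nat \<Rightarrow> nat list \<Rightarrow> nat word set" where
  "lie n \<equiv> lyndon_comm (FG n) (alpha n)"

lemma lie_lcs: "lyndon w \<Longrightarrow> set w \<subseteq> {1..n} \<Longrightarrow> lie n w \<in> F.lcs n (length w)"
  by (rule FA.lc_mem_lcs)

lemma lie_deg:
  assumes "lyndon w" "set w \<subseteq> {1..n}"
  shows "lie n w \<in> deg_kernel n length (length w)"
  using lie_lcs[OF assms] lcs_deg_kernel[OF lyndon_length[OF assms(1)]] by blast

text \<open>Every word in the support of the expansion minus one contains each index at least as
  often as \<open>w\<close> does. Thus the commutators of inadmissible Lyndon words are invisible at
  admissible words.\<close>

lemma lie_content:
  assumes "lyndon w" "set w \<subseteq> {1..n}"
  shows "lie n w \<in> deg_kernel n (\<lambda>u. count_list u j) (count_list w j)"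
  using assms
proof (induction w rule: lyndon_induct)
  case (singleton i)
  show ?case unfolding lyndon_comm_singleton
    by (rule alpha_kernel) (use singleton in auto)
next
  case (append u v)
  then show ?case using comm_deg_kernel[OF additive_count[of j]] by (simp add: lyndon_comm_append)
qed

text \<open>Triangularity. Among the words of this length, the product of the series of
  \<open>u\<close> and \<open>v\<close> has least word \<open>u @ v\<close>, and the opposite
  product contains no word below \<open>v @ u\<close>, which is larger because
  \<open>u @ v < v\<close>.\<close>

lemma lie_lead:
  assumes "lyndon w" "set w \<subseteq> {1..n}" "length z = length w" "z \<le> w"
  shows "coeff (mag n (lie n w)) z = (if z = w then 1 else 0)"
  using assms
proof (induction w arbitrary: z rule: lyndon_induct)
  case (singleton i)
  then show ?case by (auto simp: lyndon_comm_singleton mag_alpha)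
next
  case (append u v)
  have uv: "lyndon u" "lyndon v" "set u \<subseteq> {1..n}" "set v \<subseteq> {1..n}" "u < v"
    using append by (auto simp: standard_def)
  have ne: "u \<noteq> []" "v \<noteq> []" using uv lyndon_not_Nil by auto
  let ?U = "mag n (lie n u) - 1" and ?V = "mag n (lie n v) - 1"
  have c: "lie n u \<in> carrier (FG n)" "lie n v \<in> carrier (FG n)" using uv FA.lc_closed by auto
  have d: "vanish {x. length x < length u} ?U" "vanish {x. length x < length v} ?V"
    using lie_deg uv by (simp_all add: magnus_kernel_def)
  have zl: "length z = length u + length v" using append.prems by simp
  have zne: "z \<noteq> []" using zl ne by auto
  have U: "coeff ?U y = (if y = u then 1 else 0)" if "length y = length u" "y \<le> u" for y
    using append.IH(1)[OF uv(3) that] that ne by auto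
  have V: "coeff ?V y = (if y = v then 1 else 0)" if "length y = length v" "y \<le> v" for y
    using append.IH(2)[OF uv(4) that] that ne by auto
  have le: "take k z < p \<or> (take k z = p \<and> drop k z \<le> q)"
    if "z \<le> p @ q" "length p = k" for p q k
  proof (rule ccontr)
    assume neg: "\<not> ?thesis"
    have lt: "length (take k z) \<le> length p" using that by simp
    have "p @ q < take k z @ drop k z"
    proof (cases "p < take k z")
      case True
      then show ?thesis by (rule less_append_same_length) (rule lt)
    next
      case False
      then have "take k z = p" "q < drop k z" using neg by auto
      then show ?thesis using append_less_cancel_left[of p q "drop k z"] by simp
    qed
    then show False using that(1) by simp
  qed
  have UV: "coeff (?U * ?V) z = (if z = u @ v then 1 else 0)"
  proof -
    have lens: "length (take (length u) z) = length u" "length (drop (length u) z) = length v"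
      using zl by auto
    have "coeff (?U * ?V) z = coeff ?U (take (length u) z) * coeff ?V (drop (length u) z)"
      by (rule coeff_mult_lead[OF d zl])
    also have "\<dots> = (if z = u @ v then 1 else 0)"
    proof -
      consider "take (length u) z < u" | "take (length u) z = u" "drop (length u) z \<le> v"
        using le[OF append.prems(3)] by blast
      then show ?thesis
      proof cases
        case 1
        then have "coeff ?U (take (length u) z) = 0" using U[OF lens(1)] by auto
        moreover have "z \<noteq> u @ v" using 1 by auto
        ultimately show ?thesis by simp
      next
        case 2
        have "drop (length u) z = v \<longleftrightarrow> z = u @ v" using 2(1) by (metis append_take_drop_id append_eq_conv_conj)
        then show ?thesis using U[OF lens(1)] V[OF lens(2)] 2 by auto
      qed
    qed
    finally show ?thesis .
  qed
  have VU: "coeff (?V * ?U) z = 0"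
  proof -
    have lens: "length (take (length v) z) = length v" "length (drop (length v) z) = length u"
      using zl by auto
    have "u @ v < v @ u"
      using append_less_lyndon[OF uv(2,5) ne(1)] le_append_self[of v u] by (rule less_le_trans)
    then have zlt: "z < v @ u" using append.prems(3) by simp
    consider "take (length v) z < v" | "take (length v) z = v" "drop (length v) z \<le> u"
      using le[OF less_imp_le[OF zlt] HOL.refl] by blast
    then have "coeff ?V (take (length v) z) * coeff ?U (drop (length v) z) = 0"
    proof cases
      case 1
      then show ?thesis using V[OF lens(1)] by auto
    next
      case 2
      then have "drop (length v) z \<noteq> u" using zlt by (metis append_take_drop_id less_irrefl)
      then show ?thesis using U[OF lens(2)] 2 by simp
    qed
    then show ?thesis using coeff_mult_lead[OF d(2,1)] zl by (simp add: add.commute)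
  qed
  \<comment> \<open>The bracket has no terms shorter than \<open>z\<close>, so the right factor in
    \<open>mag_comm\<close> enters the coefficient at \<open>z\<close> only through its constant
    term \<open>1\<close>.\<close>
  have van: "vanish {x. length x < length u + length v} (?U * ?V - ?V * ?U)"
    using vanish_mult_additive[OF additive_length d] vanish_mult_additive[OF additive_length d(2,1)]
    by (intro vanish_diff) (simp_all add: add.commute)
  have "coeff (mag n (F.comm n (lie n u) (lie n v)) - 1) z = coeff (?U * ?V - ?V * ?U) z"
    unfolding mag_comm[OF c] using c by (intro coeff_mult_head_one[OF van _ zl] mag_coeff_Nil) auto
  then show ?case using UV VU zne append.hyps by (simp add: lyndon_comm_append)
qed

definition lead_coeff0 :: "nat \<Rightarrow> nat \<Rightarrow> nat list \<Rightarrow> nat word set set" where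
  "lead_coeff0 n q w = {g \<in> F.lcs n q. coeff (mag n g) w = 0}"

text \<open>The cross term \<open>(mag n g - 1) * (mag n h - 1)\<close> starts in length
  \<open>2 * q\<close>. So on \<open>F.lcs n q\<close> the coefficient at a word of length
  \<open>q\<close> is a homomorphism to the integers, which allows exponents to be read off.\<close>

lemma coeff_lcs_mult:
  assumes g: "g \<in> F.lcs n q" and h: "h \<in> F.lcs n q" and w: "length w = q" "1 \<le> q"
  shows "coeff (mag n (g \<otimes>\<^bsub>FG n\<^esub> h)) w = coeff (mag n g) w + coeff (mag n h) w"
proof -
  have c: "g \<in> carrier (FG n)" "h \<in> carrier (FG n)" using g h F.lcs_carrier by auto
  have d: "vanish {u. length u < q} (mag n g - 1)" "vanish {u. length u < q} (mag n h - 1)"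
    using g h lcs_deg_kernel[OF w(2)] by (auto simp: magnus_kernel_def)
  have "vanish {u. length u < q + q} ((mag n g - 1) * (mag n h - 1))"
    by (rule vanish_mult_additive[OF additive_length d])
  then have "coeff ((mag n g - 1) * (mag n h - 1)) w = 0" using w by (simp add: vanish_def)
  moreover have "mag n (g \<otimes>\<^bsub>FG n\<^esub> h) = (mag n g - 1) * (mag n h - 1) + mag n g + mag n h - 1"
    using c by (simp add: mag_mult algebra_simps)
  moreover have "w \<noteq> []" using w by auto
  ultimately show ?thesis by simp
qed

lemma coeff_lcs_inv:
  assumes g: "g \<in> F.lcs n q" and w: "length w = q" "1 \<le> q"
  shows "coeff (mag n (inv\<^bsub>FG n\<^esub> g)) w = - coeff (mag n g) w"
proof -
  have "coeff (mag n (g \<otimes>\<^bsub>FG n\<^esub> inv\<^bsub>FG n\<^esub> g)) w = coeff (mag n g) w + coeff (mag n (inv\<^bsub>FG n\<^esub> g)) w"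
    using g w F.lcs_subgroup by (intro coeff_lcs_mult) (auto intro: subgroup.m_inv_closed)
  moreover have "w \<noteq> []" using w by auto
  ultimately show ?thesis using g F.lcs_carrier[OF g] by (simp add: mag_one)
qed

lemma coeff_lcs_pow:
  assumes g: "g \<in> F.lcs n q" and w: "length w = q" "1 \<le> q"
  shows "coeff (mag n (g [^]\<^bsub>FG n\<^esub> (c :: int))) w = c * coeff (mag n g) w"
proof -
  have ne: "w \<noteq> []" using w by auto
  have nat: "g [^]\<^bsub>FG n\<^esub> (m :: nat) \<in> F.lcs n q \<and> coeff (mag n (g [^]\<^bsub>FG n\<^esub> m)) w = int m * coeff (mag n g) w" for m
  proof (induction m)
    case 0
    then show ?case using ne subgroup.one_closed[OF F.lcs_subgroup] by (simp add: mag_one)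
  next
    case (Suc m)
    then show ?case using g w subgroup.m_closed[OF F.lcs_subgroup]
      by (simp add: coeff_lcs_mult[OF _ g w] algebra_simps)
  qed
  show ?thesis
  proof (cases "0 \<le> c")
    case True
    then obtain m where "c = int m" using nonneg_int_cases by blast
    then show ?thesis using nat[of m] by (simp add: int_pow_int)
  next
    case False
    then obtain m where m: "c = - int m" by (metis int_cases2 of_nat_0_le_iff)
    then have "g [^]\<^bsub>FG n\<^esub> c = inv\<^bsub>FG n\<^esub> (g [^]\<^bsub>FG n\<^esub> m)"
      using F.lcs_carrier[OF g] by (simp add: F.int_pow_neg int_pow_int)
    then show ?thesis using nat[of m] coeff_lcs_inv[OF _ w] m by simp
  qed
qed

lemma lead_coeff0_subgroup:
  assumes w: "length w = q" "1 \<le> q"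
  shows "subgroup (lead_coeff0 n q w) (FG n)"
proof (rule F.subgroupI)
  show "lead_coeff0 n q w \<subseteq> carrier (FG n)" using F.lcs_carrier by (auto simp: lead_coeff0_def)
  have "\<one>\<^bsub>FG n\<^esub> \<in> lead_coeff0 n q w"
    using w subgroup.one_closed[OF F.lcs_subgroup] by (auto simp: lead_coeff0_def mag_one)
  then show "lead_coeff0 n q w \<noteq> {}" by blast
qed (use w subgroup.m_closed[OF F.lcs_subgroup] subgroup.m_inv_closed[OF F.lcs_subgroup] in
    \<open>auto simp: lead_coeff0_def coeff_lcs_mult coeff_lcs_inv\<close>)

text \<open>Conjugation changes an element of \<open>lcs q\<close> only by a factor in
  \<open>lcs (Suc q)\<close>, and the span contains that term.\<close>

lemma (in group_with_gens) lspan_normal: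
  assumes A: "A \<subseteq> lyn q" and q: "1 \<le> q"
  shows "lspan A q \<lhd> G"
proof (rule normal_invI[OF lspan_subgroup[OF A]])
  fix g h assume g: "g \<in> carrier G" and h: "h \<in> lspan A q"
  have hl: "h \<in> lcs q" using h lspan_subset_lcs[OF A] by blast
  then have hc: "h \<in> carrier G" using lcs_carrier by blast
  have "comm g h \<in> lcs (Suc q)" using comm_mem_lower_central(1)[OF normal_self g hl q] .
  then have "comm g h \<otimes> h \<in> lspan A q"
    using h lcs_subset_lspan subgroup.m_closed[OF lspan_subgroup[OF A]] by blast
  then show "g \<otimes> h \<otimes> inv g \<in> lspan A q" using g hc by (simp add: gcomm_def m_assoc)
qed

text \<open>Modulo the normal subgroup \<open>lspan A q\<close> an element of the larger span is a
  power of \<open>lc w\<close>. The exponent \<open>c\<close> cancels this power, so it is the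
  negative of a coordinate of \<open>g\<close> at \<open>w\<close>.\<close>

lemma (in group_with_gens) lspan_insert:
  assumes A: "insert w A \<subseteq> lyn q" and q: "1 \<le> q" and g: "g \<in> lspan (insert w A) q"
  shows "\<exists>c :: int. g \<otimes> lc w [^] c \<in> lspan A q"
proof -
  have A': "A \<subseteq> lyn q" using A by simp
  let ?T = "lspan A q"
  have wc: "lc w \<in> carrier G" using A lc_closed by (auto simp: lyn_def)
  note T = lspan_normal[OF A' q] and sT = lspan_subgroup[OF A']
  let ?S = "{g \<in> carrier G. \<exists>c :: int. g \<otimes> lc w [^] c \<in> ?T}"
  have "lspan (insert w A) q \<subseteq> ?S"
  proof (rule lspan_least)
    show "subgroup ?S G"
    proof (rule subgroupI)
      have "\<one> \<otimes> lc w [^] (0::int) \<in> ?T" using subgroup.one_closed[OF sT] by simp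
      then show "?S \<noteq> {}" by blast
    next
      fix a assume "a \<in> ?S"
      then obtain c :: int where a: "a \<in> carrier G" "a \<otimes> lc w [^] c \<in> ?T" by blast
      let ?p = "lc w [^] c"
      have p: "?p \<in> carrier G" using wc by simp
      have "?p \<otimes> (a \<otimes> ?p) \<otimes> inv ?p \<in> ?T" using normal_invE(2)[OF T p a(2)] .
      then have "?p \<otimes> a \<in> ?T" using a p by (simp add: m_assoc)
      then have "inv (?p \<otimes> a) \<in> ?T" using sT by (rule subgroup.m_inv_closed[rotated])
      then have "inv a \<otimes> lc w [^] (- c) \<in> ?T"
        using a p wc by (simp add: inv_mult_group int_pow_neg)
      then show "inv a \<in> ?S" using a by blast
    next
      fix a b assume "a \<in> ?S" "b \<in> ?S"
      then obtain c d :: int where ab: "a \<in> carrier G" "a \<otimes> lc w [^] c \<in> ?T"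
        "b \<in> carrier G" "b \<otimes> lc w [^] d \<in> ?T" by blast
      let ?p = "lc w [^] c" and ?r = "lc w [^] d"
      have p: "?p \<in> carrier G" "?r \<in> carrier G" using wc by simp_all
      have "inv ?p \<otimes> (b \<otimes> ?r) \<otimes> ?p \<in> ?T" using normal_conj_inv[OF T p(1) ab(4)] .
      then have "(a \<otimes> ?p) \<otimes> (inv ?p \<otimes> (b \<otimes> ?r) \<otimes> ?p) \<in> ?T"
        using ab(2) subgroup.m_closed[OF sT] by blast
      moreover have "(a \<otimes> ?p) \<otimes> (inv ?p \<otimes> (b \<otimes> ?r) \<otimes> ?p) = (a \<otimes> b) \<otimes> lc w [^] (d + c)"
        using ab p wc by (simp add: m_assoc int_pow_mult[symmetric])
      ultimately show "a \<otimes> b \<in> ?S" using ab by auto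
    qed auto
    fix v assume "v \<in> insert w A"
    then show "lc v \<in> ?S"
    proof
      assume "v = w"
      moreover have "lc w \<otimes> lc w [^] (- 1 :: int) = \<one>" using wc by (simp add: int_pow_neg)
      ultimately have "lc v \<otimes> lc w [^] (- 1 :: int) \<in> ?T" using subgroup.one_closed[OF sT] by simp
      then show ?thesis using wc \<open>v = w\<close> by blast
    next
      assume v: "v \<in> A"
      then have "lc v \<in> carrier G" using A lc_closed by (auto simp: lyn_def)
      moreover from this have "lc v \<otimes> lc w [^] (0::int) \<in> ?T" using lspan_mem[OF v] by simp
      ultimately show ?thesis by blast
    qed
  next
    have "g \<otimes> lc w [^] (0::int) \<in> ?T \<and> g \<in> carrier G" if "g \<in> lcs (Suc q)" for g
      using that lcs_subset_lspan lcs_carrier by auto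
    then show "lcs (Suc q) \<subseteq> ?S" by blast
  qed
  then show ?thesis using g by blast
qed

text \<open>The smallest bad word in the support of \<open>g\<close> is the leading word of its Lyndon commutator only,
  so its exponent is the corresponding Magnus coefficient of \<open>g\<close>.\<close>

lemma lspan_remove_adm:
  assumes "finite B" "B \<subseteq> FA.lyn n q \<inter> adm n e" "1 \<le> q"
    and "g \<in> FA.lspan n (FA.lyn n q - adm n e \<union> B) q" "g \<in> magnus_kernel n (adm n e)"
  shows "g \<in> FA.lspan n (FA.lyn n q - adm n e) q"
  using assms
proof (induction B rule: finite_linorder_min_induct)
  case empty
  then show ?case by simp
next
  case (insert w B)
  let ?A = "FA.lyn n q - adm n e \<union> B"
  have A: "insert w ?A \<subseteq> FA.lyn n q" using insert.prems(1) by auto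
  have w: "lyndon w" "set w \<subseteq> {1..n}" "length w = q" "w \<in> adm n e"
    using insert.prems(1) by (auto simp: FA.lyn_def)
  obtain c :: int where c: "g \<otimes>\<^bsub>FG n\<^esub> lie n w [^]\<^bsub>FG n\<^esub> c \<in> FA.lspan n ?A q"
    using FA.lspan_insert[OF A insert.prems(2)] insert.prems(3) by auto
  \<comment> \<open>Every remaining generator has coefficient zero at \<open>w\<close>: the words of
    \<open>B\<close> are larger than \<open>w\<close> by the choice of induction, and an
    inadmissible word contains some index more often than \<open>w\<close> does.\<close>
  have "FA.lspan n ?A q \<subseteq> lead_coeff0 n q w"
  proof (rule FA.lspan_least[OF lead_coeff0_subgroup[OF w(3) insert.prems(2)]])
    fix v assume v: "v \<in> ?A"
    then have v': "lyndon v" "set v \<subseteq> {1..n}" "length v = q" using A by (auto simp: FA.lyn_def)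
    have "coeff (mag n (lie n v)) w = 0"
    proof (cases "v \<in> B")
      case True
      then have "w < v" using insert.hyps by blast
      then show ?thesis using lie_lead[OF v'(1,2), of w] w v' by auto
    next
      case False
      then have "v \<notin> adm n e" using v by blast
      then obtain j where j: "j \<in> {1..n}" "e j \<le> count_list v j" using v'(2) by (auto simp: adm_def not_less)
      have "count_list w j < e j" using w(4) j by (simp add: adm_def)
      then have "count_list w j < count_list v j" using j by simp
      then have "coeff (mag n (lie n v) - 1) w = 0"
        using lie_content[OF v'(1,2), of j] unfolding magnus_kernel_def vanish_def by blast
      then show ?thesis using lyndon_not_Nil[OF w(1)] by simp
    qed
    then show "lie n v \<in> lead_coeff0 n q w" using lie_lcs[OF v'(1,2)] v' by (simp add: lead_coeff0_def)
  next
    show "F.lcs n (Suc q) \<subseteq> lead_coeff0 n q w"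
    proof
      fix h assume h: "h \<in> F.lcs n (Suc q)"
      then have "h \<in> deg_kernel n length (Suc q)" using lcs_deg_kernel[of "Suc q" n] by auto
      then have "coeff (mag n h - 1) w = 0" using w by (simp add: magnus_kernel_def vanish_def)
      then show "h \<in> lead_coeff0 n q w"
        using h F.lcs_antimono[of q "Suc q"] lyndon_not_Nil[OF w(1)] by (auto simp: lead_coeff0_def)
    qed
  qed
  then have "coeff (mag n (g \<otimes>\<^bsub>FG n\<^esub> lie n w [^]\<^bsub>FG n\<^esub> c)) w = 0" using c by (auto simp: lead_coeff0_def)
  moreover have gl: "g \<in> F.lcs n q" using insert.prems(3) FA.lspan_subset_lcs[OF A] by auto
  moreover have lw: "lie n w \<in> F.lcs n q" using lie_lcs w by blast
  moreover have "lie n w [^]\<^bsub>FG n\<^esub> c \<in> F.lcs n q"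
    using lw F.subgroup_int_pow_closed[OF F.lcs_subgroup] by blast
  ultimately have "coeff (mag n g) w + c * coeff (mag n (lie n w)) w = 0"
    using coeff_lcs_mult coeff_lcs_pow w insert.prems(2) by metis
  moreover have "coeff (mag n g - 1) w = 0"
    using insert.prems(4) w(4) unfolding magnus_kernel_def vanish_def by blast
  moreover have "coeff (mag n (lie n w)) w = 1" using lie_lead w by simp
  \<comment> \<open>At the admissible word \<open>w\<close> the coefficient of \<open>g\<close> is
    zero and that of the Lyndon commutator is one.\<close>
  ultimately have "c = 0" using lyndon_not_Nil[OF w(1)] by simp
  then have "g \<in> FA.lspan n ?A q" using c F.lcs_carrier[OF gl] by simp
  then show ?case using insert by blast
qed

lemma magnus_kernel_eq_gprod:
  assumes e: "\<And>j. j \<in> {1..n} \<Longrightarrow> 1 \<le> e j"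
  shows "magnus_kernel n (adm n e) = FA.gprod n e"
proof
  show "FA.gprod n e \<subseteq> magnus_kernel n (adm n e)" by (rule gprod_magnus_kernel[OF e])
  let ?J = "FA.gprod n e" and ?K = "magnus_kernel n (adm n e)"
  have J: "?J \<lhd> FG n" by (rule FA.gprod_normal)
  have K: "subgroup ?K (FG n)" by (intro normal_imp_subgroup magnus_kernel_normal factor_closed_adm)
  have gen: "carrier (FG n) \<subseteq> generate (FG n) (alpha n ` {1..n})"
    by (intro free_group_generated F.generate_is_subgroup) (auto intro: generate.incl free_gen_closed)
  \<comment> \<open>One step of the descent: an element of the product is split off so that the rest
    moves to the next term of the lower central series while staying in the kernel.\<close>
  have refine: "\<exists>a\<in>?J. \<exists>h\<in>F.lcs n (Suc q) \<inter> ?K. g = a \<otimes>\<^bsub>FG n\<^esub> h"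
    if g: "g \<in> F.lcs n q" "g \<in> ?K" and q: "1 \<le> q" for g q
  proof -
    have "g \<in> FA.lspan n (FA.lyn n q) q" using FA.lcs_subset_span_lyn[OF gen q] g by blast
    moreover have "FA.lyn n q = FA.lyn n q - adm n e \<union> (FA.lyn n q \<inter> adm n e)" by blast
    ultimately have "g \<in> FA.lspan n (FA.lyn n q - adm n e) q"
      using lspan_remove_adm[OF _ order_refl q _ g(2)] FA.finite_lyn by (metis finite_Int)
    also have "FA.lspan n (FA.lyn n q - adm n e) q \<subseteq> ?J <#>\<^bsub>FG n\<^esub> F.lcs n (Suc q)"
    proof (rule FA.lspan_least)
      show "subgroup (?J <#>\<^bsub>FG n\<^esub> F.lcs n (Suc q)) (FG n)"
        by (intro normal_imp_subgroup F.normal_set_mult J F.lcs_normal)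
      have one: "\<one>\<^bsub>FG n\<^esub> \<in> ?J" "\<one>\<^bsub>FG n\<^esub> \<in> F.lcs n (Suc q)"
        using normal_imp_subgroup[OF J] F.lcs_subgroup subgroup.one_closed by blast+
      have l: "a \<in> ?J <#>\<^bsub>FG n\<^esub> F.lcs n (Suc q)" if "a \<in> ?J" for a
        using that one F.normal_subsetD[OF J that] unfolding set_mult_def by force
      show "F.lcs n (Suc q) \<subseteq> ?J <#>\<^bsub>FG n\<^esub> F.lcs n (Suc q)"
      proof
        fix h assume h: "h \<in> F.lcs n (Suc q)"
        then have "h = \<one>\<^bsub>FG n\<^esub> \<otimes>\<^bsub>FG n\<^esub> h" using F.lcs_carrier by simp
        then show "h \<in> ?J <#>\<^bsub>FG n\<^esub> F.lcs n (Suc q)" using h one unfolding set_mult_def by blast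
      qed
      fix w assume "w \<in> FA.lyn n q - adm n e"
      then have w: "lyndon w" "set w \<subseteq> {1..n}" "w \<notin> adm n e" by (auto simp: FA.lyn_def)
      then obtain j where j: "j \<in> {1..n}" "e j \<le> count_list w j" by (auto simp: adm_def not_less)
      have "lie n w \<in> lower_central (FG n) (FA.N n j) (count_list w j)"
        using FA.lc_mem_gamma[OF w(1,2) j(1)] e[OF j(1)] j(2) by simp
      also have "\<dots> \<subseteq> lower_central (FG n) (FA.N n j) (e j)"
        by (rule F.lower_central_antimono[OF FA.N_normal[OF j(1)] j(2)])
      also have "\<dots> \<subseteq> ?J" by (rule FA.gprod_incl[OF j(1)])
      finally show "lie n w \<in> ?J <#>\<^bsub>FG n\<^esub> F.lcs n (Suc q)" by (rule l)
    qed
    finally obtain a h where ah: "a \<in> ?J" "h \<in> F.lcs n (Suc q)" "g = a \<otimes>\<^bsub>FG n\<^esub> h"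
      by (auto simp: set_mult_def)
    have aK: "a \<in> ?K" using ah gprod_magnus_kernel[of n e, OF e] by blast
    have c: "a \<in> carrier (FG n)" "h \<in> carrier (FG n)"
      using F.normal_subsetD[OF J ah(1)] F.lcs_carrier[OF ah(2)] by auto
    have "h = inv\<^bsub>FG n\<^esub> a \<otimes>\<^bsub>FG n\<^esub> g" using c ah by simp
    then have "h \<in> ?K" using aK g K by (simp add: subgroup.m_closed subgroup.m_inv_closed)
    then show ?thesis using ah by blast
  qed
  show "?K \<subseteq> ?J"
  proof
    fix g assume g: "g \<in> ?K"
    have decompose: "\<exists>a\<in>?J. \<exists>h\<in>F.lcs n q \<inter> ?K. g = a \<otimes>\<^bsub>FG n\<^esub> h" if "1 \<le> q" for q
      using that
    proof (induction q rule: dec_induct)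
      case base
      have gc: "g \<in> carrier (FG n)" using g by (simp add: magnus_kernel_def)
      then show ?case using g subgroup.one_closed[OF normal_imp_subgroup[OF J]]
        by (intro bexI[of _ "\<one>\<^bsub>FG n\<^esub>"] bexI[of _ g]) auto
    next
      case (step q)
      then obtain a h where ah: "a \<in> ?J" "h \<in> F.lcs n q" "h \<in> ?K" "g = a \<otimes>\<^bsub>FG n\<^esub> h" by blast
      obtain b h' where bh: "b \<in> ?J" "h' \<in> F.lcs n (Suc q) \<inter> ?K" "h = b \<otimes>\<^bsub>FG n\<^esub> h'"
        using refine[OF ah(2,3) step.hyps(1)] by blast
      have c: "a \<in> carrier (FG n)" "b \<in> carrier (FG n)" "h' \<in> carrier (FG n)"
        using F.normal_subsetD[OF J] ah bh F.lcs_carrier by blast+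
      have "a \<otimes>\<^bsub>FG n\<^esub> b \<in> ?J"
        by (rule subgroup.m_closed[OF normal_imp_subgroup[OF J] ah(1) bh(1)])
      moreover have "g = (a \<otimes>\<^bsub>FG n\<^esub> b) \<otimes>\<^bsub>FG n\<^esub> h'"
        using ah(4) bh(3) c by (simp add: F.m_assoc)
      ultimately show ?case using bh(2) by blast
    qed
    \<comment> \<open>The index is the pigeonhole bound from which on the lower central series lies
      in the product; the descent may stop there.\<close>
    obtain a h where ah: "a \<in> ?J" "h \<in> F.lcs n (Suc (\<Sum>j\<in>{1..n}. e j - 1))" "g = a \<otimes>\<^bsub>FG n\<^esub> h"
      using decompose[of "Suc (\<Sum>j\<in>{1..n}. e j - 1)"] by auto
    have gen': "carrier (FG n) \<subseteq> generate (FG n) (\<Union>j\<in>{1..n}. FA.N n j)"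
    proof -
      have "alpha n ` {1..n} \<subseteq> (\<Union>j\<in>{1..n}. FA.N n j)" using F.normal_closure_mem by blast
      from F.mono_generate[OF this] show ?thesis using gen by blast
    qed
    have "F.lcs n (Suc (\<Sum>j\<in>{1..n}. e j - 1)) \<subseteq> ?J"
      by (rule FA.lcs_subset_gprod[OF gen' e]) auto
    then have "h \<in> ?J" using ah(2) by blast
    then show "g \<in> ?J" unfolding ah(3)
      by (rule subgroup.m_closed[OF normal_imp_subgroup[OF J] ah(1)])
  qed
qed

section \<open>The nilpotent quotients of the link group\<close>

lemma (in Group.group) weval_coset:
  assumes N: "N \<lhd> G" and f: "f \<in> S \<rightarrow> carrier G" and w: "w \<in> words S"
  shows "N #> weval G f w = weval (G Mod N) (\<lambda>x. N #> f x) w"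
  using group_hom.weval_hom[OF group_hom_coset[OF N] f w] by (simp add: comp_def)

lemma (in Group.group) weval_coset_cong:
  assumes N: "N \<lhd> G" and f: "f \<in> S \<rightarrow> carrier G" "g \<in> S \<rightarrow> carrier G" and w: "w \<in> words S"
    and fg: "\<And>x. x \<in> S \<Longrightarrow> N #> f x = N #> g x"
  shows "N #> weval G f w = N #> weval G g w"
  unfolding weval_coset[OF N f(1) w] weval_coset[OF N f(2) w] using fg by (intro weval_cong[OF w])

text \<open>The geometry of \<open>D\<close> enters the group theory only through these two
  properties: over-passing arcs are generators of the link group, and the framing counts with signs
  the letters of the longitude that belong to its own strand.\<close>

locale arc_diagram =
  fixes n :: nat and D :: link_diagram
  assumes over_arc: "i \<in> {1..n} \<Longrightarrow> j \<in> {1..under_number D i} \<Longrightarrow> fst (over_letter D i j) \<in> arcs n D"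
    and framing_sum: "i \<in> {1..n} \<Longrightarrow> framing D i = (\<Sum>j\<in>{1..under_number D i}.
      if fst (fst (over_letter D i j)) = i then (if snd (over_letter D i j) then 1 else -1) else 0)"
begin

abbreviation A :: "(nat \<times> nat) set" where
  "A \<equiv> arcs n D"

text \<open>The word that conjugates the first arc of strand \<open>i\<close> to its
  \<open>j\<close>th arc; at the last arc it is the longitude without the framing
  correction.\<close>

definition under_word :: "nat \<Rightarrow> nat \<Rightarrow> (nat \<times> nat) word" where
  "under_word i j = map (over_letter D i) [1..<j]"

lemma over_letter_word: "i \<in> {1..n} \<Longrightarrow> j \<in> {1..under_number D i} \<Longrightarrow> [over_letter D i j] \<in> words A"
  using over_arc by (cases "over_letter D i j") force

lemma under_word_words: "(i, j) \<in> A \<Longrightarrow> under_word i j \<in> words A"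
  using over_letter_word[of i] by (auto simp: under_word_def in_lists_conv_set arcs_def)

lemma under_word_1 [simp]: "under_word i 1 = []"
  by (simp add: under_word_def)

lemma under_word_Suc: "1 \<le> j \<Longrightarrow> under_word i (j + 1) = under_word i j @ [over_letter D i j]"
  by (simp add: under_word_def One_nat_def)

lemma rel_words: "link_relations n D \<subseteq> words A \<times> words A"
proof -
  have "[((i, j + 1), True)] \<in> words A \<and> [inv_letter (over_letter D i j), ((i, j), True), over_letter D i j] \<in> words A"
    if ij: "i \<in> {1..n}" "j \<in> {1..under_number D i}" for i j
    using over_arc[OF ij] ij by (auto simp: arcs_def inv_letter_def mem_Times_iff)
  then show ?thesis unfolding link_relations_def by blast
qed

sublocale L: presentation A "link_relations n D"
  by unfold_locales (rule rel_words)

lemma link_group_P: "link_group n D = L.P"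
  by (simp add: link_group_def)

sublocale G: Group.group "link_group n D"
  unfolding link_group_P by (rule L.group_P)

lemma word_class_cls: "word_class n D = L.cls"
  by (simp add: fun_eq_iff word_class_def L.cls_def)

lemma arc_1: "i \<in> {1..n} \<Longrightarrow> (i, 1) \<in> A"
  by (simp add: arcs_def)

lemma meridian_gen: "meridian n D i = L.gen (i, 1)"
  by (simp add: meridian_def word_class_cls L.gen_def)

lemma gen_closed [simp]: "a \<in> A \<Longrightarrow> L.gen a \<in> carrier (link_group n D)"
  by (simp add: link_group_P)

lemma meridian_closed: "meridian n D \<in> {1..n} \<rightarrow> carrier (link_group n D)"
  using arc_1 gen_closed by (simp add: meridian_gen)

sublocale GM: group_with_gens "link_group n D" n "meridian n D"
  by unfold_locales (use meridian_closed in blast)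

abbreviation \<mu> :: "nat word set \<Rightarrow> (nat \<times> nat) word set" where
  "\<mu> \<equiv> meridian_map n D"

lemma \<mu>_hom: "\<mu> \<in> hom (FG n) (link_group n D)"
  unfolding meridian_map_def by (rule free_lift_hom[OF G.is_group meridian_closed])

lemma \<mu>_alpha: "i \<in> {1..n} \<Longrightarrow> \<mu> (alpha n i) = L.gen (i, 1)"
  unfolding meridian_map_def by (simp add: free_lift_gen[OF G.is_group meridian_closed] meridian_gen)

sublocale \<mu>: group_hom "FG n" "link_group n D" \<mu>
  by (intro group_hom.intro group_hom_axioms.intro \<mu>_hom G.is_group group_free_group)

lemma gen_conj:
  assumes "(i, j) \<in> A"
  shows "L.gen (i, j) = inv\<^bsub>link_group n D\<^esub> weval (link_group n D) L.gen (under_word i j)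
    \<otimes>\<^bsub>link_group n D\<^esub> L.gen (i, 1) \<otimes>\<^bsub>link_group n D\<^esub> weval (link_group n D) L.gen (under_word i j)"
proof -
  have "1 \<le> j" using assms by (simp add: arcs_def)
  then show ?thesis using assms
  proof (induction j rule: dec_induct)
    case base
    then show ?case by simp
  next
    case (step j)
    let ?G = "link_group n D" and ?b = "over_letter D i j"
    have ij: "i \<in> {1..n}" "j \<in> {1..under_number D i}" using step by (auto simp: arcs_def)
    then have a: "(i, j) \<in> A" "(i, j + 1) \<in> A" "(i, 1) \<in> A" by (auto simp: arcs_def)
    define v where "v = weval ?G L.gen (under_word i j)"
    define c where "c = weval ?G L.gen [?b]"
    have bw: "[?b] \<in> words A" by (rule over_letter_word[OF ij])
    have gens: "L.gen \<in> A \<rightarrow> carrier ?G" by simp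
    have carr: "v \<in> carrier ?G" "c \<in> carrier ?G"
      unfolding v_def c_def by (rule G.weval_closed[OF gens under_word_words[OF a(1)]], rule G.weval_closed[OF gens bw])
    have v': "weval ?G L.gen (under_word i (j + 1)) = v \<otimes>\<^bsub>?G\<^esub> c"
      unfolding under_word_Suc[OF step.hyps(1)] v_def c_def
      by (rule G.weval_append[OF gens under_word_words[OF a(1)] bw])
    have bc: "L.gen (fst ?b) \<in> carrier ?G" using over_arc[OF ij] by simp
    let ?r = "[inv_letter ?b, ((i, j), True), ?b]"
    have "([((i, j + 1), True)], ?r) \<in> link_relations n D"
      using ij unfolding link_relations_def by blast
    then have "([] @ [((i, j + 1), True)] @ [], [] @ ?r @ []) \<in> word_rel A (link_relations n D)"
      by (intro word_rel.relation) auto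
    moreover have "[((i, j + 1), True)] \<in> words A" "?r \<in> words A"
      using \<open>([((i, j + 1), True)], ?r) \<in> link_relations n D\<close> rel_words by blast+
    ultimately have "L.cls [((i, j + 1), True)] = L.cls ?r" by (simp add: L.cls_eq_iff)
    then have "L.gen (i, j + 1) = weval ?G L.gen ?r"
      using L.cls_weval[OF \<open>?r \<in> words A\<close>] by (simp add: L.gen_def link_group_P)
    also have "\<dots> = inv\<^bsub>?G\<^esub> c \<otimes>\<^bsub>?G\<^esub> L.gen (i, j) \<otimes>\<^bsub>?G\<^esub> c"
      using bc a by (cases "snd ?b") (simp_all add: c_def inv_letter_def G.m_assoc)
    also have "\<dots> = inv\<^bsub>?G\<^esub> (v \<otimes>\<^bsub>?G\<^esub> c) \<otimes>\<^bsub>?G\<^esub> L.gen (i, 1) \<otimes>\<^bsub>?G\<^esub> (v \<otimes>\<^bsub>?G\<^esub> c)"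
      unfolding step.IH[OF a(1), folded v_def] using carr a by (simp add: G.inv_mult_group G.m_assoc)
    finally show ?case unfolding Suc_eq_plus1 v' .
  qed
qed

text \<open>Milnor's approximations \<open>\<eta>\<^sub>q\<close>: words in the meridians that represent the arcs modulo \<open>\<Gamma>\<^bsub>q+1\<^esub>\<close>.\<close>

primrec eta :: "nat \<Rightarrow> nat \<times> nat \<Rightarrow> nat word set" where
  "eta 0 a = alpha n (fst a)"
| "eta (Suc q) a = inv\<^bsub>FG n\<^esub> weval (FG n) (eta q) (under_word (fst a) (snd a))
    \<otimes>\<^bsub>FG n\<^esub> alpha n (fst a) \<otimes>\<^bsub>FG n\<^esub> weval (FG n) (eta q) (under_word (fst a) (snd a))"

declare eta.simps [simp del]

lemma alpha_fst: "a \<in> A \<Longrightarrow> alpha n (fst a) \<in> carrier (FG n)"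
  by (rule free_gen_closed) (auto simp: arcs_def)

lemma eta_closed: "eta q \<in> A \<rightarrow> carrier (FG n)"
proof (induction q)
  case (Suc q)
  then show ?case using under_word_words F.weval_closed[OF Suc] alpha_fst
    by (auto simp: eta.simps Pi_iff split_paired_all)
qed (use alpha_fst in \<open>auto simp: eta.simps\<close>)

lemma eta_1: "i \<in> {1..n} \<Longrightarrow> eta q (i, 1) = alpha n i"
  using free_gen_closed[of i "{1..n}"] by (cases q) (auto simp: eta.simps)

text \<open>By induction the conjugating words of two successive levels agree up to some degree, and
  \<open>lcs_conj_coset\<close> gains one more.\<close>

lemma eta_Suc_coset:
  assumes "a \<in> A"
  shows "F.lcs n (Suc q) #>\<^bsub>FG n\<^esub> eta (Suc q) a = F.lcs n (Suc q) #>\<^bsub>FG n\<^esub> eta q a"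
  using assms
proof (induction q arbitrary: a)
  case 0
  have "eta (Suc 0) a \<in> carrier (FG n)" "eta 0 a \<in> carrier (FG n)" using eta_closed 0 by blast+
  then show ?case by (subst F.coset_eq_iff[OF F.lcs_normal]) simp_all
next
  case (Suc q)
  have w: "under_word (fst a) (snd a) \<in> words A" using under_word_words Suc.prems by simp
  have "F.lcs n (Suc q) #>\<^bsub>FG n\<^esub> weval (FG n) (eta (Suc q)) (under_word (fst a) (snd a))
      = F.lcs n (Suc q) #>\<^bsub>FG n\<^esub> weval (FG n) (eta q) (under_word (fst a) (snd a))"
    by (rule F.weval_coset_cong[OF F.lcs_normal eta_closed eta_closed w Suc.IH])
  then show ?case unfolding eta.simps(2)[of "Suc q" a] eta.simps(2)[of q a]
    by (intro F.lcs_conj_coset) (use F.weval_closed[OF eta_closed w] alpha_fst[OF Suc.prems] in auto)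
qed

lemma eta_coset:
  assumes "a \<in> A" "q \<le> q'"
  shows "F.lcs n (Suc q) #>\<^bsub>FG n\<^esub> eta q' a = F.lcs n (Suc q) #>\<^bsub>FG n\<^esub> eta q a"
  using assms(2)
proof (induction q' rule: dec_induct)
  case (step q')
  have c: "eta (Suc q') a \<in> carrier (FG n)" "eta q' a \<in> carrier (FG n)" using eta_closed assms(1) by blast+
  have "F.lcs n (Suc q) #>\<^bsub>FG n\<^esub> eta (Suc q') a = F.lcs n (Suc q) #>\<^bsub>FG n\<^esub> eta q' a"
    by (rule F.coset_eq_mono[OF F.lcs_normal F.lcs_normal F.lcs_antimono c eta_Suc_coset[OF assms(1)]])
      (use step in simp)
  then show ?case using step.IH by simp
qed simp

text \<open>For \<open>q > 0\<close> the recursion gives the relation exactly, but with the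
  conjugator evaluated at level \<open>q - 1\<close> in place of \<open>q\<close>. The two values
  agree modulo \<open>F.lcs n q\<close>, hence the conjugates agree modulo the next term.\<close>

lemma eta_relation:
  assumes "i \<in> {1..n}" "j \<in> {1..under_number D i}"
  shows "F.lcs n (Suc q) #>\<^bsub>FG n\<^esub> eta q (i, j + 1) =
    F.lcs n (Suc q) #>\<^bsub>FG n\<^esub> weval (FG n) (eta q) [inv_letter (over_letter D i j), ((i, j), True), over_letter D i j]"
proof -
  let ?b = "over_letter D i j" and ?F = "FG n"
  have a: "(i, j) \<in> A" "(i, j + 1) \<in> A" using assms by (auto simp: arcs_def)
  have bw: "[?b] \<in> words A" by (rule over_letter_word[OF assms])
  have ec: "eta q a \<in> carrier ?F" if "a \<in> A" for a q using eta_closed that by blast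
  define c where "c q = weval ?F (eta q) [?b]" for q
  have cc: "c q \<in> carrier ?F" for q unfolding c_def by (rule F.weval_closed[OF eta_closed bw])
  have rhs: "weval ?F (eta q) [inv_letter ?b, ((i, j), True), ?b] = inv\<^bsub>?F\<^esub> c q \<otimes>\<^bsub>?F\<^esub> eta q (i, j) \<otimes>\<^bsub>?F\<^esub> c q" for q
    using ec[OF over_arc[OF assms]] ec[OF a(1)]
    by (cases "snd ?b") (simp_all add: c_def inv_letter_def F.m_assoc)
  show ?thesis
  proof (cases q)
    case 0
    then show ?thesis unfolding rhs using cc ec[OF a(1)] ec[OF a(2)]
      by (subst F.coset_eq_iff[OF F.lcs_normal]) (auto)
  next
    case (Suc p)
    let ?v = "weval ?F (eta p) (under_word i j)"
    have v: "?v \<in> carrier ?F" by (rule F.weval_closed[OF eta_closed under_word_words[OF a(1)]])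
    have "weval ?F (eta p) (under_word i (j + 1)) = ?v \<otimes>\<^bsub>?F\<^esub> c p"
    proof -
      have "1 \<le> j" using assms(2) by simp
      then show ?thesis unfolding c_def under_word_Suc[OF \<open>1 \<le> j\<close>]
        by (intro F.weval_append[OF eta_closed under_word_words[OF a(1)] bw])
    qed
    then have "eta q (i, j + 1) = inv\<^bsub>?F\<^esub> c p \<otimes>\<^bsub>?F\<^esub> eta q (i, j) \<otimes>\<^bsub>?F\<^esub> c p"
      using v cc alpha_fst[OF a(1)] unfolding Suc by (simp add: eta.simps F.inv_mult_group F.m_assoc)
    moreover have "F.lcs n (Suc p) #>\<^bsub>?F\<^esub> c p = F.lcs n (Suc p) #>\<^bsub>?F\<^esub> c q"
      unfolding c_def Suc
      by (rule F.weval_coset_cong[OF F.lcs_normal eta_closed eta_closed bw eta_Suc_coset[symmetric]])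
    ultimately show ?thesis unfolding rhs
      using F.lcs_conj_coset[of "Suc p" "c p" n "c q" "eta q (i, j)"] cc ec[OF a(1)] Suc by simp
  qed
qed

text \<open>\<open>K\<close> is general because two kinds of quotient are needed: by terms of the
  lower central series for the Milnor invariants, and by \<open>JK n k\<close> for the reduced
  group.\<close>

lemma eta_hom_exists:
  assumes K: "K \<lhd> FG n" "F.lcs n (Suc q) \<subseteq> K"
  obtains h where "h \<in> hom (link_group n D) (FG n Mod K)"
    "\<And>w. w \<in> words A \<Longrightarrow> h (L.cls w) = K #>\<^bsub>FG n\<^esub> weval (FG n) (eta q) w"
proof -
  let ?f = "\<lambda>a. K #>\<^bsub>FG n\<^esub> eta q a"
  have grp: "Group.group (FG n Mod K)" using K(1) by (rule normal.factorgroup_is_group)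
  have f: "?f \<in> A \<rightarrow> carrier (FG n Mod K)" using eta_closed by (auto simp: carrier_FactGroup)
  have "weval (FG n Mod K) ?f r = weval (FG n Mod K) ?f r'" if rr: "(r, r') \<in> link_relations n D" for r r'
  proof -
    obtain i j where ij: "i \<in> {1..n}" "j \<in> {1..under_number D i}" and r: "r = [((i, j + 1), True)]"
      "r' = [inv_letter (over_letter D i j), ((i, j), True), over_letter D i j]"
      using rr unfolding link_relations_def by blast
    have w: "r \<in> words A" "r' \<in> words A" using rr rel_words by blast+
    have ec: "eta q (i, j + 1) \<in> carrier (FG n)" by (rule funcset_mem[OF eta_closed]) (use ij in \<open>auto simp: arcs_def\<close>)
    then have e1: "weval (FG n) (eta q) r = eta q (i, j + 1)" unfolding r(1) by simp
    have "K #>\<^bsub>FG n\<^esub> weval (FG n) (eta q) r = K #>\<^bsub>FG n\<^esub> weval (FG n) (eta q) r'"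
      unfolding e1 using eta_relation[OF ij, of q, folded r(2)]
      by (rule F.coset_eq_mono[OF F.lcs_normal K(1,2) ec F.weval_closed[OF eta_closed w(2)]])
    then show ?thesis by (simp only: F.weval_coset[OF K(1) eta_closed w(1)] F.weval_coset[OF K(1) eta_closed w(2)])
  qed
  from L.exists_hom[OF grp f this] obtain h where h: "h \<in> hom L.P (FG n Mod K)"
    "\<And>w. w \<in> words A \<Longrightarrow> h (L.cls w) = weval (FG n Mod K) ?f w" by blast
  then show thesis using that F.weval_coset[OF K(1) eta_closed] by (simp add: link_group_P)
qed

text \<open>By \<open>gen_conj\<close> the arcs are conjugates of meridians by the same words that
  the recursion for \<open>eta\<close> uses, so each level of the approximation is exact to one
  degree more.\<close>

lemma \<mu>_eta:
  assumes "a \<in> A"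
  shows "G.lcs (Suc q) #>\<^bsub>link_group n D\<^esub> \<mu> (eta q a) = G.lcs (Suc q) #>\<^bsub>link_group n D\<^esub> L.gen a"
  using assms
proof (induction q arbitrary: a)
  case 0
  have "\<mu> (eta 0 a) \<in> carrier (link_group n D)" "L.gen a \<in> carrier (link_group n D)"
    using \<mu>.hom_closed[OF funcset_mem[OF eta_closed 0]] gen_closed[OF 0] by blast+
  then show ?case by (subst G.coset_eq_iff[OF G.lcs_normal]) simp_all
next
  case (Suc q)
  obtain i j where a: "a = (i, j)" by (cases a)
  let ?w = "under_word i j" and ?G = "link_group n D"
  have i: "i \<in> {1..n}" using Suc.prems a by (auto simp: arcs_def)
  have w: "?w \<in> words A" using under_word_words Suc.prems a by simp
  have v: "weval (FG n) (eta q) ?w \<in> carrier (FG n)" by (rule F.weval_closed[OF eta_closed w])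
  have gens: "L.gen \<in> A \<rightarrow> carrier ?G" by simp
  have \<mu>e: "\<mu> \<circ> eta q \<in> A \<rightarrow> carrier ?G" using \<mu>.hom_closed[OF funcset_mem[OF eta_closed]] by (auto)
  have al: "alpha n i \<in> carrier (FG n)" using i by (rule free_gen_closed)
  have "\<mu> (eta (Suc q) a) = inv\<^bsub>?G\<^esub> \<mu> (weval (FG n) (eta q) ?w) \<otimes>\<^bsub>?G\<^esub> L.gen (i, 1)
      \<otimes>\<^bsub>?G\<^esub> \<mu> (weval (FG n) (eta q) ?w)"
    using v al i by (simp add: a eta.simps \<mu>_alpha)
  moreover have "G.lcs (Suc q) #>\<^bsub>?G\<^esub> \<mu> (weval (FG n) (eta q) ?w) = G.lcs (Suc q) #>\<^bsub>?G\<^esub> weval ?G L.gen ?w"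
    unfolding \<mu>.weval_hom[OF eta_closed w]
    by (rule G.weval_coset_cong[OF G.lcs_normal \<mu>e gens w]) (simp add: Suc.IH)
  ultimately show ?case unfolding a gen_conj[OF Suc.prems[unfolded a]]
    using G.lcs_conj_coset[of "Suc q" "\<mu> (weval (FG n) (eta q) ?w)" "weval ?G L.gen ?w" "L.gen (i, 1)"]
      v G.weval_closed[OF gens w] gen_closed[OF arc_1[OF i]] by simp
qed

lemma \<mu>_weval_eta:
  assumes w: "w \<in> words A"
  shows "G.lcs (Suc q) #>\<^bsub>link_group n D\<^esub> \<mu> (weval (FG n) (eta q) w) = G.lcs (Suc q) #>\<^bsub>link_group n D\<^esub> L.cls w"
proof -
  have gens: "L.gen \<in> A \<rightarrow> carrier (link_group n D)" by simp
  have \<mu>e: "\<mu> \<circ> eta q \<in> A \<rightarrow> carrier (link_group n D)" using \<mu>.hom_closed[OF funcset_mem[OF eta_closed]] by (auto)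
  show ?thesis
    unfolding \<mu>.weval_hom[OF eta_closed w] L.cls_weval[OF w, folded link_group_P]
    by (rule G.weval_coset_cong[OF G.lcs_normal \<mu>e gens w]) (simp add: \<mu>_eta)
qed

definition lam :: "nat \<Rightarrow> nat \<Rightarrow> nat word set" where
  "lam q i = (inv\<^bsub>FG n\<^esub> alpha n i) [^]\<^bsub>FG n\<^esub> framing D i
    \<otimes>\<^bsub>FG n\<^esub> weval (FG n) (eta q) (under_word i (under_number D i + 1))"

lemma last_arc: "i \<in> {1..n} \<Longrightarrow> (i, under_number D i + 1) \<in> A"
  by (simp add: arcs_def)

lemma lam_closed: "i \<in> {1..n} \<Longrightarrow> lam q i \<in> carrier (FG n)"
  unfolding lam_def using F.weval_closed[OF eta_closed under_word_words[OF last_arc]] free_gen_closed[of i "{1..n}"]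
  by auto

lemma longitude_cls: "longitude n D i =
    (inv\<^bsub>link_group n D\<^esub> L.gen (i, 1)) [^]\<^bsub>link_group n D\<^esub> framing D i
    \<otimes>\<^bsub>link_group n D\<^esub> L.cls (under_word i (under_number D i + 1))"
  by (simp add: longitude_def meridian_gen word_class_cls under_word_def)

lemma longitude_closed: "i \<in> {1..n} \<Longrightarrow> longitude n D i \<in> carrier (link_group n D)"
  unfolding longitude_cls
  using L.cls_closed[OF under_word_words[OF last_arc]] gen_closed[OF arc_1]
  by (simp add: link_group_P)

lemma \<mu>_lam:
  assumes i: "i \<in> {1..n}"
  shows "G.lcs (Suc q) #>\<^bsub>link_group n D\<^esub> \<mu> (lam q i) = G.lcs (Suc q) #>\<^bsub>link_group n D\<^esub> longitude n D i"
proof -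
  let ?G = "link_group n D" and ?w = "under_word i (under_number D i + 1)"
  have w: "?w \<in> words A" by (rule under_word_words[OF last_arc[OF i]])
  have al: "alpha n i \<in> carrier (FG n)" using i by (rule free_gen_closed)
  have v: "weval (FG n) (eta q) ?w \<in> carrier (FG n)" by (rule F.weval_closed[OF eta_closed w])
  let ?p = "(inv\<^bsub>?G\<^esub> L.gen (i, 1)) [^]\<^bsub>?G\<^esub> framing D i"
  have p: "?p \<in> carrier ?G" using gen_closed[OF arc_1[OF i]] by simp
  have "\<mu> (lam q i) = ?p \<otimes>\<^bsub>?G\<^esub> \<mu> (weval (FG n) (eta q) ?w)"
    unfolding lam_def using v al i by (simp add: \<mu>_alpha \<mu>.hom_int_pow)
  then have "G.lcs (Suc q) #>\<^bsub>?G\<^esub> \<mu> (lam q i) = (G.lcs (Suc q) #>\<^bsub>?G\<^esub> ?p) \<otimes>\<^bsub>?G Mod G.lcs (Suc q)\<^esub> (G.lcs (Suc q) #>\<^bsub>?G\<^esub> \<mu> (weval (FG n) (eta q) ?w))"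
    using G.coset_mult[OF G.lcs_normal p, of "\<mu> (weval (FG n) (eta q) ?w)"] v by simp
  also have "\<dots> = G.lcs (Suc q) #>\<^bsub>?G\<^esub> longitude n D i"
    unfolding \<mu>_weval_eta[OF w] longitude_cls
    using G.coset_mult[OF G.lcs_normal p, of "L.cls ?w"] L.cls_closed[OF w] by (simp add: link_group_P)
  finally show ?thesis .
qed

text \<open>The third property says that \<open>h\<close> inverts the meridian map modulo
  \<open>K\<close>; it yields uniqueness for \<open>milnor\<close> and injectivity of the reduced
  meridian map.\<close>

lemma eta_hom:
  assumes K: "K \<lhd> FG n" "F.lcs n (Suc q) \<subseteq> K"
  obtains h where "group_hom (link_group n D) (FG n Mod K) h"
    "\<And>w. w \<in> words A \<Longrightarrow> h (L.cls w) = K #>\<^bsub>FG n\<^esub> weval (FG n) (eta q) w"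
    "\<And>g. g \<in> carrier (FG n) \<Longrightarrow> h (\<mu> g) = K #>\<^bsub>FG n\<^esub> g"
    "\<And>i. i \<in> {1..n} \<Longrightarrow> h (L.gen (i, 1)) = K #>\<^bsub>FG n\<^esub> alpha n i"
    "\<And>i. i \<in> {1..n} \<Longrightarrow> h (longitude n D i) = K #>\<^bsub>FG n\<^esub> lam q i"
proof -
  let ?Q = "FG n Mod K" and ?G = "link_group n D"
  obtain h where h: "h \<in> hom ?G ?Q" "\<And>w. w \<in> words A \<Longrightarrow> h (L.cls w) = K #>\<^bsub>FG n\<^esub> weval (FG n) (eta q) w"
    by (rule eta_hom_exists[OF K], rule that)
  interpret c: group_hom "FG n" ?Q "\<lambda>x. K #>\<^bsub>FG n\<^esub> x" by (rule F.group_hom_coset[OF K(1)])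
  have hh: "group_hom ?G ?Q h"
    by (intro group_hom.intro group_hom_axioms.intro h(1) G.is_group c.H.is_group)
  interpret h: group_hom ?G ?Q h by (rule hh)
  have gen: "h (L.gen (i, 1)) = K #>\<^bsub>FG n\<^esub> alpha n i" if i: "i \<in> {1..n}" for i
  proof -
    have "[((i, 1), True)] \<in> words A" using arc_1[OF i] by simp
    from h(2)[OF this] show ?thesis
      using eta_1[OF i] free_gen_closed[OF i] by (simp add: L.gen_def)
  qed
  have "h \<circ> \<mu> \<in> hom (FG n) ?Q" by (rule hom_compose[OF \<mu>_hom h(1)])
  from free_group_hom_unique[OF c.H.is_group this c.homh]
  have mu: "h (\<mu> g) = K #>\<^bsub>FG n\<^esub> g" if "g \<in> carrier (FG n)" for g
    using that gen \<mu>_alpha by simp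
  have "h (longitude n D i) = K #>\<^bsub>FG n\<^esub> lam q i" if i: "i \<in> {1..n}" for i
  proof -
    let ?w = "under_word i (under_number D i + 1)"
    have w: "?w \<in> words A" by (rule under_word_words[OF last_arc[OF i]])
    have al: "alpha n i \<in> carrier (FG n)" using i by (rule free_gen_closed)
    have v: "weval (FG n) (eta q) ?w \<in> carrier (FG n)" by (rule F.weval_closed[OF eta_closed w])
    have g: "L.gen (i, 1) \<in> carrier ?G" "L.cls ?w \<in> carrier ?G"
      using gen_closed[OF arc_1[OF i]] L.cls_closed[OF w] by (simp_all add: link_group_P)
    have "h (longitude n D i) = (inv\<^bsub>?Q\<^esub> h (L.gen (i, 1))) [^]\<^bsub>?Q\<^esub> framing D i \<otimes>\<^bsub>?Q\<^esub> h (L.cls ?w)"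
      unfolding longitude_cls using g by (simp add: h.hom_int_pow)
    also have "\<dots> = K #>\<^bsub>FG n\<^esub> lam q i"
      unfolding lam_def gen[OF i] h(2)[OF w] using al v by (simp add: c.hom_int_pow)
    finally show ?thesis .
  qed
  then show thesis using that hh h(2) mu gen by blast
qed

lemma lam_coset:
  assumes i: "i \<in> {1..n}" and q: "q \<le> q'"
  shows "F.lcs n (Suc q) #>\<^bsub>FG n\<^esub> lam q' i = F.lcs n (Suc q) #>\<^bsub>FG n\<^esub> lam q i"
proof -
  let ?N = "F.lcs n (Suc q)" and ?w = "under_word i (under_number D i + 1)"
  have w: "?w \<in> words A" by (rule under_word_words[OF last_arc[OF i]])
  have al: "alpha n i \<in> carrier (FG n)" using i by (rule free_gen_closed)
  have v: "weval (FG n) (eta q) ?w \<in> carrier (FG n)" for q by (rule F.weval_closed[OF eta_closed w])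
  have "?N #>\<^bsub>FG n\<^esub> weval (FG n) (eta q') ?w = ?N #>\<^bsub>FG n\<^esub> weval (FG n) (eta q) ?w"
    by (rule F.weval_coset_cong[OF F.lcs_normal eta_closed eta_closed w eta_coset[OF _ q]])
  then show ?thesis unfolding lam_def using F.coset_mult[OF F.lcs_normal] v al
    by (metis F.int_pow_closed F.inv_closed)
qed

end

lemma lcs_coset_coeff:
  assumes "F.lcs n q #>\<^bsub>FG n\<^esub> g = F.lcs n q #>\<^bsub>FG n\<^esub> h" "g \<in> carrier (FG n)" "h \<in> carrier (FG n)" "length u < q"
  shows "coeff (mag n g) u = coeff (mag n h) u"
proof -
  have "h \<otimes>\<^bsub>FG n\<^esub> inv\<^bsub>FG n\<^esub> g \<in> F.lcs n q" using F.coset_eq_iff[OF F.lcs_normal] assms by metis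
  then have "inv\<^bsub>FG n\<^esub> g \<otimes>\<^bsub>FG n\<^esub> (h \<otimes>\<^bsub>FG n\<^esub> inv\<^bsub>FG n\<^esub> g) \<otimes>\<^bsub>FG n\<^esub> g \<in> F.lcs n q"
    by (rule F.normal_conj_inv[OF F.lcs_normal assms(2)])
  then have "inv\<^bsub>FG n\<^esub> g \<otimes>\<^bsub>FG n\<^esub> h \<in> F.lcs n q" using assms by (simp add: F.m_assoc)
  moreover have "1 \<le> q" using assms(4) by simp
  ultimately have "inv\<^bsub>FG n\<^esub> g \<otimes>\<^bsub>FG n\<^esub> h \<in> deg_kernel n length q" using lcs_deg_kernel by blast
  then have "vanish {u. length u < q} (mag n g - mag n h)"
    using magnus_kernel_coset_iff[OF factor_closed_additive[OF additive_length] assms(2,3)] by blast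
  then show ?thesis using assms(4) by (simp add: vanish_def)
qed

lemma lcs_FactGroup: "lower_central (FG n Mod F.lcs n q) (carrier (FG n Mod F.lcs n q)) q \<subseteq> {F.lcs n q}"
proof -
  interpret c: group_hom "FG n" "FG n Mod F.lcs n q" "\<lambda>x. F.lcs n q #>\<^bsub>FG n\<^esub> x"
    by (rule F.group_hom_coset[OF F.lcs_normal])
  have "lower_central (FG n Mod F.lcs n q) (carrier (FG n Mod F.lcs n q)) q =
      (\<lambda>x. F.lcs n q #>\<^bsub>FG n\<^esub> x) ` F.lcs n q"
    unfolding carrier_FactGroup by (rule c.lower_central_image[symmetric]) simp
  also have "\<dots> \<subseteq> {F.lcs n q}"
    using F.coset_eq_self_iff[OF F.lcs_normal] F.lcs_carrier by blast
  finally show ?thesis .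
qed

context arc_diagram
begin

text \<open>Existence and uniqueness for the definite description both have to be shown. A competing
  pair of degree and word is compared with \<open>lam\<close> in a nilpotent quotient of the free
  group, through the map of \<open>eta_hom\<close>.\<close>

lemma milnor_eq:
  assumes i: "i \<in> {1..n}" and u: "length u \<le> q"
  shows "milnor n D (u @ [i]) = coeff (mag n (lam q i)) u"
proof -
  let ?G = "link_group n D"
  have "(THE m. \<exists>q w. length u < q \<and> w \<in> carrier (FG n) \<and>
      G.lcs q #>\<^bsub>?G\<^esub> \<mu> w = G.lcs q #>\<^bsub>?G\<^esub> longitude n D i \<and> m = magnus n w u) = coeff (mag n (lam q i)) u"
  proof (rule the_equality)
    show "\<exists>q' w. length u < q' \<and> w \<in> carrier (FG n) \<and>
      G.lcs q' #>\<^bsub>?G\<^esub> \<mu> w = G.lcs q' #>\<^bsub>?G\<^esub> longitude n D i \<and> coeff (mag n (lam q i)) u = magnus n w u"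
      using u lam_closed[OF i] \<mu>_lam[OF i, of q] by (intro exI[of _ "Suc q"] exI[of _ "lam q i"]) (simp add: coeff_mag)
  next
    fix m assume "\<exists>q' w. length u < q' \<and> w \<in> carrier (FG n) \<and>
      G.lcs q' #>\<^bsub>?G\<^esub> \<mu> w = G.lcs q' #>\<^bsub>?G\<^esub> longitude n D i \<and> m = magnus n w u"
    then obtain q0 w where q0: "length u < q0" and w: "w \<in> carrier (FG n)"
      and eq: "G.lcs q0 #>\<^bsub>?G\<^esub> \<mu> w = G.lcs q0 #>\<^bsub>?G\<^esub> longitude n D i" and m: "m = magnus n w u" by blast
    then obtain p where p: "q0 = Suc p" by (cases q0) auto
    let ?K = "F.lcs n q0"
    obtain h where h: "group_hom ?G (FG n Mod ?K) h"
      "\<And>g. g \<in> carrier (FG n) \<Longrightarrow> h (\<mu> g) = ?K #>\<^bsub>FG n\<^esub> g"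
      "\<And>i. i \<in> {1..n} \<Longrightarrow> h (longitude n D i) = ?K #>\<^bsub>FG n\<^esub> lam p i"
      by (rule eta_hom[OF F.lcs_normal[of n q0], of p]) (use p in simp, rule that)
    interpret h: group_hom ?G "FG n Mod ?K" h by (rule h(1))
    have lc: "longitude n D i \<in> carrier ?G" "\<mu> w \<in> carrier ?G" using longitude_closed[OF i] w by auto
    have "\<mu> w \<otimes>\<^bsub>?G\<^esub> inv\<^bsub>?G\<^esub> longitude n D i \<in> G.lcs q0"
      using G.coset_eq_iff[OF G.lcs_normal lc(2,1)] eq by blast
    moreover have "h ` G.lcs q0 \<subseteq> {?K}"
    proof -
      have "h ` G.lcs q0 = lower_central (FG n Mod ?K) (h ` carrier ?G) q0"
        by (rule h.lower_central_image) simp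
      also have "\<dots> \<subseteq> lower_central (FG n Mod ?K) (carrier (FG n Mod ?K)) q0"
        by (rule lower_central_mono[OF h.H.is_group]) auto
      finally show ?thesis using lcs_FactGroup by blast
    qed
    ultimately have "h (\<mu> w \<otimes>\<^bsub>?G\<^esub> inv\<^bsub>?G\<^esub> longitude n D i) = \<one>\<^bsub>FG n Mod ?K\<^esub>" by auto
    then have "h (\<mu> w) = h (longitude n D i)"
      using lc by (simp add: h.H.inv_solve_right' del: one_FactGroup mult_FactGroup)
    then have 1: "?K #>\<^bsub>FG n\<^esub> w = ?K #>\<^bsub>FG n\<^esub> lam p i" using h(2)[OF w] h(3)[OF i] by simp
    then have "magnus n w u = coeff (mag n (lam p i)) u"
      using lcs_coset_coeff[OF 1 w lam_closed[OF i] q0] by (simp add: coeff_mag)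
    also have "\<dots> = coeff (mag n (lam q i)) u"
    proof -
      \<comment> \<open>Both levels are at least \<open>length u\<close>, so at their minimum the
        two lifts still have the same coefficient at \<open>u\<close>.\<close>
      let ?r = "min p q"
      have "F.lcs n (Suc ?r) #>\<^bsub>FG n\<^esub> lam p i = F.lcs n (Suc ?r) #>\<^bsub>FG n\<^esub> lam q i"
        using lam_coset[OF i, of ?r p] lam_coset[OF i, of ?r q] by simp
      then show ?thesis
        by (rule lcs_coset_coeff[OF _ lam_closed[OF i] lam_closed[OF i]]) (use u q0 p in auto)
    qed
    finally show "m = coeff (mag n (lam q i)) u" using m by simp
  qed
  then show ?thesis by (simp add: milnor_def Let_def)
qed

end

section \<open>Reduced longitudes and the reduced free action\<close>

context Group.group
begin

lemma comm_mult_left_coset: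
  assumes N: "N \<lhd> G" and c: "s \<in> carrier G" "a \<in> carrier G" "y \<in> carrier G"
    and s: "comm s (comm a y) \<in> N" "comm s y \<in> N"
  shows "N #> comm (s \<otimes> a) y = N #> comm a y"
proof -
  have "comm (s \<otimes> a) y \<otimes> inv (comm a y) = comm s (comm a y) \<otimes> (comm a y \<otimes> comm s y \<otimes> inv (comm a y))"
    using c by (simp add: comm_mult_left m_assoc)
  also have "\<dots> \<in> N"
    using c by (intro subgroup.m_closed[OF normal_imp_subgroup[OF N] s(1)] normal_invE(2)[OF N _ s(2)]) simp
  finally show ?thesis using c by (subst coset_eq_iff[OF N]) auto
qed

text \<open>If \<open>\<phi>\<close> moves \<open>a\<close> by a factor in \<open>lcs 2\<close> and
  \<open>y \<in> lcs q\<close> by a factor in \<open>lcs (Suc q)\<close>, then by bilinearity it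
  moves \<open>comm a y\<close> only by a factor in \<open>lcs (Suc (Suc q))\<close>.\<close>

lemma endo_trivial_lcs:
  assumes \<phi>: "group_hom G G \<phi>" and ab: "\<And>x. x \<in> carrier G \<Longrightarrow> \<phi> x \<otimes> inv x \<in> lcs 2"
    and q: "1 \<le> q" and x: "x \<in> lcs q"
  shows "\<phi> x \<otimes> inv x \<in> lcs (Suc q)"
  using q x
proof (induction q arbitrary: x rule: dec_induct)
  case base
  then show ?case using ab[of x] by (simp add: numeral_2_eq_2)
next
  case (step q)
  interpret \<phi>: group_hom G G \<phi> by (rule \<phi>)
  let ?N = "lcs (Suc (Suc q))"
  have "?N #> \<phi> (comm a y) = ?N #> comm a y" if a: "a \<in> carrier G" and y: "y \<in> lcs q" for a y
  proof -
    define s where "s = \<phi> a \<otimes> inv a"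
    define t where "t = \<phi> y \<otimes> inv y"
    have yc: "y \<in> carrier G" using y lcs_carrier by blast
    have s: "s \<in> lcs 2" unfolding s_def by (rule ab[OF a])
    have t: "t \<in> lcs (Suc q)" unfolding t_def by (rule step.IH[OF y])
    have sc: "s \<in> carrier G" "t \<in> carrier G" using s t lcs_carrier by blast+
    have tq: "t \<in> lcs q" using t lcs_antimono[of q "Suc q"] by auto
    have \<phi>a: "\<phi> a = s \<otimes> a" and \<phi>y: "\<phi> y = t \<otimes> y" using a yc by (simp_all add: s_def t_def m_assoc)
    have ty: "t \<otimes> y \<in> lcs q" using tq y subgroup.m_closed[OF lcs_subgroup] by blast
    have "comm a (t \<otimes> y) \<in> lcs (Suc q)" using comm_mem_lower_central(1)[OF normal_self a ty] step.hyps by simp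
    then have "comm s (comm a (t \<otimes> y)) \<in> lcs (2 + Suc q)" using s by (intro comm_mem_lcs) auto
    then have 1: "comm s (comm a (t \<otimes> y)) \<in> ?N" using lcs_antimono[of "Suc (Suc q)" "2 + Suc q"] by auto
    have 2: "comm s (t \<otimes> y) \<in> ?N" using comm_mem_lcs[OF s ty _ step.hyps(1)] by simp
    have yl: "comm y a \<in> carrier G" using yc a by simp
    have 3: "comm t (comm y a) \<in> ?N" using comm_mem_lower_central(2)[OF normal_self yl t] by simp
    have 4: "comm t a \<in> ?N" using comm_mem_lower_central(2)[OF normal_self a t] by simp
    have "?N #> \<phi> (comm a y) = ?N #> comm (s \<otimes> a) (t \<otimes> y)"
      using a yc by (simp add: \<phi>.hom_gcomm \<phi>a \<phi>y)
    also have "\<dots> = ?N #> comm a (t \<otimes> y)"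
      by (rule comm_mult_left_coset[OF lcs_normal sc(1) a _ 1 2]) (use sc yc in simp)
    also have "\<dots> = inv\<^bsub>G Mod ?N\<^esub> (?N #> comm (t \<otimes> y) a)"
      using sc yc a by (simp add: coset_inv[OF lcs_normal] inv_gcomm)
    also have "?N #> comm (t \<otimes> y) a = ?N #> comm y a"
      by (rule comm_mult_left_coset[OF lcs_normal sc(2) yc a 3 4])
    also have "inv\<^bsub>G Mod ?N\<^esub> (?N #> comm y a) = ?N #> comm a y"
      using yc a by (simp add: coset_inv[OF lcs_normal] inv_gcomm)
    finally show ?thesis .
  qed
  note gen = this
  let ?S = "{x \<in> carrier G. ?N #> \<phi> x = ?N #> x}"
  have "subgroup ?S G"
  proof (rule subgroupI)
    show "?S \<noteq> {}" using one_closed by (auto intro!: exI[of _ \<one>])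
    show "inv a \<in> ?S" if "a \<in> ?S" for a
    proof -
      have a: "a \<in> carrier G" "?N #> \<phi> a = ?N #> a" using that by auto
      have "?N #> \<phi> (inv a) = inv\<^bsub>G Mod ?N\<^esub> (?N #> \<phi> a)" 
        by (simp only: \<phi>.hom_inv[OF a(1)] coset_inv[OF lcs_normal \<phi>.hom_closed[OF a(1)]])
      also have "\<dots> = ?N #> inv a" unfolding a(2) by (rule coset_inv[OF lcs_normal a(1)])
      finally show ?thesis using a(1) by simp
    qed
    show "a \<otimes> b \<in> ?S" if "a \<in> ?S" "b \<in> ?S" for a b
    proof -
      have ab: "a \<in> carrier G" "?N #> \<phi> a = ?N #> a" "b \<in> carrier G" "?N #> \<phi> b = ?N #> b" using that by auto
      have "?N #> \<phi> (a \<otimes> b) = (?N #> \<phi> a) \<otimes>\<^bsub>G Mod ?N\<^esub> (?N #> \<phi> b)"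
        by (simp only: \<phi>.hom_mult[OF ab(1,3)] coset_mult[OF lcs_normal \<phi>.hom_closed[OF ab(1)] \<phi>.hom_closed[OF ab(3)]])
      also have "\<dots> = ?N #> (a \<otimes> b)" unfolding ab(2,4) by (rule coset_mult[OF lcs_normal ab(1,3)])
      finally show ?thesis using ab by simp
    qed
  qed auto
  then have "lcs (Suc q) \<subseteq> ?S"
    unfolding lower_central_Suc[OF step.hyps(1)]
    using gen lcs_carrier by (intro generate_subgroup_incl) auto
  then have "?N #> \<phi> x = ?N #> x" "x \<in> carrier G" using step.prems by blast+
  then show ?case using coset_eq_iff[OF lcs_normal] by simp
qed

text \<open>An element of the kernel sinks from each term of the lower central series to the next,
  so nilpotency makes it trivial. For surjectivity, approximate preimages are improved one degree at
  a time.\<close>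

lemma endo_bij:
  assumes \<phi>: "group_hom G G \<phi>" and ab: "\<And>x. x \<in> carrier G \<Longrightarrow> \<phi> x \<otimes> inv x \<in> lcs 2"
    and nil: "lcs Q \<subseteq> {\<one>}" "1 \<le> Q"
  shows "bij_betw \<phi> (carrier G) (carrier G)"
proof -
  interpret \<phi>: group_hom G G \<phi> by (rule \<phi>)
  have triv: "\<phi> x \<otimes> inv x \<in> lcs (Suc q)" if "1 \<le> q" "x \<in> lcs q" for q x
    by (rule endo_trivial_lcs[OF \<phi> _ that]) (rule ab)
  have "x = \<one>" if x: "x \<in> carrier G" "\<phi> x = \<one>" for x
  proof -
    have "x \<in> lcs q" if "1 \<le> q" for q
      using that
    proof (induction q rule: dec_induct)
      case (step q)
      have "\<phi> x \<otimes> inv x \<in> lcs (Suc q)" by (rule triv[OF step.hyps(1) step.IH])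
      then have "inv x \<in> lcs (Suc q)" using x by simp
      then show ?case using subgroup.m_inv_closed[OF lcs_subgroup] x by fastforce
    qed (use x in simp)
    then show ?thesis using nil by auto
  qed
  then have "inj_on \<phi> (carrier G)" by (simp add: \<phi>.inj_on_one_iff)
  moreover have "carrier G \<subseteq> \<phi> ` carrier G"
  proof
    fix y assume y: "y \<in> carrier G"
    have "\<exists>x\<in>carrier G. \<exists>z\<in>lcs q. y = z \<otimes> \<phi> x" if "1 \<le> q" for q
      using that
    proof (induction q rule: dec_induct)
      case base
      show ?case using y by (intro bexI[of _ \<one>] bexI[of _ y]) auto
    next
      case (step q)
      then obtain x z where xz: "x \<in> carrier G" "z \<in> lcs q" "y = z \<otimes> \<phi> x" by blast
      have zc: "z \<in> carrier G" using xz lcs_carrier by blast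
      have "inv (\<phi> z \<otimes> inv z) \<in> lcs (Suc q)"
        using triv[OF step.hyps(1) xz(2)] subgroup.m_inv_closed[OF lcs_subgroup] by blast
      \<comment> \<open>The remainder \<open>z\<close> is nearly its own image, so it is absorbed
        into the argument of \<open>\<phi>\<close>; what is left over lies one degree
        deeper.\<close>
      moreover have "y = inv (\<phi> z \<otimes> inv z) \<otimes> \<phi> (z \<otimes> x)"
        using xz zc by (simp add: inv_mult_group m_assoc)
      ultimately show ?case using xz zc by blast
    qed
    from this[OF nil(2)] obtain x z where "x \<in> carrier G" "z \<in> lcs Q" "y = z \<otimes> \<phi> x" by blast
    then show "y \<in> \<phi> ` carrier G" using nil by auto
  qed
  ultimately show ?thesis by (auto simp: bij_betw_def)
qed

end

section \<open>The reduced free group\<close>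

context
  fixes n k :: nat
begin

lemma JK_gprod: "JK n k = FA.gprod n (\<lambda>_. k + 1)"
  by (simp add: JK_def)

lemma J_at_gprod: "J_at n k i = FA.gprod n ((\<lambda>_. k + 1)(i := k))"
  by (simp add: J_at_def)

lemma JK_normal: "JK n k \<lhd> FG n"
  unfolding JK_gprod by (rule FA.gprod_normal)

lemma free_group_N_generated: "carrier (FG n) \<subseteq> generate (FG n) (\<Union>j\<in>{1..n}. FA.N n j)"
proof (rule free_group_generated)
  show "subgroup (generate (FG n) (\<Union>j\<in>{1..n}. FA.N n j)) (FG n)"
    using FA.N_normal F.normal_subsetD by (intro F.generate_is_subgroup) blast
  show "alpha n x \<in> generate (FG n) (\<Union>j\<in>{1..n}. FA.N n j)" if "x \<in> {1..n}" for x
    using that F.normal_closure_mem by (intro generate.incl) blast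
qed

text \<open>\<open>n * k\<close> is the sum over the \<open>n\<close> indices of the exponent
  \<open>k + 1\<close> minus one, as required by the pigeonhole bound.\<close>

lemma lcs_subset_JK: "F.lcs n (Suc (n * k)) \<subseteq> JK n k"
  unfolding JK_gprod by (rule FA.lcs_subset_gprod[OF free_group_N_generated]) auto

lemma group_RF: "Group.group (RF n k)"
  unfolding RF_def using JK_normal by (rule normal.factorgroup_is_group)

lemma RF_coset_hom: "group_hom (FG n) (RF n k) (\<lambda>x. JK n k #>\<^bsub>FG n\<^esub> x)"
  unfolding RF_def by (rule F.group_hom_coset[OF JK_normal])

lemma carrier_RF: "carrier (RF n k) = (\<lambda>x. JK n k #>\<^bsub>FG n\<^esub> x) ` carrier (FG n)"
  by (simp add: RF_def carrier_FactGroup)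

lemma RF_gen_closed: "i \<in> {1..n} \<Longrightarrow> RF_gen n k i \<in> carrier (RF n k)"
  unfolding carrier_RF RF_gen_def by (intro imageI free_gen_closed)

lemma one_RF: "\<one>\<^bsub>RF n k\<^esub> = JK n k"
  by (simp add: RF_def)

lemma RF_hom_unique:
  assumes H: "Group.group H" and h: "h \<in> hom (RF n k) H" "h' \<in> hom (RF n k) H"
    and gen: "\<And>i. i \<in> {1..n} \<Longrightarrow> h (RF_gen n k i) = h' (RF_gen n k i)" and x: "x \<in> carrier (RF n k)"
  shows "h x = h' x"
proof -
  let ?c = "\<lambda>x. JK n k #>\<^bsub>FG n\<^esub> x"
  have c: "?c \<in> hom (FG n) (RF n k)" using group_hom.homh[OF RF_coset_hom] .
  obtain g where g: "x = ?c g" "g \<in> carrier (FG n)" using x carrier_RF by auto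
  have "(h \<circ> ?c) g = (h' \<circ> ?c) g"
    by (rule free_group_hom_unique[OF H hom_compose[OF c h(1)] hom_compose[OF c h(2)] _ g(2)])
      (use gen in \<open>simp add: RF_gen_def\<close>)
  then show ?thesis by (simp add: g)
qed

lemma gamma_product_RF: "gamma_product (RF n k) n (RF_gen n k) (\<lambda>_. k + 1) \<subseteq> {JK n k}"
  using FA.gamma_product_quotient[OF JK_normal, of "\<lambda>_. k + 1"]
  by (simp add: RF_def JK_gprod RF_gen_def[abs_def])

lemma RF_hom_exists:
  assumes H: "group_hom (FG n) H h" and k: "h ` JK n k \<subseteq> {\<one>\<^bsub>H\<^esub>}"
  obtains f where "f \<in> hom (RF n k) H" "\<And>x. x \<in> carrier (FG n) \<Longrightarrow> f (JK n k #>\<^bsub>FG n\<^esub> x) = h x"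
proof -
  interpret h: group_hom "FG n" H h by (rule H)
  have "h x = h y" if xy: "x \<in> carrier (FG n)" "y \<in> carrier (FG n)" "JK n k #>\<^bsub>FG n\<^esub> x = JK n k #>\<^bsub>FG n\<^esub> y" for x y
  proof -
    have "x \<otimes>\<^bsub>FG n\<^esub> inv\<^bsub>FG n\<^esub> y \<in> JK n k" using F.coset_eq_iff[OF JK_normal xy(1,2)] xy(3) by blast
    then have "h (x \<otimes>\<^bsub>FG n\<^esub> inv\<^bsub>FG n\<^esub> y) = \<one>\<^bsub>H\<^esub>" using k by blast
    then show ?thesis using xy h.H.inv_solve_right'[of "\<one>\<^bsub>H\<^esub>" "h x" "h y"] by simp
  qed
  from FactGroup_universal[OF h.homh JK_normal this] show thesis using that unfolding RF_def by blast
qed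

lemma lcs_RF: "lower_central (RF n k) (carrier (RF n k)) (Suc (n * k)) \<subseteq> {\<one>\<^bsub>RF n k\<^esub>}"
proof -
  have "lower_central (RF n k) (carrier (RF n k)) (Suc (n * k)) = (\<lambda>x. JK n k #>\<^bsub>FG n\<^esub> x) ` F.lcs n (Suc (n * k))"
    unfolding carrier_RF by (rule group_hom.lower_central_image[OF RF_coset_hom, symmetric]) simp
  also have "\<dots> \<subseteq> {\<one>\<^bsub>RF n k\<^esub>}"
    unfolding one_RF using lcs_subset_JK F.coset_eq_self_iff[OF JK_normal] F.lcs_carrier by blast
  finally show ?thesis .
qed

text \<open>Shows that the definite description \<open>reduced_action\<close> is met. Conjugating
  the generators separately is compatible with the quotient because each image stays in the normal
  closure of its generator; bijectivity is \<open>endo_bij\<close>, as \<open>RF n k\<close> is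
  nilpotent.\<close>

lemma conj_automorphism:
  assumes l: "l \<in> {1..n} \<rightarrow> carrier (RF n k)"
  shows "\<exists>!\<phi>. \<phi> \<in> Aut_c n k \<and> (\<forall>i\<in>{1..n}. \<phi> (RF_gen n k i) =
    inv\<^bsub>RF n k\<^esub> l i \<otimes>\<^bsub>RF n k\<^esub> RF_gen n k i \<otimes>\<^bsub>RF n k\<^esub> l i)"
proof -
  let ?R = "RF n k" and ?a = "RF_gen n k"
  let ?f = "\<lambda>i. inv\<^bsub>?R\<^esub> l i \<otimes>\<^bsub>?R\<^esub> ?a i \<otimes>\<^bsub>?R\<^esub> l i"
  interpret R: Group.group ?R by (rule group_RF)
  interpret RA: group_with_gens ?R n ?a by unfold_locales (rule RF_gen_closed)
  have lc: "l i \<in> carrier ?R" if "i \<in> {1..n}" for i using l that by auto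
  have fc: "?f \<in> {1..n} \<rightarrow> carrier ?R" using lc RF_gen_closed by auto
  define h where "h = free_lift {1..n} ?R ?f"
  have h: "h \<in> hom (FG n) ?R" "\<And>i. i \<in> {1..n} \<Longrightarrow> h (alpha n i) = ?f i"
    unfolding h_def using free_lift_hom[OF group_RF fc] free_lift_gen[OF group_RF fc] by auto
  have hh: "group_hom (FG n) ?R h"
    by (intro group_hom.intro group_hom_axioms.intro group_free_group group_RF h(1))
  have "h ` JK n k \<subseteq> gamma_product ?R n ?a (\<lambda>_. k + 1)"
    unfolding JK_def
  proof (rule group_hom.gamma_product_image[OF hh])
    show "h (alpha n j) \<in> normal_closure ?R {?a j}" if j: "j \<in> {1..n}" for j
      unfolding h(2)[OF j]
      by (rule R.normal_conj_inv[OF RA.N_normal[OF j] lc[OF j] R.normal_closure_mem])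
  qed (use free_gen_closed RF_gen_closed in auto)
  also have "\<dots> \<subseteq> {\<one>\<^bsub>?R\<^esub>}" unfolding one_RF by (rule gamma_product_RF)
  finally have hJ: "h ` JK n k \<subseteq> {\<one>\<^bsub>?R\<^esub>}" .
  obtain \<phi> where \<phi>: "\<phi> \<in> hom ?R ?R" "\<And>x. x \<in> carrier (FG n) \<Longrightarrow> \<phi> (JK n k #>\<^bsub>FG n\<^esub> x) = h x"
    by (rule RF_hom_exists[OF hh hJ], rule that)
  have \<phi>g: "\<phi> (?a i) = ?f i" if i: "i \<in> {1..n}" for i
    using \<phi>(2)[OF free_gen_closed[OF i]] h(2)[OF i] by (simp add: RF_gen_def)
  have \<phi>h: "group_hom ?R ?R \<phi>" by (intro group_hom.intro group_hom_axioms.intro group_RF \<phi>(1))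
  let ?N = "R.lcs 2"
  interpret c: group_hom ?R "?R Mod ?N" "\<lambda>x. ?N #>\<^bsub>?R\<^esub> x" by (rule R.group_hom_coset[OF R.lcs_normal])
  have "?N #>\<^bsub>?R\<^esub> \<phi> x = ?N #>\<^bsub>?R\<^esub> x" if x: "x \<in> carrier ?R" for x
  proof -
    have "((\<lambda>x. ?N #>\<^bsub>?R\<^esub> x) \<circ> \<phi>) x = ?N #>\<^bsub>?R\<^esub> x"
    proof (rule RF_hom_unique[OF c.H.is_group hom_compose[OF \<phi>(1) c.homh] c.homh _ x])
      fix i assume i: "i \<in> {1..n}"
      \<comment> \<open>\<open>R.lcs 1\<close> is the whole group, so any conjugator agrees with the
        identity modulo it, and conjugation is trivial modulo \<open>R.lcs 2\<close>.\<close>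
      have "R.lcs 1 #>\<^bsub>?R\<^esub> l i = R.lcs 1 #>\<^bsub>?R\<^esub> \<one>\<^bsub>?R\<^esub>"
        using lc[OF i] by (subst R.coset_eq_iff[OF R.lcs_normal]) auto
      from R.lcs_conj_coset[OF order_refl lc[OF i] R.one_closed RF_gen_closed[OF i] this]
      show "((\<lambda>x. ?N #>\<^bsub>?R\<^esub> x) \<circ> \<phi>) (?a i) = ?N #>\<^bsub>?R\<^esub> ?a i"
        using RF_gen_closed[OF i] by (simp add: \<phi>g[OF i] numeral_2_eq_2 One_nat_def)
    qed
    then show ?thesis by simp
  qed
  then have "\<phi> x \<otimes>\<^bsub>?R\<^esub> inv\<^bsub>?R\<^esub> x \<in> ?N" if "x \<in> carrier ?R" for x
    using R.coset_eq_iff[OF R.lcs_normal] that group_hom.hom_closed[OF \<phi>h that] by blast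
  then have bij: "bij_betw \<phi> (carrier ?R) (carrier ?R)"
    by (rule R.endo_bij[OF \<phi>h _ lcs_RF]) auto
  define \<psi> where "\<psi> = restrict \<phi> (carrier ?R)"
  have eq: "\<psi> x = \<phi> x" if "x \<in> carrier ?R" for x using that by (simp add: \<psi>_def)
  have "\<psi> \<in> hom ?R ?R" using \<phi>(1) eq by (auto simp: hom_def Pi_iff)
  moreover have "\<psi> \<in> Bij (carrier ?R)"
    using bij bij_betw_cong[of "carrier ?R" \<psi> \<phi>] eq by (simp add: Bij_def \<psi>_def)
  moreover have \<psi>g: "\<psi> (?a i) = ?f i" if "i \<in> {1..n}" for i using that eq RF_gen_closed \<phi>g by simp
  ultimately have \<psi>: "\<psi> \<in> Aut_c n k" using lc by (auto simp: Aut_c_def auto_def)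
  show ?thesis
  proof (rule ex1I[of _ \<psi>])
    show "\<psi> \<in> Aut_c n k \<and> (\<forall>i\<in>{1..n}. \<psi> (?a i) = ?f i)" using \<psi> \<psi>g by blast
    fix f assume f: "f \<in> Aut_c n k \<and> (\<forall>i\<in>{1..n}. f (?a i) = ?f i)"
    show "f = \<psi>"
    proof (rule extensionalityI[of _ "carrier ?R"])
      show "f \<in> extensional (carrier ?R)" "\<psi> \<in> extensional (carrier ?R)"
        using f \<psi> by (auto simp: Aut_c_def auto_def Bij_def)
      show "f x = \<psi> x" if x: "x \<in> carrier ?R" for x
      proof (rule RF_hom_unique[OF group_RF _ _ _ x])
        show "f \<in> hom ?R ?R" "\<psi> \<in> hom ?R ?R" using f \<psi> unfolding Aut_c_def auto_def by blast+
        show "f (?a i) = \<psi> (?a i)" if i: "i \<in> {1..n}" for i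
          unfolding \<psi>g[OF i] using f i by blast
      qed
    qed
  qed
qed

end

section \<open>The reduced link group\<close>

context arc_diagram
begin

text \<open>By \<open>gen_conj\<close> each arc is a conjugate of the meridian of its strand, so it
  lies in the normal closure of that meridian.\<close>

lemma link_group_N_generated: "carrier (link_group n D) \<subseteq> generate (link_group n D) (\<Union>j\<in>{1..n}. GM.N j)"
  unfolding link_group_P
proof (rule L.P_generated, fold link_group_P)
  have sub: "(\<Union>j\<in>{1..n}. GM.N j) \<subseteq> carrier (link_group n D)"
    using GM.N_normal G.normal_subsetD by blast
  show "subgroup (generate (link_group n D) (\<Union>j\<in>{1..n}. GM.N j)) (link_group n D)"
    by (rule G.generate_is_subgroup[OF sub])
  fix a assume a: "a \<in> A"
  obtain i j where ij: "a = (i, j)" by (cases a)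
  have i: "i \<in> {1..n}" using a ij by (auto simp: arcs_def)
  have gens: "L.gen \<in> A \<rightarrow> carrier (link_group n D)" by simp
  have v: "weval (link_group n D) L.gen (under_word i j) \<in> carrier (link_group n D)"
    using G.weval_closed[OF gens under_word_words] a ij by blast
  have "L.gen (i, 1) \<in> GM.N i" using G.normal_closure_mem[of "meridian n D i"] by (simp add: meridian_gen)
  then have "L.gen a \<in> GM.N i"
    unfolding ij gen_conj[OF a[unfolded ij]] by (rule G.normal_conj_inv[OF GM.N_normal[OF i] v])
  then show "L.gen a \<in> generate (link_group n D) (\<Union>j\<in>{1..n}. GM.N j)"
    using i by (intro generate.incl) blast
qed

lemma lcs_subset_RG_kernel: "G.lcs (Suc (n * k)) \<subseteq> RG_kernel n k D"
  unfolding RG_kernel_def by (rule GM.lcs_subset_gprod[OF link_group_N_generated]) auto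

lemma RG_kernel_normal: "RG_kernel n k D \<lhd> link_group n D"
  unfolding RG_kernel_def by (rule GM.gprod_normal)

text \<open>Surjectivity comes from Milnor's approximations, whose error at level
  \<open>n * k\<close> lies in \<open>RG_kernel n k D\<close>; injectivity from
  \<open>\<Phi>\<close>, which inverts the meridian map modulo \<open>JK n k\<close>.\<close>

lemma reduced_meridian_iso:
  obtains \<psi> where "\<psi> \<in> iso (RF n k) (RG n k D)"
    "\<And>x. x \<in> carrier (FG n) \<Longrightarrow> \<psi> (JK n k #>\<^bsub>FG n\<^esub> x) = RG_kernel n k D #>\<^bsub>link_group n D\<^esub> \<mu> x"
proof -
  let ?G = "link_group n D" and ?K = "RG_kernel n k D"
  note K = RG_kernel_normal[of k]
  have RG: "Group.group (RG n k D)" unfolding RG_def using K by (rule normal.factorgroup_is_group)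
  have c: "group_hom ?G (RG n k D) (\<lambda>x. ?K #>\<^bsub>?G\<^esub> x)" unfolding RG_def by (rule G.group_hom_coset[OF K])
  have ch: "(\<lambda>x. ?K #>\<^bsub>?G\<^esub> x) \<circ> \<mu> \<in> hom (FG n) (RG n k D)"
    by (rule hom_compose[OF \<mu>_hom group_hom.homh[OF c]])
  have h: "group_hom (FG n) (RG n k D) ((\<lambda>x. ?K #>\<^bsub>?G\<^esub> x) \<circ> \<mu>)"
    by (intro group_hom.intro group_hom_axioms.intro group_free_group RG ch)
  have "\<mu> ` JK n k \<subseteq> ?K"
    unfolding JK_def RG_kernel_def
  proof (rule \<mu>.gamma_product_image)
    show "\<mu> (alpha n j) \<in> GM.N j" if "j \<in> {1..n}" for j
      using \<mu>_alpha[OF that] G.normal_closure_mem[of "meridian n D j"] by (simp add: meridian_gen)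
  qed (use free_gen_closed GM.gens_carrier in auto)
  then have hJ: "((\<lambda>x. ?K #>\<^bsub>?G\<^esub> x) \<circ> \<mu>) ` JK n k \<subseteq> {\<one>\<^bsub>RG n k D\<^esub>}"
    using G.coset_eq_self_iff[OF K] G.normal_subsetD[OF K] by (auto simp: RG_def)
  obtain \<psi> where \<psi>: "\<psi> \<in> hom (RF n k) (RG n k D)"
    "\<And>x. x \<in> carrier (FG n) \<Longrightarrow> \<psi> (JK n k #>\<^bsub>FG n\<^esub> x) = ((\<lambda>x. ?K #>\<^bsub>?G\<^esub> x) \<circ> \<mu>) x"
    by (rule RF_hom_exists[OF h hJ], rule that)
  obtain \<Phi> where \<Phi>: "group_hom ?G (FG n Mod JK n k) \<Phi>"
    "\<And>g. g \<in> carrier (FG n) \<Longrightarrow> \<Phi> (\<mu> g) = JK n k #>\<^bsub>FG n\<^esub> g"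
    "\<And>i. i \<in> {1..n} \<Longrightarrow> \<Phi> (L.gen (i, 1)) = JK n k #>\<^bsub>FG n\<^esub> alpha n i"
    by (rule eta_hom[OF JK_normal lcs_subset_JK], rule that)
  interpret \<Phi>: group_hom ?G "RF n k" \<Phi> using \<Phi>(1) by (simp add: RF_def)
  have "\<Phi> ` ?K \<subseteq> gamma_product (RF n k) n (RF_gen n k) (\<lambda>_. k + 1)"
    unfolding RG_kernel_def
  proof (rule \<Phi>.gamma_product_image)
    show "\<Phi> (meridian n D j) \<in> normal_closure (RF n k) {RF_gen n k j}" if "j \<in> {1..n}" for j
      using \<Phi>(3)[OF that] \<Phi>.H.normal_closure_mem[of "RF_gen n k j"] by (simp add: meridian_gen RF_gen_def)
  qed (use RF_gen_closed GM.gens_carrier in auto)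
  also have "\<dots> \<subseteq> {JK n k}" by (rule gamma_product_RF)
  finally have \<Phi>K: "\<Phi> ` ?K \<subseteq> {JK n k}" .
  interpret \<psi>: group_hom "RF n k" "RG n k D" \<psi>
    by (intro group_hom.intro group_hom_axioms.intro group_RF RG \<psi>(1))
  have "\<psi> \<in> iso (RF n k) (RG n k D)"
    unfolding \<psi>.iso_iff
  proof (intro conjI ballI impI)
    show "carrier (RG n k D) \<subseteq> \<psi> ` carrier (RF n k)"
    proof
      fix X assume "X \<in> carrier (RG n k D)"
      then obtain g where g: "X = ?K #>\<^bsub>?G\<^esub> g" "g \<in> carrier ?G" by (auto simp: RG_def carrier_FactGroup)
      then obtain w where w: "g = L.cls w" "w \<in> words A" by (auto simp: link_group_P L.carrier_P)
      let ?x = "weval (FG n) (eta (n * k)) w"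
      have xc: "?x \<in> carrier (FG n)" by (rule F.weval_closed[OF eta_closed w(2)])
      have "?K #>\<^bsub>?G\<^esub> \<mu> ?x = ?K #>\<^bsub>?G\<^esub> g"
        by (rule G.coset_eq_mono[OF G.lcs_normal K lcs_subset_RG_kernel _ g(2)])
          (use \<mu>_weval_eta[OF w(2)] w(1) xc in auto)
      then have "X = \<psi> (JK n k #>\<^bsub>FG n\<^esub> ?x)" using \<psi>(2)[OF xc] g by simp
      then show "X \<in> \<psi> ` carrier (RF n k)" using xc carrier_RF by blast
    qed
    fix X assume "X \<in> carrier (RF n k)" and X1: "\<psi> X = \<one>\<^bsub>RG n k D\<^esub>"
    then obtain x where x: "X = JK n k #>\<^bsub>FG n\<^esub> x" "x \<in> carrier (FG n)" by (auto simp: carrier_RF)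
    then have "?K #>\<^bsub>?G\<^esub> \<mu> x = ?K" using X1 \<psi>(2) by (simp add: RG_def)
    then have "\<mu> x \<in> ?K" using G.coset_eq_self_iff[OF K] x by simp
    then have "\<Phi> (\<mu> x) = JK n k" using \<Phi>K by blast
    then show "X = \<one>\<^bsub>RF n k\<^esub>" using \<Phi>(2)[OF x(2)] x(1) by (simp add: one_RF)
  qed
  then show thesis using that \<psi>(2) by simp
qed

lemma reduced_longitude_eq:
  assumes i: "i \<in> {1..n}"
  shows "reduced_longitude n k D i = JK n k #>\<^bsub>FG n\<^esub> lam (n * k) i"
proof -
  let ?G = "link_group n D" and ?K = "RG_kernel n k D" and ?R = "RF n k"
  obtain \<psi> where \<psi>: "\<psi> \<in> iso ?R (RG n k D)"
    "\<And>x. x \<in> carrier (FG n) \<Longrightarrow> \<psi> (JK n k #>\<^bsub>FG n\<^esub> x) = ?K #>\<^bsub>?G\<^esub> \<mu> x"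
    by (rule reduced_meridian_iso, rule that)
  have RG: "Group.group (RG n k D)"
    unfolding RG_def using RG_kernel_normal by (rule normal.factorgroup_is_group)
  let ?\<psi> = "restrict \<psi> (carrier ?R)"
  have eq: "?\<psi> x = \<psi> x" if "x \<in> carrier ?R" for x using that by simp
  have "?\<psi> \<in> hom ?R (RG n k D)"
    using \<psi>(1) Group.group.is_monoid[OF group_RF, THEN monoid.m_closed] by (auto simp: iso_def hom_def Pi_iff)
  moreover have "bij_betw ?\<psi> (carrier ?R) (carrier (RG n k D))"
    using \<psi>(1) bij_betw_cong[of "carrier ?R" ?\<psi> \<psi>] by (simp add: iso_def)
  ultimately have iso: "?\<psi> \<in> iso ?R (RG n k D)" by (simp add: iso_def)
  have gen: "?\<psi> (RF_gen n k j) = ?K #>\<^bsub>?G\<^esub> meridian n D j" if j: "j \<in> {1..n}" for j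
    using eq[OF RF_gen_closed[OF j]] \<psi>(2)[OF free_gen_closed[OF j]] \<mu>_alpha[OF j]
    by (simp add: RF_gen_def meridian_gen)
  have "reduced_meridian_map n k D = ?\<psi>"
    unfolding reduced_meridian_map_def
  proof (rule the_equality)
    show "?\<psi> \<in> iso ?R (RG n k D) \<inter> extensional (carrier ?R) \<and>
      (\<forall>i\<in>{1..n}. ?\<psi> (RF_gen n k i) = ?K #>\<^bsub>?G\<^esub> meridian n D i)"
      using iso gen by blast
    fix h assume h: "h \<in> iso ?R (RG n k D) \<inter> extensional (carrier ?R) \<and>
      (\<forall>i\<in>{1..n}. h (RF_gen n k i) = ?K #>\<^bsub>?G\<^esub> meridian n D i)"
    show "h = ?\<psi>"
    proof (rule extensionalityI[of _ "carrier ?R"])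
      show "h x = ?\<psi> x" if x: "x \<in> carrier ?R" for x
      proof (rule RF_hom_unique[OF RG _ _ _ x])
        show "h \<in> hom ?R (RG n k D)" using h unfolding iso_def by blast
        show "?\<psi> \<in> hom ?R (RG n k D)" using iso unfolding iso_def by blast
        show "h (RF_gen n k j) = ?\<psi> (RF_gen n k j)" if j: "j \<in> {1..n}" for j
          using h j unfolding gen[OF j] by blast
      qed
    qed (use h in auto)
  qed
  moreover have lc: "JK n k #>\<^bsub>FG n\<^esub> lam (n * k) i \<in> carrier ?R"
    unfolding carrier_RF by (intro imageI lam_closed[OF i])
  moreover have "?\<psi> (JK n k #>\<^bsub>FG n\<^esub> lam (n * k) i) = ?K #>\<^bsub>?G\<^esub> longitude n D i"
  proof -
    have "?K #>\<^bsub>?G\<^esub> \<mu> (lam (n * k) i) = ?K #>\<^bsub>?G\<^esub> longitude n D i"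
      by (rule G.coset_eq_mono[OF G.lcs_normal RG_kernel_normal lcs_subset_RG_kernel _ longitude_closed[OF i] \<mu>_lam[OF i]])
        (use lam_closed[OF i] in auto)
    then show ?thesis unfolding eq[OF lc] \<psi>(2)[OF lam_closed[OF i]] .
  qed
  moreover have "inj_on ?\<psi> (carrier ?R)" using iso by (simp add: iso_def bij_betw_def)
  ultimately show ?thesis unfolding reduced_longitude_def by (metis inv_into_f_f)
qed

end

section \<open>Combinatorics of diagrams\<close>

text \<open>The geometric input. That an under-passing point determines its over-passing site rests
  on the absence of triple points; finiteness rests on that of the double points.\<close>

lemma string_link_arc_diagram:
  assumes "string_link_diagram p n D"
  shows "arc_diagram n D"
proof -
  have fin: "finite (double_points n D)" and sub: "classical D \<subseteq> double_points n D"
    and trip: "\<And>x y z. (x, y) \<in> double_points n D \<Longrightarrow> z \<in> sites n \<Longrightarrow> pt D z = pt D x \<Longrightarrow> z = x \<or> z = y"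
    using assms unfolding string_link_diagram_def by blast+
  have finc: "finite (classical D)" using fin sub by (rule rev_finite_subset)
  have site: "x \<in> sites n" "y \<in> sites n" if "(x, y) \<in> classical D" for x y
    using that sub by (auto simp: double_points_def)
  have unique: "x = x'" if "(x, y) \<in> classical D" "(x', y) \<in> classical D" for x x' y
  proof -
    have "(x, y) \<in> double_points n D" "(x', y) \<in> double_points n D" using that sub by auto
    then show ?thesis using trip[of x y x'] by (auto simp: double_points_def)
  qed
  have finu: "finite (under_times D i)" for i
  proof (rule finite_subset)
    show "under_times D i \<subseteq> (\<lambda>c. snd (snd c)) ` classical D"
      by (force simp: under_times_def)
  qed (use finc in simp)
  \<comment> \<open>Crossings along a strand are numbered from one and list positions from zero,
    hence the shift.\<close>
  define time where "time i j = sorted_list_of_set (under_times D i) ! (j - 1)" for i j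
  have time_bij: "bij_betw (time i) {1..under_number D i} (under_times D i)" for i
  proof -
    have "bij_betw (\<lambda>j. j - 1) {1..under_number D i} {..<under_number D i}"
      by (rule bij_betwI[of _ _ _ "\<lambda>j. j + 1"]) auto
    moreover have "bij_betw ((!) (sorted_list_of_set (under_times D i))) {..<under_number D i} (under_times D i)"
      using finu by (intro bij_betw_nth) auto
    ultimately show ?thesis
      unfolding time_def[abs_def] using bij_betw_trans by (fastforce simp: comp_def)
  qed
  have crossing: "crossing_at D i j = (x, (i, time i j))" if "(x, (i, time i j)) \<in> classical D" for i j x
  proof -
    have "(THE x. (x, (i, time i j)) \<in> classical D) = x" using that unique by blast
    then show ?thesis by (simp add: crossing_at_def Let_def time_def)
  qed
  have crossing_ex: "\<exists>x. (x, (i, time i j)) \<in> classical D" if "j \<in> {1..under_number D i}" for i j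
    using bij_betw_apply[OF time_bij that] by (simp add: under_times_def)
  have crossing_mem: "crossing_at D i j \<in> classical D" "snd (crossing_at D i j) = (i, time i j)"
    if "j \<in> {1..under_number D i}" for i j
    using crossing_ex[OF that] crossing by fastforce+
  show ?thesis
  proof
    fix i j assume i: "i \<in> {1..n}" and j: "j \<in> {1..under_number D i}"
    let ?x = "fst (crossing_at D i j)"
    have "(?x, snd (crossing_at D i j)) \<in> classical D" using crossing_mem(1)[OF j] by simp
    then have "?x \<in> sites n" by (rule site(1))
    then have "fst ?x \<in> {1..n}" by (auto simp: sites_def)
    moreover have "card {t \<in> under_times D (fst ?x). t < snd ?x} \<le> under_number D (fst ?x)"
      by (rule card_mono[OF finu]) auto
    ultimately show "fst (over_letter D i j) \<in> arcs n D"
      by (simp add: over_letter_def arc_of_def arcs_def)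
  next
    fix i assume i: "i \<in> {1..n}"
    let ?C = "{c \<in> classical D. fst (snd c) = i}"
    \<comment> \<open>The crossings at which strand \<open>i\<close> passes under are enumerated
      without repetition, so the sum defining the framing can be reindexed by
      \<open>j\<close>.\<close>
    have bij: "bij_betw (crossing_at D i) {1..under_number D i} ?C"
    proof (rule bij_betw_imageI)
      show "inj_on (crossing_at D i) {1..under_number D i}"
      proof (rule inj_onI)
        fix j j' assume j: "j \<in> {1..under_number D i}" "j' \<in> {1..under_number D i}"
          "crossing_at D i j = crossing_at D i j'"
        then have "time i j = time i j'" using crossing_mem(2) by (metis prod.inject)
        then show "j = j'" using time_bij[of i] j by (auto simp: bij_betw_def dest: inj_onD)
      qed
      show "crossing_at D i ` {1..under_number D i} = ?C"
      proof
        show "crossing_at D i ` {1..under_number D i} \<subseteq> ?C" using crossing_mem by auto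
        show "?C \<subseteq> crossing_at D i ` {1..under_number D i}"
        proof
          fix c assume c: "c \<in> ?C"
          then obtain x t where xt: "c = (x, (i, t))" "(x, (i, t)) \<in> classical D" by (cases c) auto
          then have "t \<in> under_times D i" unfolding under_times_def by blast
          then have "t \<in> time i ` {1..under_number D i}"
            using time_bij[of i] unfolding bij_betw_def by simp
          then obtain j where j: "j \<in> {1..under_number D i}" "t = time i j" by blast
          then have "crossing_at D i j = c" using crossing xt by simp
          then show "c \<in> crossing_at D i ` {1..under_number D i}" using j by blast
        qed
      qed
    qed
    have sgn: "crossing_sign D c = 1 \<or> crossing_sign D c = - 1" for c
      by (simp add: crossing_sign_def)
    let ?f = "\<lambda>c. if fst (fst c) = i then crossing_sign D c else 0"
    have "framing D i = (\<Sum>c\<in>?C. ?f c)"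
    proof -
      have "{(x, y) \<in> classical D. fst x = i \<and> fst y = i} = {c \<in> ?C. fst (fst c) = i}" by auto
      then show ?thesis unfolding framing_def using finc by (auto simp: sum.inter_filter intro!: sum.cong)
    qed
    also have "\<dots> = (\<Sum>j\<in>{1..under_number D i}. ?f (crossing_at D i j))"
      by (rule sum.reindex_bij_betw[OF bij, symmetric])
    also have "\<dots> = (\<Sum>j\<in>{1..under_number D i}.
      if fst (fst (over_letter D i j)) = i then (if snd (over_letter D i j) then 1 else -1) else 0)"
    proof (rule sum.cong[OF HOL.refl])
      fix j
      show "?f (crossing_at D i j) =
        (if fst (fst (over_letter D i j)) = i then (if snd (over_letter D i j) then 1 else -1) else 0)"
        using sgn[of "crossing_at D i j"] by (auto simp: over_letter_def arc_of_def)
    qed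
    finally show "framing D i = (\<Sum>j\<in>{1..under_number D i}.
      if fst (fst (over_letter D i j)) = i then (if snd (over_letter D i j) then 1 else -1) else 0)" .
  qed
qed

section \<open>Preferred longitudes and centralizers of generators\<close>

text \<open>Restricting a series to these words amounts to setting all variables other than
  \<open>X\<^sub>i\<close> to zero.\<close>

definition pure_powers :: "nat \<Rightarrow> nat list set" where
  "pure_powers i = {u. set u \<subseteq> {i}}"

lemma factor_closed_pure_powers: "factor_closed (pure_powers i)"
  unfolding factor_closed_def pure_powers_def using set_take_subset set_drop_subset by fastforce

text \<open>Modulo this kernel every other generator is trivial, so the quotient is generated by the
  image of \<open>alpha n i\<close> and is abelian.\<close>

lemma comm_alpha_pure_powers:
  assumes i: "i \<in> {1..n}" and g: "g \<in> carrier (FG n)"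
  shows "F.comm n g (alpha n i) \<in> magnus_kernel n (pure_powers i)"
proof -
  let ?K = "magnus_kernel n (pure_powers i)"
  have K: "?K \<lhd> FG n" by (rule magnus_kernel_normal[OF factor_closed_pure_powers])
  have al: "alpha n j \<in> carrier (FG n)" if "j \<in> {1..n}" for j using that by (rule free_gen_closed)
  have "carrier (FG n) \<subseteq> {g \<in> carrier (FG n). F.comm n g (alpha n i) \<in> ?K}"
  proof (rule free_group_generated)
    show "subgroup {g \<in> carrier (FG n). F.comm n g (alpha n i) \<in> ?K} (FG n)"
      by (rule F.subgroup_comm_normal[OF K al[OF i]])
    fix j assume j: "j \<in> {1..n}"
    have "F.comm n (alpha n j) (alpha n i) \<in> ?K"
    proof (cases "j = i")
      case True
      then have "F.comm n (alpha n j) (alpha n i) = \<one>\<^bsub>FG n\<^esub>"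
        using al[OF i] by (simp add: gcomm_def F.m_assoc)
      then show ?thesis using subgroup.one_closed[OF normal_imp_subgroup[OF K]] by simp
    next
      case False
      then have "alpha n j \<in> ?K" using j by (intro alpha_kernel) (auto simp: pure_powers_def)
      then show ?thesis by (rule F.normal_comm(1)[OF K _ al[OF i]])
    qed
    then show "alpha n j \<in> {g \<in> carrier (FG n). F.comm n g (alpha n i) \<in> ?K}" using al[OF j] by simp
  qed
  then show ?thesis using g by blast
qed

text \<open>Modulo all variables but \<open>X\<^sub>i\<close> the longitude becomes a power of \<open>\<alpha>\<^sub>i\<close>, whose exponent
  vanishes by the choice of the framing.\<close>

lemma (in arc_diagram) lam_pure_powers:
  assumes i: "i \<in> {1..n}"
  shows "lam q i \<in> magnus_kernel n (pure_powers i)"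
proof -
  let ?K = "magnus_kernel n (pure_powers i)" and ?F = "FG n"
  let ?Q = "?F Mod ?K"
  have K: "?K \<lhd> ?F" by (rule magnus_kernel_normal[OF factor_closed_pure_powers])
  interpret c: group_hom ?F ?Q "\<lambda>x. ?K #>\<^bsub>?F\<^esub> x" by (rule F.group_hom_coset[OF K])
  have al: "alpha n j \<in> carrier ?F" if "j \<in> {1..n}" for j using that by (rule free_gen_closed)
  define \<beta> where "\<beta> = ?K #>\<^bsub>?F\<^esub> alpha n i"
  have \<beta>: "\<beta> \<in> carrier ?Q" unfolding \<beta>_def by (rule c.hom_closed[OF al[OF i]])
  \<comment> \<open>This makes the conjugators in the recursion for \<open>eta\<close> irrelevant:
    in the quotient only the strand of an arc counts.\<close>
  have conj: "?K #>\<^bsub>?F\<^esub> (inv\<^bsub>?F\<^esub> v \<otimes>\<^bsub>?F\<^esub> alpha n j \<otimes>\<^bsub>?F\<^esub> v) = (if j = i then \<beta> else \<one>\<^bsub>?Q\<^esub>)"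
    if v: "v \<in> carrier ?F" and j: "j \<in> {1..n}" for v j
  proof (cases "j = i")
    case True
    have "F.comm n (inv\<^bsub>?F\<^esub> v) (alpha n i) \<in> ?K" by (rule comm_alpha_pure_powers[OF i]) (use v in simp)
    then have "inv\<^bsub>?F\<^esub> v \<otimes>\<^bsub>?F\<^esub> alpha n i \<otimes>\<^bsub>?F\<^esub> v \<otimes>\<^bsub>?F\<^esub> inv\<^bsub>?F\<^esub> alpha n i \<in> ?K"
      using v by (simp add: gcomm_def)
    then have "?K #>\<^bsub>?F\<^esub> (inv\<^bsub>?F\<^esub> v \<otimes>\<^bsub>?F\<^esub> alpha n i \<otimes>\<^bsub>?F\<^esub> v) = \<beta>"
      unfolding \<beta>_def using v al[OF i] by (subst F.coset_eq_iff[OF K]) auto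
    then show ?thesis using True by simp
  next
    case False
    then have "alpha n j \<in> ?K" using j by (intro alpha_kernel) (auto simp: pure_powers_def)
    then have "inv\<^bsub>?F\<^esub> v \<otimes>\<^bsub>?F\<^esub> alpha n j \<otimes>\<^bsub>?F\<^esub> v \<in> ?K" by (rule F.normal_conj_inv[OF K v])
    then have "?K #>\<^bsub>?F\<^esub> (inv\<^bsub>?F\<^esub> v \<otimes>\<^bsub>?F\<^esub> alpha n j \<otimes>\<^bsub>?F\<^esub> v) = ?K"
      using v al[OF j] by (subst F.coset_eq_self_iff[OF K]) auto
    then show ?thesis using False by simp
  qed
  have eta: "?K #>\<^bsub>?F\<^esub> eta q a = (if fst a = i then \<beta> else \<one>\<^bsub>?Q\<^esub>)" if a: "a \<in> A" for q a
  proof -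
    have j: "fst a \<in> {1..n}" using a by (auto simp: arcs_def)
    show ?thesis
    proof (cases q)
      case 0
      then show ?thesis using conj[OF F.one_closed j] al[OF j] by (simp add: eta.simps)
    next
      case (Suc p)
      show ?thesis unfolding Suc eta.simps(2)
        by (rule conj[OF F.weval_closed[OF eta_closed under_word_words] j]) (use a in simp)
    qed
  qed
  let ?e = "\<lambda>j. if fst (fst (over_letter D i j)) = i then (if snd (over_letter D i j) then 1 else -1) else 0 :: int"
  \<comment> \<open>Partial words serve the induction along the strand; at the last arc the exponent
    is the framing, by \<open>framing_sum\<close>.\<close>
  have pow: "?K #>\<^bsub>?F\<^esub> weval ?F (eta q) (under_word i (m + 1)) = \<beta> [^]\<^bsub>?Q\<^esub> (\<Sum>j\<in>{1..m}. ?e j)"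
    if "m \<le> under_number D i" for m
    using that
  proof (induction m)
    case 0
    have "under_word i (0 + 1) = []" by (simp add: under_word_def One_nat_def)
    then show ?case using F.coset_eq_self_iff[OF K F.one_closed] subgroup.one_closed[OF normal_imp_subgroup[OF K]]
      by simp
  next
    case (Suc m)
    let ?b = "over_letter D i (Suc m)"
    have m: "Suc m \<in> {1..under_number D i}" using Suc.prems by simp
    have bw: "[?b] \<in> words A" by (rule over_letter_word[OF i m])
    have w: "under_word i (m + 1) \<in> words A"
      by (rule under_word_words) (use Suc.prems i in \<open>auto simp: arcs_def\<close>)
    have b: "eta q (fst ?b) \<in> carrier ?F" by (rule funcset_mem[OF eta_closed over_arc[OF i m]])
    have uw: "under_word i (Suc m + 1) = under_word i (m + 1) @ [?b]"
      using under_word_Suc[of "Suc m" i] by (simp add: One_nat_def)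
    have vb: "?K #>\<^bsub>?F\<^esub> weval ?F (eta q) [?b] = \<beta> [^]\<^bsub>?Q\<^esub> ?e (Suc m)"
    proof -
      have 1: "?K #>\<^bsub>?F\<^esub> inv\<^bsub>?F\<^esub> eta q (fst ?b) = inv\<^bsub>?Q\<^esub> (?K #>\<^bsub>?F\<^esub> eta q (fst ?b))"
        by (rule F.coset_inv[OF K b, symmetric])
      have 2: "weval ?F (eta q) [?b] = (if snd ?b then eta q (fst ?b) else inv\<^bsub>?F\<^esub> eta q (fst ?b))"
        using b by simp
      show ?thesis unfolding 2
        using \<beta> eta[OF over_arc[OF i m], of q] 1
        by (auto simp: c.H.int_pow_neg simp del: one_FactGroup mult_FactGroup)
    qed
    have "?K #>\<^bsub>?F\<^esub> weval ?F (eta q) (under_word i (Suc m + 1)) =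
        (?K #>\<^bsub>?F\<^esub> weval ?F (eta q) (under_word i (m + 1))) \<otimes>\<^bsub>?Q\<^esub> (?K #>\<^bsub>?F\<^esub> weval ?F (eta q) [?b])"
      unfolding uw F.weval_append[OF eta_closed w bw]
      by (rule F.coset_mult[OF K F.weval_closed[OF eta_closed w] F.weval_closed[OF eta_closed bw], symmetric])
    also have "\<dots> = \<beta> [^]\<^bsub>?Q\<^esub> ((\<Sum>j\<in>{1..m}. ?e j) + ?e (Suc m))"
      unfolding vb Suc.IH[OF Suc_leD[OF Suc.prems]] by (rule c.H.int_pow_mult[OF \<beta>, symmetric])
    also have "(\<Sum>j\<in>{1..m}. ?e j) + ?e (Suc m) = (\<Sum>j\<in>{1..Suc m}. ?e j)"
      by (simp add: sum.atLeast_Suc_atMost_Suc_shift)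
    finally show ?case .
  qed
  have w: "weval ?F (eta q) (under_word i (under_number D i + 1)) \<in> carrier ?F"
    by (rule F.weval_closed[OF eta_closed under_word_words[OF last_arc[OF i]]])
  have p: "(inv\<^bsub>?F\<^esub> alpha n i) [^]\<^bsub>?F\<^esub> framing D i \<in> carrier ?F" using al[OF i] by simp
  have "?K #>\<^bsub>?F\<^esub> lam q i = (?K #>\<^bsub>?F\<^esub> (inv\<^bsub>?F\<^esub> alpha n i) [^]\<^bsub>?F\<^esub> framing D i) \<otimes>\<^bsub>?Q\<^esub> \<beta> [^]\<^bsub>?Q\<^esub> framing D i"
    unfolding lam_def framing_sum[OF i] pow[OF order_refl, symmetric]
    using F.coset_mult[OF K p w] unfolding framing_sum[OF i] by (rule HOL.sym)
  also have "?K #>\<^bsub>?F\<^esub> (inv\<^bsub>?F\<^esub> alpha n i) [^]\<^bsub>?F\<^esub> framing D i = (inv\<^bsub>?Q\<^esub> \<beta>) [^]\<^bsub>?Q\<^esub> framing D i"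
    unfolding \<beta>_def F.coset_inv[OF K al[OF i]] by (rule c.hom_int_pow) (use al[OF i] in simp)
  also have "(inv\<^bsub>?Q\<^esub> \<beta>) [^]\<^bsub>?Q\<^esub> framing D i \<otimes>\<^bsub>?Q\<^esub> \<beta> [^]\<^bsub>?Q\<^esub> framing D i = \<one>\<^bsub>?Q\<^esub>"
    using \<beta> by (simp add: c.H.int_pow_inv del: one_FactGroup mult_FactGroup)
  finally have "?K #>\<^bsub>?F\<^esub> lam q i = ?K" by simp
  then show ?thesis using F.coset_eq_self_iff[OF K lam_closed[OF i]] by simp
qed

lemma coeff_mult_ncX: "coeff (f * ncX i) (u @ [j]) = (if j = i then coeff f u else 0)"
proof -
  have "coeff f (take l (u @ [j])) * coeff (ncX i) (drop l (u @ [j])) = 0" if "l \<noteq> length u" for l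
    using that by (cases "l < length u") (auto simp: append_eq_Cons_conv)
  then have "coeff (f * ncX i) (u @ [j]) =
      (\<Sum>l\<in>{length u}. coeff f (take l (u @ [j])) * coeff (ncX i) (drop l (u @ [j])))"
    unfolding coeff_mult by (intro sum.mono_neutral_right) auto
  then show ?thesis by simp
qed

lemma coeff_ncX_mult: "coeff (ncX i * f) (j # u) = (if j = i then coeff f u else 0)"
proof -
  have "coeff (ncX i) (take l (j # u)) * coeff f (drop l (j # u)) = 0" if "l \<noteq> 1" "l \<le> length (j # u)" for l
  proof -
    have "length (take l (j # u)) \<noteq> 1" using that by simp
    then have "take l (j # u) \<noteq> [i]" by (metis One_nat_def length_Cons list.size(3))
    then show ?thesis by simp
  qed
  then have "coeff (ncX i * f) (j # u) =
      (\<Sum>l\<in>{1}. coeff (ncX i) (take l (j # u)) * coeff f (drop l (j # u)))"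
    unfolding coeff_mult by (intro sum.mono_neutral_right) (auto simp: One_nat_def)
  then show ?thesis by (simp add: One_nat_def)
qed

text \<open>The appended \<open>i\<close> uses up one of the \<open>k\<close> permitted occurrences.
  This accounts for \<open>\<Gamma>\<^sub>k N\<^sub>i\<close> in \<open>J\<^sub>i\<^sup>k\<close>,
  and is used both for the last entry of a Milnor index and for coefficients of words ending in
  \<open>X\<^sub>i\<close>.\<close>

lemma adm_reduced_append:
  assumes "i \<in> {1..n}"
  shows "u @ [i] \<in> adm n (\<lambda>_. k + 1) \<longleftrightarrow> u \<in> adm n ((\<lambda>_. k + 1)(i := k))"
  using assms by (auto simp: adm_def)

text \<open>If \<open>E(g)\<close> commutes with \<open>X\<^sub>i\<close>, comparing the coefficients of \<open>u X\<^sub>i\<close> on both sides shows that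
  \<open>E(g)\<close> vanishes at \<open>u\<close> unless \<open>u\<close> starts with \<open>i\<close>, and that it is invariant under moving that \<open>i\<close>
  to the end. Hence only powers of \<open>X\<^sub>i\<close> survive.\<close>

lemma centralizer_alpha:
  assumes i: "i \<in> {1..n}" and k: "1 \<le> k" and g: "g \<in> carrier (FG n)"
    and pure: "g \<in> magnus_kernel n (pure_powers i)"
  shows "F.comm n g (alpha n i) \<in> JK n k \<longleftrightarrow> g \<in> J_at n k i"
proof
  assume "g \<in> J_at n k i"
  \<comment> \<open>Bracketing with \<open>alpha n i\<close>, an element of \<open>N i\<close>,
    raises the exponent at \<open>i\<close> from \<open>k\<close> to \<open>Suc k\<close>, and then
    all exponents are equal.\<close>
  then have "F.comm n g (alpha n i) \<in> FA.gprod n ((\<lambda>_. k + 1)(i := Suc k))"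
    unfolding J_at_gprod by (rule FA.comm_gprod[OF i F.normal_closure_mem _ k])
  moreover have "((\<lambda>_. k + 1)(i := Suc k)) = (\<lambda>_. k + 1)" by auto
  ultimately show "F.comm n g (alpha n i) \<in> JK n k" by (simp add: JK_gprod)
next
  let ?e = "\<lambda>_ :: nat. k + 1" and ?e' = "(\<lambda>_ :: nat. k + 1)(i := k)"
  let ?A = "adm n ?e" and ?B = "adm n ?e'"
  let ?a = "alpha n i" and ?c = "coeff (mag n g)"
  assume "F.comm n g ?a \<in> JK n k"
  then have "F.comm n g ?a \<in> magnus_kernel n ?A"
    unfolding JK_gprod using magnus_kernel_eq_gprod[of n ?e] by simp
  then have v: "vanish ?A (mag n (F.comm n g ?a) - 1)" by (simp add: magnus_kernel_def)
  have a: "?a \<in> carrier (FG n)" using i by (rule free_gen_closed)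
  let ?y = "inv\<^bsub>FG n\<^esub> g \<otimes>\<^bsub>FG n\<^esub> inv\<^bsub>FG n\<^esub> ?a"
  have y: "?y \<in> carrier (FG n)" using a g by simp
  \<comment> \<open>Multiplying by the inverse of the unit in \<open>mag_comm\<close> leaves the
    bare Lie bracket with \<open>X\<^sub>i\<close>.\<close>
  have "(mag n (F.comm n g ?a) - 1) * mag n (inv\<^bsub>FG n\<^esub> ?y) = (mag n g - 1) * (mag n ?a - 1) - (mag n ?a - 1) * (mag n g - 1)"
    unfolding mag_comm[OF g a] mult.assoc mag_inv(1)[OF y] by simp
  also have "\<dots> = mag n g * ncX i - ncX i * mag n g"
    by (simp add: mag_alpha[OF i] algebra_simps)
  finally have "vanish ?A (mag n g * ncX i - ncX i * mag n g)"
    using vanish_mult(1)[OF factor_closed_adm v, of "mag n (inv\<^bsub>FG n\<^esub> ?y)"] by simp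
  then have comm: "coeff (mag n g * ncX i) u = coeff (ncX i * mag n g) u" if "u \<in> ?A" for u
    using that by (simp add: vanish_def)
  have rot: "?c (x # u) = (if x = i then ?c (u @ [i]) else 0)" if "x # u \<in> ?B" for x u
  proof -
    have "(x # u) @ [i] \<in> ?A" using that adm_reduced_append[OF i, of "x # u" k] by blast
    from comm[OF this] show ?thesis
      unfolding coeff_mult_ncX using coeff_ncX_mult[of i "mag n g" x "u @ [i]"] by simp
  qed
  \<comment> \<open>\<open>l\<close> counts the leading letters \<open>i\<close> that
    \<open>rot\<close> still has to move to the end. Moving them changes neither the content nor
    membership in \<open>?B\<close>.\<close>
  have mixed: "?c (replicate l i @ x # t) = 0" if "replicate l i @ x # t \<in> ?B" "x \<noteq> i" for l x t
    using that
  proof (induction l arbitrary: t)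
    case 0
    then have "x # t \<in> ?B" unfolding replicate_0 append_Nil by blast
    from rot[OF this] show ?case using 0 by simp
  next
    case (Suc l)
    have "replicate l i @ x # (t @ [i]) \<in> ?B" using Suc.prems by (auto simp: adm_def)
    then have "?c (replicate l i @ x # (t @ [i])) = 0" using Suc by blast
    moreover have "i # (replicate l i @ x # t) \<in> ?B"
      using Suc.prems(1) unfolding replicate_Suc append_Cons by blast
    ultimately show ?case using rot[of i "replicate l i @ x # t"] by simp
  qed
  \<comment> \<open>Rotation says nothing about words in \<open>i\<close> alone; their coefficients
    are controlled by \<open>pure\<close>.\<close>
  have "?c u = (if u = [] then 1 else 0)" if u: "u \<in> ?B" for u
  proof (cases "set u \<subseteq> {i}")
    case True
    then have "coeff (mag n g - 1) u = 0" using pure by (simp add: magnus_kernel_def vanish_def pure_powers_def)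
    then show ?thesis by simp
  next
    case False
    then obtain s x t where st: "u = s @ x # t" "x \<noteq> i" "\<forall>y\<in>set s. y = i"
      using split_list_first_prop[of u "\<lambda>x. x \<noteq> i"] by auto
    then have "s = replicate (length s) i" by (simp add: replicate_eqI[symmetric])
    then have "?c u = 0" using mixed[of "length s" x t] u st by metis
    then show ?thesis using st by simp
  qed
  then have "vanish ?B (mag n g - 1)" by (simp add: vanish_def)
  then have "g \<in> magnus_kernel n ?B" using g by (simp add: magnus_kernel_def)
  then show "g \<in> J_at n k i" unfolding J_at_gprod using magnus_kernel_eq_gprod[of n ?e'] k by simp
qed

section \<open>Milnor indices and the comparison of two diagrams\<close>

lemma adm_length:
  assumes "u \<in> adm n e"
  shows "length u \<le> (\<Sum>j\<in>{1..n}. e j - 1)"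
proof -
  have "length u = (\<Sum>j\<in>{1..n}. count_list u j)"
    using assms sum_count_set[of u "{1..n}"] by (simp add: adm_def)
  also have "\<dots> \<le> (\<Sum>j\<in>{1..n}. e j - 1)"
    using assms by (intro sum_mono) (force simp: adm_def)
  finally show ?thesis .
qed

lemma max_repetition_le_iff:
  "max_repetition (u @ [i]) \<le> k \<longleftrightarrow> (\<forall>j. count_list (u @ [i]) j \<le> k)"
proof -
  have "max_repetition (u @ [i]) \<le> k \<longleftrightarrow> (\<forall>j\<in>set (u @ [i]). count_list (u @ [i]) j \<le> k)"
    unfolding max_repetition_def by (subst Max_le_iff) auto
  also have "\<dots> \<longleftrightarrow> (\<forall>j. count_list (u @ [i]) j \<le> k)"
    by (metis count_notin le0)
  finally show ?thesis .
qed

lemma milnor_index_iff: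
  assumes i: "i \<in> {1..n}"
  shows "set (u @ [i]) \<subseteq> {1..n} \<and> max_repetition (u @ [i]) \<le> k \<longleftrightarrow> u \<in> adm n ((\<lambda>_. k + 1)(i := k))"
proof -
  have "u @ [i] \<in> adm n (\<lambda>_. k + 1) \<longleftrightarrow> set (u @ [i]) \<subseteq> {1..n} \<and> (\<forall>j. count_list (u @ [i]) j \<le> k)"
  proof -
    have "(\<forall>j\<in>{1..n}. count_list w j < k + 1) \<longleftrightarrow> (\<forall>j. count_list w j \<le> k)" if "set w \<subseteq> {1..n}" for w :: "nat list"
      using that by (metis Suc_eq_plus1 count_notin le0 less_Suc_eq_le subsetD)
    then show ?thesis unfolding adm_def by blast
  qed
  then show ?thesis unfolding max_repetition_le_iff adm_reduced_append[OF i, symmetric] by simp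
qed

locale two_diagrams = D: arc_diagram n D + D': arc_diagram n D' for n D D' +
  fixes k :: nat
  assumes k: "1 \<le> k"
begin

abbreviation l :: "nat \<Rightarrow> nat word set" where "l \<equiv> D.lam (n * k)"
abbreviation l' :: "nat \<Rightarrow> nat word set" where "l' \<equiv> D'.lam (n * k)"

lemma J_at_eq: "J_at n k i = magnus_kernel n (adm n ((\<lambda>_. k + 1)(i := k)))"
  unfolding J_at_gprod using magnus_kernel_eq_gprod[of n "(\<lambda>_. k + 1)(i := k)"] k by simp

lemma J_at_normal: "J_at n k i \<lhd> FG n"
  unfolding J_at_gprod by (rule FA.gprod_normal)

lemma JK_subset_J_at: "JK n k \<subseteq> J_at n k i"
  unfolding JK_gprod J_at_gprod by (rule FA.gprod_antimono) auto

text \<open>Because \<open>JK n k\<close> is contained in \<open>J_at n k i\<close>, a coset of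
  \<open>JK n k\<close> lies in the image of \<open>J_at n k i\<close> exactly when its
  representatives lie in \<open>J_at n k i\<close>.\<close>

lemma congruent_iff:
  assumes i: "i \<in> {1..n}"
  shows "(reduced_longitude n k D i, reduced_longitude n k D' i) \<in> rcong\<^bsub>RF n k\<^esub> (RJ_at n k i)
    \<longleftrightarrow> inv\<^bsub>FG n\<^esub> l i \<otimes>\<^bsub>FG n\<^esub> l' i \<in> J_at n k i"
proof -
  interpret c: group_hom "FG n" "RF n k" "\<lambda>x. JK n k #>\<^bsub>FG n\<^esub> x" by (rule RF_coset_hom)
  have lc: "l i \<in> carrier (FG n)" "l' i \<in> carrier (FG n)" using D.lam_closed D'.lam_closed i by auto
  let ?g = "inv\<^bsub>FG n\<^esub> l i \<otimes>\<^bsub>FG n\<^esub> l' i"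
  have g: "?g \<in> carrier (FG n)" using lc by simp
  have "inv\<^bsub>RF n k\<^esub> (JK n k #>\<^bsub>FG n\<^esub> l i) \<otimes>\<^bsub>RF n k\<^esub> (JK n k #>\<^bsub>FG n\<^esub> l' i) = JK n k #>\<^bsub>FG n\<^esub> ?g"
    using lc by simp
  moreover have "JK n k #>\<^bsub>FG n\<^esub> ?g \<in> RJ_at n k i \<longleftrightarrow> ?g \<in> J_at n k i"
  proof
    assume "JK n k #>\<^bsub>FG n\<^esub> ?g \<in> RJ_at n k i"
    then obtain h where h: "h \<in> J_at n k i" "JK n k #>\<^bsub>FG n\<^esub> ?g = JK n k #>\<^bsub>FG n\<^esub> h" by (auto simp: RJ_at_def)
    have hc: "h \<in> carrier (FG n)" by (rule F.normal_subsetD[OF J_at_normal h(1)])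
    have "?g \<otimes>\<^bsub>FG n\<^esub> inv\<^bsub>FG n\<^esub> h \<in> J_at n k i"
      using F.coset_eq_iff[OF JK_normal g hc] h(2) JK_subset_J_at by blast
    then have "(?g \<otimes>\<^bsub>FG n\<^esub> inv\<^bsub>FG n\<^esub> h) \<otimes>\<^bsub>FG n\<^esub> h \<in> J_at n k i"
      using h(1) subgroup.m_closed[OF normal_imp_subgroup[OF J_at_normal]] by blast
    moreover have "(?g \<otimes>\<^bsub>FG n\<^esub> inv\<^bsub>FG n\<^esub> h) \<otimes>\<^bsub>FG n\<^esub> h = ?g"
      using F.m_assoc[OF g F.inv_closed[OF hc] hc] F.l_inv[OF hc] F.r_one[OF g] by simp
    ultimately show "?g \<in> J_at n k i" by simp
  qed (auto simp: RJ_at_def)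
  ultimately show ?thesis
    using c.hom_closed[OF lc(1)] c.hom_closed[OF lc(2)]
    by (simp add: r_congruent_def D.reduced_longitude_eq[OF i] D'.reduced_longitude_eq[OF i])
qed

text \<open>The admissible \<open>u\<close> are the words at which membership in
  \<open>J_at n k i\<close> is tested. The empty word, which gives no Milnor index, causes no gap:
  both constant terms are \<open>1\<close>.\<close>

lemma milnor_iff_congruent:
  assumes i: "i \<in> {1..n}"
  shows "(\<forall>u. u \<noteq> [] \<and> set (u @ [i]) \<subseteq> {1..n} \<and> max_repetition (u @ [i]) \<le> k \<longrightarrow>
      milnor n D (u @ [i]) = milnor n D' (u @ [i]))
    \<longleftrightarrow> inv\<^bsub>FG n\<^esub> l i \<otimes>\<^bsub>FG n\<^esub> l' i \<in> J_at n k i"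
proof -
  let ?B = "adm n ((\<lambda>_. k + 1)(i := k))"
  have lc: "l i \<in> carrier (FG n)" "l' i \<in> carrier (FG n)" using D.lam_closed D'.lam_closed i by auto
  have len: "length u \<le> n * k" if "u \<in> ?B" for u
  proof -
    have "(\<Sum>j\<in>{1..n}. ((\<lambda>_. k + 1)(i := k)) j - 1) \<le> (\<Sum>j\<in>{1..n}. k)" by (rule sum_mono) simp
    then show ?thesis using adm_length[OF that] by simp
  qed
  have "(\<forall>u. u \<noteq> [] \<and> set (u @ [i]) \<subseteq> {1..n} \<and> max_repetition (u @ [i]) \<le> k \<longrightarrow>
      milnor n D (u @ [i]) = milnor n D' (u @ [i]))
    \<longleftrightarrow> (\<forall>u\<in>?B. u \<noteq> [] \<longrightarrow> coeff (mag n (l i)) u = coeff (mag n (l' i)) u)"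
    using milnor_index_iff[OF i, of _ k] D.milnor_eq[OF i len] D'.milnor_eq[OF i len] by auto
  also have "\<dots> \<longleftrightarrow> vanish ?B (mag n (l i) - mag n (l' i))"
    using lc by (auto simp: vanish_def)
  also have "\<dots> \<longleftrightarrow> inv\<^bsub>FG n\<^esub> l i \<otimes>\<^bsub>FG n\<^esub> l' i \<in> J_at n k i"
    unfolding J_at_eq by (rule magnus_kernel_coset_iff[OF factor_closed_adm lc, symmetric])
  finally show ?thesis .
qed

text \<open>The conjugates agree iff \<open>l' i \<otimes> inv (l i)\<close> commutes with
  \<open>alpha n i\<close> modulo \<open>JK n k\<close>. Both longitudes being preferred,
  \<open>centralizer_alpha\<close> applies to this quotient; normality of \<open>J_at n k i\<close>
  then exchanges the order of its factors.\<close>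

lemma conj_eq_iff_congruent:
  assumes i: "i \<in> {1..n}"
  defines "R \<equiv> RF n k" and "a \<equiv> RF_gen n k i"
    and "x \<equiv> reduced_longitude n k D i" and "x' \<equiv> reduced_longitude n k D' i"
  shows "inv\<^bsub>R\<^esub> x \<otimes>\<^bsub>R\<^esub> a \<otimes>\<^bsub>R\<^esub> x = inv\<^bsub>R\<^esub> x' \<otimes>\<^bsub>R\<^esub> a \<otimes>\<^bsub>R\<^esub> x'
    \<longleftrightarrow> inv\<^bsub>FG n\<^esub> l i \<otimes>\<^bsub>FG n\<^esub> l' i \<in> J_at n k i"
proof -
  let ?F = "FG n" and ?J = "JK n k" and ?a = "alpha n i"
  interpret c: group_hom ?F R "\<lambda>x. ?J #>\<^bsub>?F\<^esub> x" unfolding R_def by (rule RF_coset_hom)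
  have lc: "l i \<in> carrier ?F" "l' i \<in> carrier ?F" "?a \<in> carrier ?F"
    using D.lam_closed D'.lam_closed free_gen_closed[of i "{1..n}"] i by auto
  let ?g = "l' i \<otimes>\<^bsub>?F\<^esub> inv\<^bsub>?F\<^esub> l i"
  have g: "?g \<in> carrier ?F" using lc by simp
  have xs: "x = ?J #>\<^bsub>?F\<^esub> l i" "x' = ?J #>\<^bsub>?F\<^esub> l' i" "a = ?J #>\<^bsub>?F\<^esub> ?a"
    by (simp_all add: x_def x'_def a_def D.reduced_longitude_eq[OF i] D'.reduced_longitude_eq[OF i] RF_gen_def)
  let ?u = "inv\<^bsub>?F\<^esub> l i \<otimes>\<^bsub>?F\<^esub> ?a \<otimes>\<^bsub>?F\<^esub> l i" and ?v = "inv\<^bsub>?F\<^esub> l' i \<otimes>\<^bsub>?F\<^esub> ?a \<otimes>\<^bsub>?F\<^esub> l' i"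
  have uv: "?u \<in> carrier ?F" "?v \<in> carrier ?F" using lc by simp_all
  have "inv\<^bsub>R\<^esub> x \<otimes>\<^bsub>R\<^esub> a \<otimes>\<^bsub>R\<^esub> x = ?J #>\<^bsub>?F\<^esub> ?u" "inv\<^bsub>R\<^esub> x' \<otimes>\<^bsub>R\<^esub> a \<otimes>\<^bsub>R\<^esub> x' = ?J #>\<^bsub>?F\<^esub> ?v"
    unfolding xs using lc by simp_all
  then have "inv\<^bsub>R\<^esub> x \<otimes>\<^bsub>R\<^esub> a \<otimes>\<^bsub>R\<^esub> x = inv\<^bsub>R\<^esub> x' \<otimes>\<^bsub>R\<^esub> a \<otimes>\<^bsub>R\<^esub> x' \<longleftrightarrow> ?u \<otimes>\<^bsub>?F\<^esub> inv\<^bsub>?F\<^esub> ?v \<in> ?J"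
    using F.coset_eq_iff[OF JK_normal uv] by simp
  also have "\<dots> \<longleftrightarrow> F.comm n ?g ?a \<in> ?J"
  proof
    assume "?u \<otimes>\<^bsub>?F\<^esub> inv\<^bsub>?F\<^esub> ?v \<in> ?J"
    then have "l' i \<otimes>\<^bsub>?F\<^esub> (?u \<otimes>\<^bsub>?F\<^esub> inv\<^bsub>?F\<^esub> ?v) \<otimes>\<^bsub>?F\<^esub> inv\<^bsub>?F\<^esub> l' i \<in> ?J"
      by (rule F.normal_invE(2)[OF JK_normal lc(2)])
    then show "F.comm n ?g ?a \<in> ?J" using lc by (simp add: gcomm_def F.inv_mult_group F.m_assoc)
  next
    assume "F.comm n ?g ?a \<in> ?J"
    then have "inv\<^bsub>?F\<^esub> l' i \<otimes>\<^bsub>?F\<^esub> F.comm n ?g ?a \<otimes>\<^bsub>?F\<^esub> l' i \<in> ?J"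
      by (rule F.normal_conj_inv[OF JK_normal lc(2)])
    then show "?u \<otimes>\<^bsub>?F\<^esub> inv\<^bsub>?F\<^esub> ?v \<in> ?J" using lc by (simp add: gcomm_def F.inv_mult_group F.m_assoc)
  qed
  also have "\<dots> \<longleftrightarrow> ?g \<in> J_at n k i"
  proof (rule centralizer_alpha[OF i k g])
    have "subgroup (magnus_kernel n (pure_powers i)) ?F"
      by (intro normal_imp_subgroup magnus_kernel_normal factor_closed_pure_powers)
    then show "?g \<in> magnus_kernel n (pure_powers i)"
      using D.lam_pure_powers[OF i] D'.lam_pure_powers[OF i] by (simp add: subgroup.m_closed subgroup.m_inv_closed)
  qed
  also have "\<dots> \<longleftrightarrow> inv\<^bsub>?F\<^esub> l i \<otimes>\<^bsub>?F\<^esub> l' i \<in> J_at n k i"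
  proof
    assume "?g \<in> J_at n k i"
    then have "inv\<^bsub>?F\<^esub> l i \<otimes>\<^bsub>?F\<^esub> ?g \<otimes>\<^bsub>?F\<^esub> l i \<in> J_at n k i" by (rule F.normal_conj_inv[OF J_at_normal lc(1)])
    then show "inv\<^bsub>?F\<^esub> l i \<otimes>\<^bsub>?F\<^esub> l' i \<in> J_at n k i" using lc by (simp add: F.m_assoc)
  next
    assume "inv\<^bsub>?F\<^esub> l i \<otimes>\<^bsub>?F\<^esub> l' i \<in> J_at n k i"
    then have "l i \<otimes>\<^bsub>?F\<^esub> (inv\<^bsub>?F\<^esub> l i \<otimes>\<^bsub>?F\<^esub> l' i) \<otimes>\<^bsub>?F\<^esub> inv\<^bsub>?F\<^esub> l i \<in> J_at n k i"
      by (rule F.normal_invE(2)[OF J_at_normal lc(1)])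
    then show "?g \<in> J_at n k i" using lc by (simp add: F.m_assoc)
  qed
  finally show ?thesis .
qed

lemma reduced_action_spec:
  assumes "E = D \<or> E = D'"
  shows "reduced_action n k E \<in> Aut_c n k"
    and "\<And>i. i \<in> {1..n} \<Longrightarrow> reduced_action n k E (RF_gen n k i) =
      inv\<^bsub>RF n k\<^esub> reduced_longitude n k E i \<otimes>\<^bsub>RF n k\<^esub> RF_gen n k i \<otimes>\<^bsub>RF n k\<^esub> reduced_longitude n k E i"
proof -
  have "reduced_longitude n k E \<in> {1..n} \<rightarrow> carrier (RF n k)"
    using assms D.lam_closed D'.lam_closed
    by (auto simp: D.reduced_longitude_eq D'.reduced_longitude_eq carrier_RF)
  from theI'[OF conj_automorphism[OF this]]
  show "reduced_action n k E \<in> Aut_c n k"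
    and "\<And>i. i \<in> {1..n} \<Longrightarrow> reduced_action n k E (RF_gen n k i) =
      inv\<^bsub>RF n k\<^esub> reduced_longitude n k E i \<otimes>\<^bsub>RF n k\<^esub> RF_gen n k i \<otimes>\<^bsub>RF n k\<^esub> reduced_longitude n k E i"
    unfolding reduced_action_def by blast+
qed

text \<open>The actions are extensional homomorphisms of \<open>RF n k\<close>, so they are equal
  once they agree on its generators.\<close>

lemma reduced_action_eq_iff:
  "reduced_action n k D = reduced_action n k D' \<longleftrightarrow>
    (\<forall>i\<in>{1..n}. inv\<^bsub>FG n\<^esub> l i \<otimes>\<^bsub>FG n\<^esub> l' i \<in> J_at n k i)"
proof -
  have D: "reduced_action n k D \<in> Aut_c n k" "reduced_action n k D' \<in> Aut_c n k"
    by (rule reduced_action_spec(1); simp)+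
  have "reduced_action n k D = reduced_action n k D' \<longleftrightarrow>
    (\<forall>i\<in>{1..n}. reduced_action n k D (RF_gen n k i) = reduced_action n k D' (RF_gen n k i))"
  proof
    assume gen: "\<forall>i\<in>{1..n}. reduced_action n k D (RF_gen n k i) = reduced_action n k D' (RF_gen n k i)"
    show "reduced_action n k D = reduced_action n k D'"
    proof (rule extensionalityI[of _ "carrier (RF n k)"])
      show "reduced_action n k D \<in> extensional (carrier (RF n k))"
        "reduced_action n k D' \<in> extensional (carrier (RF n k))"
        using D unfolding Aut_c_def auto_def Bij_def by blast+
      show "reduced_action n k D x = reduced_action n k D' x" if x: "x \<in> carrier (RF n k)" for x
      proof (rule RF_hom_unique[OF group_RF _ _ _ x])
        show "reduced_action n k D \<in> hom (RF n k) (RF n k)" "reduced_action n k D' \<in> hom (RF n k) (RF n k)"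
          using D unfolding Aut_c_def auto_def by blast+
      qed (use gen in blast)
    qed
  qed simp
  also have "\<dots> \<longleftrightarrow> (\<forall>i\<in>{1..n}. inv\<^bsub>FG n\<^esub> l i \<otimes>\<^bsub>FG n\<^esub> l' i \<in> J_at n k i)"
    by (rule ball_cong[OF HOL.refl])
      (simp only: reduced_action_spec(2) conj_eq_iff_congruent disj_commute HOL.refl simp_thms)
  finally show ?thesis .
qed

end

lemma welded_string_linksD:
  "L \<in> welded_string_links p n \<Longrightarrow> D \<in> L \<Longrightarrow> string_link_diagram p n D"
  by (auto simp: welded_string_links_def quotient_def)

theorem theorem2p8:
  fixes n k :: nat and p :: "nat \<Rightarrow> real"
    and L L' :: "link_diagram set" and D D' :: link_diagram
  assumes "1 \<le> n" and "1 \<le> k"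
    and "strict_mono_on {1..n} p" and "p ` {1..n} \<subseteq> {0<..<1}"
    and "L \<in> welded_string_links p n" and "D \<in> L"
    and "L' \<in> welded_string_links p n" and "D' \<in> L'"
  shows "((\<forall>I. set I \<subseteq> {1..n} \<and> 2 \<le> length I \<and> max_repetition I \<le> k \<longrightarrow>
              milnor n D I = milnor n D' I)
          \<longleftrightarrow>
          (\<forall>i\<in>{1..n}. (reduced_longitude n k D i, reduced_longitude n k D' i)
                         \<in> rcong\<^bsub>RF n k\<^esub> (RJ_at n k i)))
         \<and>
         ((\<forall>i\<in>{1..n}. (reduced_longitude n k D i, reduced_longitude n k D' i)
                         \<in> rcong\<^bsub>RF n k\<^esub> (RJ_at n k i))
          \<longleftrightarrow>
          reduced_action n k D = reduced_action n k D')"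
proof -
  interpret D: arc_diagram n D
    by (rule string_link_arc_diagram[OF welded_string_linksD[OF assms(5,6)]])
  interpret D': arc_diagram n D'
    by (rule string_link_arc_diagram[OF welded_string_linksD[OF assms(7,8)]])
  interpret two_diagrams n D D' k by unfold_locales (rule assms(2))
  \<comment> \<open>An index of length at least two is \<open>u @ [i]\<close> with \<open>u\<close>
    nonempty; grouping by \<open>i\<close> collects the invariants read off from the
    \<open>i\<close>th longitude.\<close>
  have "(\<forall>I. set I \<subseteq> {1..n} \<and> 2 \<le> length I \<and> max_repetition I \<le> k \<longrightarrow> milnor n D I = milnor n D' I)
    \<longleftrightarrow> (\<forall>i\<in>{1..n}. \<forall>u. u \<noteq> [] \<and> set (u @ [i]) \<subseteq> {1..n} \<and> max_repetition (u @ [i]) \<le> k \<longrightarrow>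
      milnor n D (u @ [i]) = milnor n D' (u @ [i]))" (is "?lhs \<longleftrightarrow> ?rhs")
  proof
    assume ?lhs
    moreover have "2 \<le> length (u @ [i])" if "u \<noteq> []" for u and i :: nat using that by (cases u) auto
    ultimately show ?rhs by blast
  next
    assume rhs: ?rhs
    show ?lhs
    proof (intro allI impI)
      fix I assume I: "set I \<subseteq> {1..n} \<and> 2 \<le> length I \<and> max_repetition I \<le> k"
      then have "I \<noteq> []" by auto
      then obtain u i where ui: "I = u @ [i]" by (metis append_butlast_last_id)
      have "i \<in> {1..n}" "u \<noteq> []" using I ui by auto
      then show "milnor n D I = milnor n D' I" using rhs I unfolding ui by blast
    qed
  qed
  also have "?rhs \<longleftrightarrow> (\<forall>i\<in>{1..n}. inv\<^bsub>FG n\<^esub> l i \<otimes>\<^bsub>FG n\<^esub> l' i \<in> J_at n k i)"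
    using milnor_iff_congruent by (rule ball_cong[OF HOL.refl])
  finally have "?lhs \<longleftrightarrow> (\<forall>i\<in>{1..n}. inv\<^bsub>FG n\<^esub> l i \<otimes>\<^bsub>FG n\<^esub> l' i \<in> J_at n k i)" .
  moreover have "(\<forall>i\<in>{1..n}. (reduced_longitude n k D i, reduced_longitude n k D' i)
      \<in> rcong\<^bsub>RF n k\<^esub> (RJ_at n k i)) \<longleftrightarrow> (\<forall>i\<in>{1..n}. inv\<^bsub>FG n\<^esub> l i \<otimes>\<^bsub>FG n\<^esub> l' i \<in> J_at n k i)"
    using congruent_iff by (rule ball_cong[OF HOL.refl])
  ultimately show ?thesis using reduced_action_eq_iff by blast
qed

end
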